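(* Let $(\mu;\nu)$ be a bipartition of $n\ge 1$ and let $\Lambda_{(r_i),I}$ be the enhanced quiver variety attached to $(\mu;\nu)$ (defined in the context). If $\Lambda_{(r_i),I}$ is a normal variety, then the closure $\overline{\mathcal{O}_{\mu;\nu}}$ of the enhanced nilpotent orbit $\mathcal{O}_{\mu;\nu}\subset \mathbb{C}^n\times\mathcal{N}_{\mathbb{C}^n}$ is a normal variety.
   Context: A bipartition of $n$ is an ordered pair $(\mu;\nu)$ of partitions with $|\mu|+|\nu|=n$. For a finite-dimensional complex vector space $V$, $\mathcal{N}_V$ denotes the variety of nilpotent endomorphisms of $V$; $GL(V)$ acts on $V\times\mathcal{N}_V$ by $g\cdot(v,x)=(gv,gxg^{-1})$. For a bipartition $(\mu;\nu)$ of $\dim V$, $\mathcal{O}_{\mu;\nu}$ is the set of $(v,x)\in V\times\mathcal{N}_V$ for which there is a basis $\{e_{i,j}: i\ge 1,\ 1\le j\le \mu_i+\nu_i\}$ of $V$ with $xe_{i,j}=e_{i,j-1}$ (where $e_{i,0}=0$) and $v=\sum_{i:\mu_i>0}e_{i,\mu_i}$; these sets are exactly the $GL(V)$-orbits in $V\times\mathcal{N}_V$. Enhanced quiver variety: given the bipartition $(\mu;\nu)$ of $n$, let $\lambda=\mu+\nu$ (termwise sum), $t=\lambda_1$, and $r_i=\lambda^{\mathbf t}_{t-i}$ for $0\le i\le t-1$ (where $\lambda^{\mathbf t}$ is the transpose partition), so $0<r_0\le r_1\le\cdots\le r_{t-1}$ are the column lengths of $\lambda$ in increasing order. Let $I\subset\{0,\dots,t-1\}$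 be the unique subset such that $(r_i)_{i\in I}$ are the column lengths of $\mu$ (in non-decreasing order) and such that $r_i=r_{i+1}$ and $i+1\in I$ imply $i\in I$; let $\bar I=\{0,\dots,t-1\}\setminus I$. Let $U_i=\mathbb{C}^{r_0+\cdots+r_{i-1}}$ for $0\le i\le t$ (so $U_0=0$, $U_t=\mathbb{C}^n$). Then $\Lambda_{(r_i),I}$ is the affine variety of tuples $(u_0,\dots,u_t,A_0,\dots,A_{t-1},B_0,\dots,B_{t-1})$ with $u_i\in U_i$, $A_i\in\mathrm{Hom}(U_i,U_{i+1})$, $B_i\in\mathrm{Hom}(U_{i+1},U_i)$, satisfying $B_iA_i=A_{i-1}B_{i-1}$ for $1\le i\le t-1$, $B_iu_{i+1}=u_i$ for $i\in I$, and $A_iu_i=u_{i+1}$ for $i\in\bar I$. *)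

theory Defs
  imports Complex_Main
begin

inductive_set polyfun :: "('a \<Rightarrow> complex) set \<Rightarrow> ('a \<Rightarrow> complex) set"
  for C :: "('a \<Rightarrow> complex) set" where
  pf_const: "(\<lambda>_. c) \<in> polyfun C"
| pf_coord: "f \<in> C \<Longrightarrow> f \<in> polyfun C"
| pf_add: "f \<in> polyfun C \<Longrightarrow> g \<in> polyfun C \<Longrightarrow> (\<lambda>x. f x + g x) \<in> polyfun C"
| pf_mult: "f \<in> polyfun C \<Longrightarrow> g \<in> polyfun C \<Longrightarrow> (\<lambda>x. f x * g x) \<in> polyfun C"

definition zariski_closure ::
  "'a set \<Rightarrow> ('a \<Rightarrow> complex) set \<Rightarrow> 'a set \<Rightarrow> 'a set" where
  "zariski_closure Amb C S =
     {p \<in> Amb. \<forall>f \<in> polyfun C. (\<forall>q \<in> S. f q = 0) \<longrightarrow> f p = 0}"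

text \<open>An affine variety X (with coordinate ring = restrictions of polynomial
functions to X, a reduced finitely generated C-algebra) is normal iff its
coordinate ring is integrally closed in its total ring of fractions:
every fraction f/g (g a non-zero-divisor) that is integral over the
coordinate ring already lies in it.\<close>
definition normal_variety :: "('a \<Rightarrow> complex) set \<Rightarrow> 'a set \<Rightarrow> bool" where
  "normal_variety C X \<longleftrightarrow>
    (\<forall>f \<in> polyfun C. \<forall>g \<in> polyfun C.
       (\<forall>h \<in> polyfun C. (\<forall>x \<in> X. g x * h x = 0) \<longrightarrow> (\<forall>x \<in> X. h x = 0)) \<longrightarrow>
       (\<exists>m::nat. m > 0 \<and> (\<exists>a :: nat \<Rightarrow> 'a \<Rightarrow> complex. (\<forall>i. a i \<in> polyfun C) \<and>
           (\<forall>x \<in> X. f x ^ m + (\<Sum>i=1..m. a i x * f x ^ (m - i) * g x ^ i) = 0))) \<longrightarrow>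
       (\<exists>h \<in> polyfun C. \<forall>x \<in> X. f x = h x * g x))"

definition is_partition :: "(nat \<Rightarrow> nat) \<Rightarrow> bool" where
  "is_partition p \<longleftrightarrow> p 0 = 0 \<and> (\<forall>i\<ge>1. p (Suc i) \<le> p i) \<and> finite {i. p i \<noteq> 0}"

definition psize :: "(nat \<Rightarrow> nat) \<Rightarrow> nat" where
  "psize p = (\<Sum>i \<in> {i. p i \<noteq> 0}. p i)"

definition ptrans :: "(nat \<Rightarrow> nat) \<Rightarrow> nat \<Rightarrow> nat" where
  "ptrans p k = (if k = 0 then 0 else card {i. 1 \<le> i \<and> k \<le> p i})"

definition vec_in :: "nat \<Rightarrow> (nat \<Rightarrow> complex) \<Rightarrow> bool" where
  "vec_in n w \<longleftrightarrow> (\<forall>a\<ge>n. w a = 0)"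

definition mat_in :: "nat \<Rightarrow> nat \<Rightarrow> (nat \<Rightarrow> nat \<Rightarrow> complex) \<Rightarrow> bool" where
  "mat_in m k M \<longleftrightarrow> (\<forall>a b. (m \<le> a \<or> k \<le> b) \<longrightarrow> M a b = 0)"

definition mv :: "nat \<Rightarrow> (nat \<Rightarrow> nat \<Rightarrow> complex) \<Rightarrow> (nat \<Rightarrow> complex) \<Rightarrow> (nat \<Rightarrow> complex)" where
  "mv k M w = (\<lambda>a. \<Sum>b<k. M a b * w b)"

definition nilpotent_mat :: "nat \<Rightarrow> (nat \<Rightarrow> nat \<Rightarrow> complex) \<Rightarrow> bool" where
  "nilpotent_mat n x \<longleftrightarrow> mat_in n n x \<and> (\<exists>k. \<forall>w. vec_in n w \<longrightarrow> (mv n x ^^ k) w = (\<lambda>_. 0))"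

definition VN_ambient :: "nat \<Rightarrow> ((nat \<Rightarrow> complex) \<times> (nat \<Rightarrow> nat \<Rightarrow> complex)) set" where
  "VN_ambient n = {(v, x). vec_in n v \<and> mat_in n n x}"

definition VN_coords :: "nat \<Rightarrow> (((nat \<Rightarrow> complex) \<times> (nat \<Rightarrow> nat \<Rightarrow> complex)) \<Rightarrow> complex) set" where
  "VN_coords n = {(\<lambda>(v, x). v a) | a. a < n} \<union> {(\<lambda>(v, x). x a b) | a b. a < n \<and> b < n}"

definition bip_index :: "(nat \<Rightarrow> nat) \<Rightarrow> (nat \<Rightarrow> nat) \<Rightarrow> (nat \<times> nat) set" where
  "bip_index \<mu> \<nu> = {(i, j). 1 \<le> i \<and> 1 \<le> j \<and> j \<le> \<mu> i + \<nu> i}"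

definition is_basis_family :: "nat \<Rightarrow> (nat \<times> nat) set \<Rightarrow> (nat \<times> nat \<Rightarrow> nat \<Rightarrow> complex) \<Rightarrow> bool" where
  "is_basis_family n J e \<longleftrightarrow> (\<forall>p \<in> J. vec_in n (e p)) \<and>
     (\<forall>w. vec_in n w \<longrightarrow> (\<exists>!c. (\<forall>p. p \<notin> J \<longrightarrow> c p = 0) \<and>
                                  w = (\<lambda>a. \<Sum>p\<in>J. c p * e p a)))"

definition enh_orbit :: "nat \<Rightarrow> (nat \<Rightarrow> nat) \<Rightarrow> (nat \<Rightarrow> nat) \<Rightarrow>
    ((nat \<Rightarrow> complex) \<times> (nat \<Rightarrow> nat \<Rightarrow> complex)) set" where
  "enh_orbit n \<mu> \<nu> = {(v, x). vec_in n v \<and> nilpotent_mat n x \<and>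
     (\<exists>e. is_basis_family n (bip_index \<mu> \<nu>) e \<and>
          (\<forall>(i, j) \<in> bip_index \<mu> \<nu>. mv n x (e (i, j)) = (if j = 1 then (\<lambda>_. 0) else e (i, j - 1))) \<and>
          v = (\<lambda>a. \<Sum>i \<in> {i. 1 \<le> i \<and> 0 < \<mu> i}. e (i, \<mu> i) a))}"

definition qdim :: "(nat \<Rightarrow> nat) \<Rightarrow> nat \<Rightarrow> nat" where
  "qdim r i = (\<Sum>k<i. r k)"

type_synonym quiver_pt =
  "(nat \<Rightarrow> nat \<Rightarrow> complex) \<times> (nat \<Rightarrow> nat \<Rightarrow> nat \<Rightarrow> complex) \<times> (nat \<Rightarrow> nat \<Rightarrow> nat \<Rightarrow> complex)"

text \<open>(u, A, B): u i a = a-th coordinate of u_i in U_i = C^(qdim r i);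
A i a b = entry (a,b) of A_i : U_i -> U_(i+1); B i a b = entry of B_i : U_(i+1) -> U_i.\<close>
definition quiver_ambient :: "nat \<Rightarrow> (nat \<Rightarrow> nat) \<Rightarrow> quiver_pt set" where
  "quiver_ambient t r = {(u, A, B).
     (\<forall>i a. \<not> (i \<le> t \<and> a < qdim r i) \<longrightarrow> u i a = 0) \<and>
     (\<forall>i a b. \<not> (i < t \<and> a < qdim r (Suc i) \<and> b < qdim r i) \<longrightarrow> A i a b = 0) \<and>
     (\<forall>i a b. \<not> (i < t \<and> a < qdim r i \<and> b < qdim r (Suc i)) \<longrightarrow> B i a b = 0)}"

definition quiver_coords :: "nat \<Rightarrow> (nat \<Rightarrow> nat) \<Rightarrow> (quiver_pt \<Rightarrow> complex) set" where
  "quiver_coords t r =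
     {(\<lambda>(u, A, B). u i a) | i a. i \<le> t \<and> a < qdim r i} \<union>
     {(\<lambda>(u, A, B). A i a b) | i a b. i < t \<and> a < qdim r (Suc i) \<and> b < qdim r i} \<union>
     {(\<lambda>(u, A, B). B i a b) | i a b. i < t \<and> a < qdim r i \<and> b < qdim r (Suc i)}"

definition enh_quiver_variety :: "nat \<Rightarrow> (nat \<Rightarrow> nat) \<Rightarrow> nat set \<Rightarrow> quiver_pt set" where
  "enh_quiver_variety t r I = {(u, A, B). (u, A, B) \<in> quiver_ambient t r \<and>
     (\<forall>i. 1 \<le> i \<and> i \<le> t - 1 \<longrightarrow> (\<forall>a b. a < qdim r i \<and> b < qdim r i \<longrightarrow>
        (\<Sum>c<qdim r (Suc i). B i a c * A i c b) = (\<Sum>c<qdim r (i - 1). A (i - 1) a c * B (i - 1) c b))) \<and>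
     (\<forall>i \<in> I. \<forall>a < qdim r i. (\<Sum>c<qdim r (Suc i). B i a c * u (Suc i) c) = u i a) \<and>
     (\<forall>i \<in> {0..<t} - I. \<forall>a < qdim r (Suc i). (\<Sum>c<qdim r i. A i a c * u i c) = u (Suc i) a)}"

definition bip_t :: "(nat \<Rightarrow> nat) \<Rightarrow> (nat \<Rightarrow> nat) \<Rightarrow> nat" where
  "bip_t \<mu> \<nu> = \<mu> 1 + \<nu> 1"

definition bip_r :: "(nat \<Rightarrow> nat) \<Rightarrow> (nat \<Rightarrow> nat) \<Rightarrow> nat \<Rightarrow> nat" where
  "bip_r \<mu> \<nu> i = ptrans (\<lambda>k. \<mu> k + \<nu> k) (bip_t \<mu> \<nu> - i)"

definition is_bip_I :: "(nat \<Rightarrow> nat) \<Rightarrow> (nat \<Rightarrow> nat) \<Rightarrow> nat set \<Rightarrow> bool" where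
  "is_bip_I \<mu> \<nu> I \<longleftrightarrow> I \<subseteq> {0..<bip_t \<mu> \<nu>} \<and>
     map (bip_r \<mu> \<nu>) (sorted_list_of_set I) = map (\<lambda>k. ptrans \<mu> (\<mu> 1 - k)) [0..<\<mu> 1] \<and>
     (\<forall>i. Suc i < bip_t \<mu> \<nu> \<longrightarrow> bip_r \<mu> \<nu> i = bip_r \<mu> \<nu> (Suc i) \<longrightarrow> Suc i \<in> I \<longrightarrow> i \<in> I)"

end

(* Let X be the quiver variety, Y the orbit closure and pi : X -> Y, (u, A, B) |-> (u_t, A_(t-1) B_(t-1)).

   X is a cone, because the relations are homogeneous for suitable positive weights.  A normal cone is
   irreducible: if D g = 0 with D, g nonzero, one finds k annihilated by D such that D + k is a
   non-zero-divisor (Hilbert's basis theorem), and k / (D + k) is an idempotent, hence a regular function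
   that is constant along the rays of the cone.

   A point of the orbit lifts to X by taking U_i to be the image of x^(t-i).  Near the lifted point p0,
   Jordan chains are transported by polynomial formulas (adjugates serve as inverses up to a scalar),
   which gives a polynomial D with D(p0) nonzero such that D(p) nonzero implies that pi(p) lies in the
   orbit.  As X is irreducible, pi maps all of X into Y, and its image contains the orbit.

   If f / g is integral over C[Y], then f o pi = h (g o pi) on X with h regular, by normality of X.  Projecting h
   to the invariants of GL(U_1), ..., GL(U_(t-1)) in turn does not destroy this identity, and by the first
   fundamental theorem together with the relations of the quiver the projected function is h' o pi with h'
   polynomial.  The Reynolds operator is obtained from the Casimir operator, which is positive
   semidefinite for the Fischer inner product on polynomials; the fundamental theorem follows because on
   invariants the Casimir of one half of the variables is a sum of contractions. *)
theory Submission
  imports Defs "HOL-Analysis.Analysis" "HOL-Library.Function_Algebras" "Jordan_Normal_Form.Determinant"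
begin

section \<open>Polynomial functions\<close>

text \<open>Normality is stated through non-zero-divisors, and irreducibility of X is not given
  beforehand. It is needed twice: to force pi(X) into Y although only the points with D nonzero are
  seen to map into the orbit, and to keep g o pi a non-zero-divisor on X.

  The quotient h matters on X only, while the Reynolds projection acts on polynomials. Hence h is
  lifted to a formal polynomial, and the error is controlled by the space of those formal
  polynomials whose product with g o pi vanishes on X; this space is stable under the Lie algebra.

  The order in which the vertices are removed is essential. Once everything attached to the vertices
  below k is gone, GL(U_k) acts only on A_k, B_k and u_k, and u_k counts as one more column of B_k.
  The invariants are then the entries of A_k B_k and A_k u_k, and the quiver relations rewrite both
  by data at later vertices, with x = A_(t-1) B_(t-1) taking over at the end.\<close>

lemma polyfun_sum:
  "(\<And>i. i \<in> S \<Longrightarrow> f i \<in> polyfun C) \<Longrightarrow> (\<lambda>x. \<Sum>i\<in>S. f i x) \<in> polyfun C"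
proof (induction S rule: infinite_finite_induct)
  case (insert i S)
  then have "(\<lambda>x. f i x + (\<Sum>i\<in>S. f i x)) \<in> polyfun C"
    by (intro pf_add) auto
  then show ?case using insert by simp
qed (auto intro: pf_const)

lemma polyfun_prod:
  "(\<And>i. i \<in> S \<Longrightarrow> f i \<in> polyfun C) \<Longrightarrow> (\<lambda>x. \<Prod>i\<in>S. f i x) \<in> polyfun C"
proof (induction S rule: infinite_finite_induct)
  case (insert i S)
  then have "(\<lambda>x. f i x * (\<Prod>i\<in>S. f i x)) \<in> polyfun C"
    by (intro pf_mult) auto
  then show ?case using insert by simp
qed (auto intro: pf_const)

lemma polyfun_power: "f \<in> polyfun C \<Longrightarrow> (\<lambda>x. f x ^ k) \<in> polyfun C"
  by (induction k) (auto intro: pf_const pf_mult)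

lemma polyfun_uminus: "f \<in> polyfun C \<Longrightarrow> (\<lambda>x. - f x) \<in> polyfun C"
  using pf_mult[OF pf_const[of "-1"]] by fastforce

lemma polyfun_minus:
  "f \<in> polyfun C \<Longrightarrow> g \<in> polyfun C \<Longrightarrow> (\<lambda>x. f x - g x) \<in> polyfun C"
  using pf_add[OF _ polyfun_uminus, of f C g] by simp

lemma polyfun_if:
  "(P \<Longrightarrow> f \<in> polyfun C) \<Longrightarrow> (\<not> P \<Longrightarrow> g \<in> polyfun C) \<Longrightarrow>
    (\<lambda>x. if P then f x else g x) \<in> polyfun C"
  by (cases P) auto

lemmas polyfun_intros =
  pf_const pf_add pf_mult polyfun_sum polyfun_prod polyfun_power polyfun_uminus polyfun_minus

lemma polyfun_subst:
  assumes "f \<in> polyfun C" and "\<And>c. c \<in> C \<Longrightarrow> (\<lambda>x. c (\<phi> x)) \<in> polyfun D"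
  shows "(\<lambda>x. f (\<phi> x)) \<in> polyfun D"
  using assms by (induction) (auto intro: polyfun_intros)

lemma polyfun_mono: "f \<in> polyfun C \<Longrightarrow> C \<subseteq> D \<Longrightarrow> f \<in> polyfun D"
  by (induction rule: polyfun.induct) (auto intro: polyfun.intros)

text \<open>Each coordinate may be replaced by a function that equals it only on \<open>X\<close>.
  This is how relations valid on the quiver variety are substituted into a polynomial.\<close>

lemma polyfun_agree:
  assumes "f \<in> polyfun C" and "\<And>c. c \<in> C \<Longrightarrow> \<exists>d \<in> polyfun D. \<forall>x\<in>X. c x = d x"
  shows "\<exists>g \<in> polyfun D. \<forall>x\<in>X. f x = g x"
  using assms
proof (induction)
  case (pf_const c)
  then show ?case by (intro bexI[of _ "\<lambda>_. c"]) (auto intro: polyfun.intros)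
next
  case (pf_add f g)
  then obtain f' g' where "f' \<in> polyfun D" "g' \<in> polyfun D"
    "\<forall>x\<in>X. f x = f' x" "\<forall>x\<in>X. g x = g' x" by blast
  then show ?case by (intro bexI[of _ "\<lambda>x. f' x + g' x"]) (auto intro: polyfun.intros)
next
  case (pf_mult f g)
  then obtain f' g' where "f' \<in> polyfun D" "g' \<in> polyfun D"
    "\<forall>x\<in>X. f x = f' x" "\<forall>x\<in>X. g x = g' x" by blast
  then show ?case by (intro bexI[of _ "\<lambda>x. f' x * g' x"]) (auto intro: polyfun.intros)
qed auto

section \<open>Hilbert's basis theorem for polynomial functions\<close>

text \<open>For a ring \<open>R\<close> of functions this is the ideal generated by
  \<open>S\<close>, grown one term at a time so that membership can be used by induction.\<close>

inductive_set fun_ideal :: "('a \<Rightarrow> complex) set \<Rightarrow> ('a \<Rightarrow> complex) set \<Rightarrow> ('a \<Rightarrow> complex) set"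
  for R S where
  fi_zero: "(\<lambda>_. 0) \<in> fun_ideal R S"
| fi_step: "r \<in> R \<Longrightarrow> s \<in> S \<Longrightarrow> f \<in> fun_ideal R S \<Longrightarrow> (\<lambda>x. r x * s x + f x) \<in> fun_ideal R S"

lemma fun_ideal_add:
  assumes "f \<in> fun_ideal R S" "g \<in> fun_ideal R S"
  shows "(\<lambda>x. f x + g x) \<in> fun_ideal R S"
  using assms
proof (induction)
  case (fi_step r s f)
  then show ?case using fun_ideal.fi_step[of r R s S "\<lambda>x. f x + g x"] by (simp add: add.assoc)
qed simp

lemma fun_ideal_mult:
  assumes "f \<in> fun_ideal (polyfun C) S" "g \<in> polyfun C"
  shows "(\<lambda>x. g x * f x) \<in> fun_ideal (polyfun C) S"
  using assms
proof (induction)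
  case (fi_step r s f)
  then show ?case using fun_ideal.fi_step[of "\<lambda>x. g x * r x" "polyfun C" s S "\<lambda>x. g x * f x"]
    by (simp add: algebra_simps pf_mult)
qed (simp add: fun_ideal.fi_zero)

lemma fun_ideal_base:
  assumes "s \<in> S"
  shows "s \<in> fun_ideal (polyfun C) S"
  using fun_ideal.fi_step[OF pf_const[of 1] assms fun_ideal.fi_zero] by simp

lemma fun_ideal_trans:
  assumes "f \<in> fun_ideal (polyfun C) S" "S \<subseteq> fun_ideal (polyfun C) T"
  shows "f \<in> fun_ideal (polyfun C) T"
  using assms
proof (induction)
  case (fi_step r s f)
  then show ?case by (intro fun_ideal_add fun_ideal_mult) auto
qed (rule fun_ideal.fi_zero)

lemma fun_ideal_mono:
  assumes "f \<in> fun_ideal R S" "S \<subseteq> T"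
  shows "f \<in> fun_ideal R T"
  using assms
proof (induction)
  case (fi_step r s f)
  then show ?case by (intro fun_ideal.fi_step) auto
qed (rule fun_ideal.fi_zero)

lemma fun_ideal_polyfun:
  assumes "f \<in> fun_ideal (polyfun C) S" "S \<subseteq> polyfun C"
  shows "f \<in> polyfun C"
  using assms
proof (induction)
  case (fi_step r s f)
  then show ?case by (intro pf_add pf_mult) auto
qed (rule pf_const)

text \<open>Repeated uses of one generator are collected into a single coefficient; the update at
  \<open>j\<close> does this.\<close>

lemma fun_ideal_coeffs:
  assumes "f \<in> fun_ideal (polyfun C) (g ` {..<n::nat})"
  shows "\<exists>s. (\<forall>i. s i \<in> polyfun C) \<and> f = (\<lambda>x. \<Sum>i<n. s i x * g i x)"
  using assms
proof (induction)
  case fi_zero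
  then show ?case by (intro exI[of _ "\<lambda>_ _. 0"]) (auto intro: pf_const)
next
  case (fi_step r s f)
  then obtain j c where j: "j < n" "s = g j" and c: "\<And>i. c i \<in> polyfun C"
    "f = (\<lambda>x. \<Sum>i<n. c i x * g i x)" by blast
  have "(\<Sum>i<n. (c(j := (\<lambda>x. r x + c j x))) i x * g i x) = r x * s x + f x" for x
  proof -
    have "(\<Sum>i<n. (c(j := (\<lambda>x. r x + c j x))) i x * g i x)
      = (\<Sum>i<n. (if i = j then r x * g j x else 0) + c i x * g i x)"
      by (intro sum.cong) (auto simp: algebra_simps)
    also have "\<dots> = r x * s x + f x"
      using j c(2) by (simp add: sum.distrib sum.delta)
    finally show ?thesis .
  qed
  then show ?case
    using fi_step.hyps c(1)
    by (intro exI[of _ "c(j := (\<lambda>x. r x + c j x))"]) (auto intro: pf_add)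
qed

text \<open>The ascending chain condition for sequences of elements: some member depends on its
  predecessors. In this form it applies directly to the sequences of leading coefficients and of
  annihilators below.\<close>

definition noetherian_fun :: "('a \<Rightarrow> complex) set \<Rightarrow> bool" where
  "noetherian_fun R \<longleftrightarrow>
    (\<forall>f::nat \<Rightarrow> _. range f \<subseteq> R \<longrightarrow> (\<exists>n. f n \<in> fun_ideal R (f ` {..<n})))"

text \<open>The coefficients need not be unique, since \<open>c\<close> may be algebraically
  dependent on \<open>C\<close>. The number \<open>d\<close> counts coefficients, so the zero
  function is represented with \<open>d = 0\<close>.\<close>

lemma polyfun_insert_rep:
  assumes "f \<in> polyfun (insert c C)"
  shows "\<exists>d r. (\<forall>i. r i \<in> polyfun C) \<and> f = (\<lambda>x. \<Sum>i<(d::nat). r i x * c x ^ i)"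
proof -
  define Rep where "Rep = {f. \<exists>d r. (\<forall>i. r i \<in> polyfun C) \<and> f = (\<lambda>x. \<Sum>i<(d::nat). r i x * c x ^ i)}"
  have RepD: "\<exists>d r. (\<forall>i. r i \<in> polyfun C) \<and> f = (\<lambda>x. \<Sum>i<(d::nat). r i x * c x ^ i)" if "f \<in> Rep" for f
    using that unfolding Rep_def by (rule CollectD)
  have RepI: "f \<in> Rep" if "\<forall>i. r i \<in> polyfun C" "f = (\<lambda>x. \<Sum>i<(d::nat). r i x * c x ^ i)" for f d r
    unfolding Rep_def using that by (intro CollectI exI conjI)
  have add: "(\<lambda>x. f x + g x) \<in> Rep" if "f \<in> Rep" "g \<in> Rep" for f g
  proof -
    from RepD[OF that(1)] obtain d r where 1: "\<forall>i. r i \<in> polyfun C" "f = (\<lambda>x. \<Sum>i<(d::nat). r i x * c x ^ i)"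
      by (elim exE conjE)
    from RepD[OF that(2)] obtain e s where 2: "\<forall>i. s i \<in> polyfun C" "g = (\<lambda>x. \<Sum>i<(e::nat). s i x * c x ^ i)"
      by (elim exE conjE)
    define r' where "r' i = (if i < d then r i else (\<lambda>_. 0))" for i
    define s' where "s' i = (if i < e then s i else (\<lambda>_. 0))" for i
    have "f x = (\<Sum>i<max d e. r' i x * c x ^ i)" for x
      unfolding 1 by (rule sum.mono_neutral_cong_left) (auto simp: r'_def)
    moreover have "g x = (\<Sum>i<max d e. s' i x * c x ^ i)" for x
      unfolding 2 by (rule sum.mono_neutral_cong_left) (auto simp: s'_def)
    ultimately have "(\<lambda>x. f x + g x) = (\<lambda>x. \<Sum>i<max d e. (r' i x + s' i x) * c x ^ i)"
      by (simp add: distrib_right sum.distrib)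
    moreover have "\<forall>i. (\<lambda>x. r' i x + s' i x) \<in> polyfun C"
    proof (intro allI pf_add)
      show "r' i \<in> polyfun C" "s' i \<in> polyfun C" for i
        using 1 2 by (simp_all add: r'_def s'_def pf_const)
    qed
    ultimately show ?thesis by (intro RepI)
  qed
  have mulC: "(\<lambda>x. g x * f x) \<in> Rep" if "f \<in> Rep" "g \<in> polyfun C" for f g
  proof -
    from RepD[OF that(1)] obtain d r where 1: "\<forall>i. r i \<in> polyfun C" "f = (\<lambda>x. \<Sum>i<(d::nat). r i x * c x ^ i)"
      by (elim exE conjE)
    then have "(\<lambda>x. g x * f x) = (\<lambda>x. \<Sum>i<d. (g x * r i x) * c x ^ i)"
      by (simp add: sum_distrib_left mult.assoc)
    moreover have "\<forall>i. (\<lambda>x. g x * r i x) \<in> polyfun C"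
      using 1(1) that(2) pf_mult by blast
    ultimately show ?thesis by (intro RepI)
  qed
  have mulc: "(\<lambda>x. c x * f x) \<in> Rep" if "f \<in> Rep" for f
  proof -
    from RepD[OF that(1)] obtain d r where 1: "\<forall>i. r i \<in> polyfun C" "f = (\<lambda>x. \<Sum>i<(d::nat). r i x * c x ^ i)"
      by (elim exE conjE)
    define r' where "r' i = (case i of 0 \<Rightarrow> (\<lambda>_. 0) | Suc j \<Rightarrow> r j)" for i
    have "(\<lambda>x. c x * f x) = (\<lambda>x. \<Sum>i<Suc d. r' i x * c x ^ i)"
      unfolding 1 sum.lessThan_Suc_shift
      by (simp add: r'_def sum_distrib_left mult_ac)
    moreover have "\<forall>i. r' i \<in> polyfun C"
      using 1 by (simp add: r'_def pf_const split: nat.split)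
    ultimately show ?thesis by (intro RepI)
  qed
  have C: "f \<in> Rep" if "f \<in> polyfun C" for f
    using that by (intro RepI[of "\<lambda>_. f" f 1]) simp_all
  have pow: "(\<lambda>x. c x ^ i * f x) \<in> Rep" if "f \<in> Rep" for f i
    using that
  proof (induction i)
    case (Suc i)
    then show ?case using mulc[of "\<lambda>x. c x ^ i * f x"] by (simp add: mult.assoc)
  qed simp
  have mul: "(\<lambda>x. f x * g x) \<in> Rep" if "f \<in> Rep" "g \<in> Rep" for f g
  proof -
    from RepD[OF that(1)] obtain d r where 1: "\<forall>i. r i \<in> polyfun C" "f = (\<lambda>x. \<Sum>i<(d::nat). r i x * c x ^ i)"
      by (elim exE conjE)
    have "(\<lambda>x. \<Sum>i<e. r i x * (c x ^ i * g x)) \<in> Rep" for e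
    proof (induction e)
      case 0
      then show ?case using C[OF pf_const[of 0]] by simp
    next
      case (Suc e)
      then show ?case using add[OF Suc mulC[OF pow[OF that(2)], of "r e"]] 1 by simp
    qed
    then show ?thesis unfolding 1 by (simp add: sum_distrib_right mult.assoc)
  qed
  have "f \<in> Rep" using assms
  proof (induction)
    case (pf_coord f)
    then show ?case using C[OF polyfun.pf_coord] mulc[OF C[OF polyfun.pf_const[of 1]]] by auto
  next
    case (pf_const a)
    show ?case by (rule C[OF polyfun.pf_const])
  next
    case (pf_add f g)
    show ?case by (rule add[OF pf_add.IH])
  next
    case (pf_mult f g)
    show ?case by (rule mul[OF pf_mult.IH])
  qed
  then show ?thesis by (rule RepD)
qed

text \<open>Hilbert's argument with leading coefficients, for functions in place of polynomials. As
  representations by powers of \<open>c\<close> need not be unique, the degree is replaced by the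
  least number \<open>dg\<close> of coefficients in any representation. Each member of the sequence
  \<open>g\<close> has least \<open>dg\<close> among the elements outside the ideal of its
  predecessors; a dependence among leading coefficients then produces such an element with smaller
  \<open>dg\<close>.\<close>

lemma noetherian_insert:
  assumes N: "noetherian_fun (polyfun C)"
  shows "noetherian_fun (polyfun (insert c C))"
proof (rule ccontr)
  let ?P = "polyfun (insert c C)"
  assume "\<not> noetherian_fun ?P"
  then obtain f :: "nat \<Rightarrow> _" where f: "range f \<subseteq> ?P" and bad: "\<And>n. f n \<notin> fun_ideal ?P (f ` {..<n})"
    unfolding noetherian_fun_def by (metis (no_types))
  have CP: "g \<in> ?P" if "g \<in> polyfun C" for g
    using that by (rule polyfun_mono) auto
  define J where "J = fun_ideal ?P (range f)"
  have Jfin: "\<exists>n. h \<in> fun_ideal ?P (f ` {..<n})" if "h \<in> J" for h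
    using that unfolding J_def
  proof (induction)
    case (fi_step r s g)
    from fi_step.IH obtain n where n: "g \<in> fun_ideal ?P (f ` {..<n})" by (rule exE)
    from fi_step.hyps(2) obtain m where m: "s = f m" by (rule rangeE)
    have "(\<lambda>x. r x * s x + g x) \<in> fun_ideal ?P (f ` {..<max n (Suc m)})"
    proof (rule fun_ideal.fi_step[OF fi_step.hyps(1)])
      show "s \<in> f ` {..<max n (Suc m)}" unfolding m by simp
      show "g \<in> fun_ideal ?P (f ` {..<max n (Suc m)})"
        by (rule fun_ideal_mono[OF n]) (simp add: image_mono)
    qed
    then show ?case by (rule exI)
  qed (rule exI, rule fun_ideal.fi_zero)
  define rep where "rep h d r \<longleftrightarrow> (\<forall>i. r i \<in> polyfun C) \<and> h = (\<lambda>x. \<Sum>i<(d::nat). r i x * c x ^ i)" for h d r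
  define dg where "dg h = (LEAST d. \<exists>r. rep h d r)" for h
  have JP: "h \<in> ?P" if "h \<in> J" for h
    using fun_ideal_polyfun[OF that[unfolded J_def] f] .
  have dg: "\<exists>r. rep h (dg h) r" if "h \<in> ?P" for h
    unfolding dg_def by (rule LeastI_ex) (use polyfun_insert_rep[OF that] in \<open>unfold rep_def\<close>)
  have dgle: "dg h \<le> d" if "rep h d r" for h d r
    unfolding dg_def by (rule Least_le) (rule exI, rule that)
  \<comment> \<open>A finite subset of \<open>J\<close> lies in the ideal of an initial segment of
    \<open>f\<close>, so its own ideal misses some \<open>f n\<close>. Hence there is an element of
    \<open>J\<close> outside it, and one of least \<open>dg\<close>.\<close>
  have step: "\<exists>h. h \<in> J - fun_ideal ?P (set gs) \<and> (\<forall>h'\<in>J - fun_ideal ?P (set gs). dg h \<le> dg h')"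
    if "set gs \<subseteq> J" for gs
  proof -
    have "\<exists>n. set gs \<subseteq> fun_ideal ?P (f ` {..<n})" using that
    proof (induction gs)
      case (Cons a gs)
      then have "\<exists>n. set gs \<subseteq> fun_ideal ?P (f ` {..<n})" and aJ: "a \<in> J" by simp_all
      then obtain n where n: "set gs \<subseteq> fun_ideal ?P (f ` {..<n})" by (elim exE)
      from Jfin[OF aJ] obtain m where m: "a \<in> fun_ideal ?P (f ` {..<m})" by (rule exE)
      have "set (a # gs) \<subseteq> fun_ideal ?P (f ` {..<max n m})"
      proof
        fix b assume "b \<in> set (a # gs)"
        then consider "b = a" | "b \<in> set gs" by auto
        then show "b \<in> fun_ideal ?P (f ` {..<max n m})"
        proof cases
          case 1
          show ?thesis unfolding 1 by (rule fun_ideal_mono[OF m]) (simp add: image_mono)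
        next
          case 2
          show ?thesis by (rule fun_ideal_mono[OF subsetD[OF n 2]]) (simp add: image_mono)
        qed
      qed
      then show ?case by (rule exI)
    qed simp
    then obtain n where n: "set gs \<subseteq> fun_ideal ?P (f ` {..<n})" by (rule exE)
    have 1: "f n \<notin> fun_ideal ?P (set gs)"
    proof
      assume "f n \<in> fun_ideal ?P (set gs)"
      from bad[of n] fun_ideal_trans[OF this n] show False by (rule notE)
    qed
    have 2: "f n \<in> J" unfolding J_def by (rule fun_ideal_base) (rule rangeI)
    from ex_has_least_nat[of "\<lambda>h. h \<in> J - fun_ideal ?P (set gs)" "f n" dg, OF DiffI[OF 2 1]]
    show ?thesis by (simp only: Ball_def)
  qed
  define nxt where "nxt gs = (SOME h. h \<in> J - fun_ideal ?P (set gs) \<and>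
      (\<forall>h'\<in>J - fun_ideal ?P (set gs). dg h \<le> dg h'))" for gs
  have nxt: "nxt gs \<in> J - fun_ideal ?P (set gs)"
    "\<And>h'. h' \<in> J - fun_ideal ?P (set gs) \<Longrightarrow> dg (nxt gs) \<le> dg h'" if "set gs \<subseteq> J" for gs
    using someI_ex[OF step[OF that], folded nxt_def] by simp_all
  define G where "G n = ((\<lambda>gs. gs @ [nxt gs]) ^^ n) []" for n
  define g where "g n = nxt (G n)" for n
  have G_Suc: "G (Suc n) = G n @ [g n]" for n by (simp add: G_def g_def)
  have Gset: "set (G n) = g ` {..<n}" for n
    by (induction n) (simp_all add: G_Suc, simp add: G_def, auto simp: lessThan_Suc)
  have GJ: "set (G n) \<subseteq> J" for n
  proof (induction n)
    case (Suc n)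
    then show ?case using nxt(1)[OF Suc] by (simp add: G_Suc g_def)
  qed (simp add: G_def)
  have g1: "g n \<in> J" "g n \<notin> fun_ideal ?P (g ` {..<n})" for n
    using nxt(1)[OF GJ[of n]] Gset[of n] unfolding g_def by auto
  have g2: "dg (g n) \<le> dg h" if "h \<in> J" "h \<notin> fun_ideal ?P (g ` {..<n})" for n h
    using nxt(2)[OF GJ[of n], of h] Gset[of n] that unfolding g_def by auto
  have dgmono: "dg (g i) \<le> dg (g j)" if "i < j" for i j
  proof (rule g2[OF g1(1)])
    show "g j \<notin> fun_ideal ?P (g ` {..<i})"
      using g1(2)[of j] that fun_ideal_mono[of "g j" ?P "g ` {..<i}" "g ` {..<j}"] by fastforce
  qed
  have "\<forall>n. \<exists>r. rep (g n) (dg (g n)) r" using dg JP g1(1) by blast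
  then obtain r where r: "\<And>n. rep (g n) (dg (g n)) (r n)" by metis
  define d where "d n = dg (g n)" for n
  have dpos: "d n > 0" for n
  proof (rule ccontr)
    assume "\<not> d n > 0"
    then have "g n = (\<lambda>_. 0)" using r[of n] unfolding rep_def d_def by simp
    then show False using g1(2)[of n] fun_ideal.fi_zero by metis
  qed
  define l where "l n = r n (d n - 1)" for n
  have "l n \<in> polyfun C" for n using r[of n] unfolding rep_def l_def by blast
  then obtain n where "l n \<in> fun_ideal (polyfun C) (l ` {..<n})"
    using N unfolding noetherian_fun_def by blast
  then obtain s where s: "\<And>i. s i \<in> polyfun C" and ls: "l n = (\<lambda>x. \<Sum>i<n. s i x * l i x)"
    using fun_ideal_coeffs by blast
  \<comment> \<open>The powers of \<open>c\<close> align all leading terms with that of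
    \<open>g n\<close>; the dependence \<open>ls\<close> then cancels the top coefficient.\<close>
  define h where "h x = g n x - (\<Sum>i<n. (s i x * c x ^ (d n - d i)) * g i x)" for x
  have tail: "(\<lambda>x. \<Sum>i\<in>K. (s i x * c x ^ (d n - d i)) * g i x) \<in> fun_ideal ?P (g ` {..<n})" 
    if "K \<subseteq> {..<n}" for K
  proof -
    have "finite K" using that finite_subset by blast
    then show ?thesis using that
    proof (induction K)
      case (insert i K)
      have "(\<lambda>x. (s i x * c x ^ (d n - d i)) * g i x + (\<Sum>i\<in>K. (s i x * c x ^ (d n - d i)) * g i x))
          \<in> fun_ideal ?P (g ` {..<n})"
      proof (rule fun_ideal.fi_step)
        show "(\<lambda>x. s i x * c x ^ (d n - d i)) \<in> ?P"
          by (intro pf_mult polyfun_power CP s polyfun.pf_coord) simp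
      qed (use insert in auto)
      then show ?case using insert by simp
    qed (simp add: fun_ideal.fi_zero)
  qed
  have hJ: "h \<in> J"
  proof -
    have 1: "(\<lambda>x. \<Sum>i<n. (s i x * c x ^ (d n - d i)) * g i x) \<in> J"
      using fun_ideal_trans[OF tail[OF order_refl]] g1(1) unfolding J_def by blast
    have "(\<lambda>x. g n x + (-1) * (\<Sum>i<n. (s i x * c x ^ (d n - d i)) * g i x)) \<in> J"
      using fun_ideal_add fun_ideal_mult[OF 1[unfolded J_def] pf_const[of "-1"]] g1(1)
      unfolding J_def by blast
    then show ?thesis unfolding h_def by simp
  qed
  have hn: "h \<notin> fun_ideal ?P (g ` {..<n})"
  proof
    assume "h \<in> fun_ideal ?P (g ` {..<n})"
    from fun_ideal_add[OF this tail[OF order_refl]] have "g n \<in> fun_ideal ?P (g ` {..<n})"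
      by (simp add: h_def)
    then show False using g1(2) by blast
  qed
  \<comment> \<open>\<open>q k\<close> is the coefficient of \<open>c ^ k\<close> in
    \<open>h\<close>; the case distinction encodes the shift by \<open>d n - d i\<close> without
    negative exponents.\<close>
  define q where "q k x = r n k x - (\<Sum>i<n. if d n - d i \<le> k then s i x * r i (k - (d n - d i)) x else 0)" for k x
  have rp: "r i k \<in> polyfun C" for i k using r[of i] unfolding rep_def by blast
  have gi: "g i x = (\<Sum>k<d i. r i k x * c x ^ k)" for i x using r[of i] unfolding rep_def d_def by metis
  have top: "q (d n - 1) x = 0" for x
  proof -
    have "(\<Sum>i<n. if d n - d i \<le> d n - 1 then s i x * r i (d n - 1 - (d n - d i)) x else 0)
      = (\<Sum>i<n. s i x * l i x)"
    proof (rule sum.cong[OF refl])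
      fix i assume "i \<in> {..<n}"
      then have "d i \<le> d n" using dgmono[of i n] by (simp add: d_def)
      then have "d n - d i \<le> d n - 1" "d n - 1 - (d n - d i) = d i - 1" using dpos[of i] by auto
      then show "(if d n - d i \<le> d n - 1 then s i x * r i (d n - 1 - (d n - d i)) x else 0) = s i x * l i x"
        by (simp add: l_def)
    qed
    with fun_cong[OF ls, of x] show ?thesis unfolding q_def by (simp add: l_def)
  qed
  have hq: "h x = (\<Sum>k<d n. q k x * c x ^ k)" for x
  proof -
    have shift: "s i x * c x ^ (d n - d i) * g i x =
      (\<Sum>k<d n. (if d n - d i \<le> k then s i x * r i (k - (d n - d i)) x else 0) * c x ^ k)" if "i < n" for i
    proof -
      have le: "d i \<le> d n" using dgmono[of i n] that by (simp add: d_def)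
      have "s i x * c x ^ (d n - d i) * g i x = (\<Sum>k<d i. s i x * r i k x * c x ^ (k + (d n - d i)))"
        unfolding gi by (simp add: sum_distrib_left power_add mult_ac)
      also have "\<dots> = (\<Sum>k\<in>{d n - d i..<d n}. s i x * r i (k - (d n - d i)) x * c x ^ k)"
        using le by (intro sum.reindex_bij_witness[of _ "\<lambda>k. k - (d n - d i)" "\<lambda>k. k + (d n - d i)"]) auto
      also have "\<dots> = (\<Sum>k<d n. (if d n - d i \<le> k then s i x * r i (k - (d n - d i)) x else 0) * c x ^ k)"
        by (intro sum.mono_neutral_cong_left) auto
      finally show ?thesis .
    qed
    have "(\<Sum>k<d n. q k x * c x ^ k) = g n x - (\<Sum>k<d n. \<Sum>i<n. (if d n - d i \<le> k then s i x * r i (k - (d n - d i)) x else 0) * c x ^ k)"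
      unfolding q_def gi by (simp add: left_diff_distrib sum_subtractf sum_distrib_right)
    also have "(\<Sum>k<d n. \<Sum>i<n. (if d n - d i \<le> k then s i x * r i (k - (d n - d i)) x else 0) * c x ^ k)
      = (\<Sum>i<n. s i x * c x ^ (d n - d i) * g i x)"
      by (subst sum.swap) (simp add: shift)
    finally show ?thesis by (simp add: h_def)
  qed
  have "rep h (d n - 1) q"
    unfolding rep_def
  proof (intro conjI allI ext)
    show "q i \<in> polyfun C" for i
      unfolding q_def by (intro polyfun_intros polyfun_if rp s)
    fix x
    obtain e where e: "d n = Suc e" using dpos[of n] gr0_conv_Suc by blast
    show "h x = (\<Sum>i<d n - 1. q i x * c x ^ i)" using hq[of x] top[of x] by (simp add: e)
  qed
  then have "dg h \<le> d n - 1" by (rule dgle)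
  moreover have "d n \<le> dg h" using g2[OF hJ hn] by (simp add: d_def)
  ultimately show False using dpos[of n] by simp
qed

lemma polyfun_empty: "f \<in> polyfun {} \<Longrightarrow> \<exists>c. f = (\<lambda>_. c)"
proof (induction rule: polyfun.induct)
  case (pf_add f g)
  then obtain a b where "f = (\<lambda>_. a)" "g = (\<lambda>_. b)" by (elim exE)
  then show ?case by (intro exI[of _ "a + b"]) simp
next
  case (pf_mult f g)
  then obtain a b where "f = (\<lambda>_. a)" "g = (\<lambda>_. b)" by (elim exE)
  then show ?case by (intro exI[of _ "a * b"]) simp
next
  case (pf_const c)
  show ?case by (rule exI) (rule refl)
qed simp

theorem noetherian_polyfun:
  assumes "finite C"
  shows "noetherian_fun (polyfun C)"
  using assms
proof (induction C)
  case empty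
  show ?case unfolding noetherian_fun_def
  proof (intro allI impI)
    fix f :: "nat \<Rightarrow> 'a \<Rightarrow> complex" assume f: "range f \<subseteq> polyfun {}"
    from f have "f 0 \<in> polyfun {}" "f 1 \<in> polyfun {}" by auto
    then obtain a b where ab: "f 0 = (\<lambda>_. a)" "f 1 = (\<lambda>_. b)"
      using polyfun_empty[of "f 0"] polyfun_empty[of "f 1"] by auto
    show "\<exists>n. f n \<in> fun_ideal (polyfun {}) (f ` {..<n})"
    proof (cases "a = 0")
      case True
      then show ?thesis using ab(1) fun_ideal.fi_zero[of "polyfun {}" "f ` {..<0}"] by metis
    next
      case False
      have "(\<lambda>x. b / a * f 0 x + 0) \<in> fun_ideal (polyfun {}) (f ` {..<1})"
        by (rule fun_ideal.fi_step[OF pf_const _ fun_ideal.fi_zero]) simp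
      then show ?thesis using False ab by (intro exI[of _ 1]) simp
    qed
  qed
qed (rule noetherian_insert)

section \<open>Normal cones are integral\<close>

text \<open>If no such \<open>k\<close> existed, one could forever add to \<open>k\<close> a
  function \<open>nx k\<close> that is killed by \<open>G + k\<close> but nonzero on
  \<open>X\<close>. The functions \<open>h n\<close> added in this way are pointwise orthogonal on
  \<open>X\<close>; by noetherianity one of them is a combination of its predecessors, so it must
  vanish on \<open>X\<close>.\<close>

lemma ann_regularize:
  assumes C: "finite C" and G: "G \<in> polyfun C"
  shows "\<exists>k\<in>polyfun C. (\<forall>x\<in>X. G x * k x = 0) \<and>
    (\<forall>h\<in>polyfun C. (\<forall>x\<in>X. (G x + k x) * h x = 0) \<longrightarrow> (\<forall>x\<in>X. h x = 0))"
proof (rule ccontr)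
  assume neg: "\<not> ?thesis"
  have step: "\<exists>h\<in>polyfun C. (\<forall>x\<in>X. (G x + k x) * h x = 0) \<and> (\<exists>x\<in>X. h x \<noteq> 0)"
    if "k \<in> polyfun C" "\<forall>x\<in>X. G x * k x = 0" for k
    using neg that by blast
  define nx where "nx k = (SOME h. h \<in> polyfun C \<and> (\<forall>x\<in>X. (G x + k x) * h x = 0) \<and> (\<exists>x\<in>X. h x \<noteq> 0))" for k
  have nx: "nx k \<in> polyfun C" "\<forall>x\<in>X. (G x + k x) * nx k x = 0" "\<exists>x\<in>X. nx k x \<noteq> 0"
    if "k \<in> polyfun C" "\<forall>x\<in>X. G x * k x = 0" for k
    using someI_ex[of "\<lambda>h. h \<in> polyfun C \<and> (\<forall>x\<in>X. (G x + k x) * h x = 0) \<and> (\<exists>x\<in>X. h x \<noteq> 0)"]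
      step[OF that] unfolding nx_def by blast+
  define K where "K n = ((\<lambda>k x. k x + nx k x) ^^ n) (\<lambda>_. 0)" for n
  define h where "h n = nx (K n)" for n
  have K0: "K 0 = (\<lambda>_. 0)" and KS: "K (Suc n) = (\<lambda>x. K n x + h n x)" for n
    by (simp_all add: K_def h_def)
  have Kprop: "K n \<in> polyfun C \<and> (\<forall>x\<in>X. G x * K n x = 0)" for n
  proof (induction n)
    case 0
    then show ?case by (simp add: K0 pf_const)
  next
    case (Suc n)
    note a = nx[of "K n", folded h_def]
    \<comment> \<open>Values lie in a field, so annihilation can be argued point by point: where
      \<open>G\<close> is nonzero, \<open>K n\<close> vanishes and \<open>G + K n\<close> reduces to
      \<open>G\<close>.\<close>
    have "G x * h n x = 0" if "x \<in> X" for x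
    proof (rule ccontr)
      assume "G x * h n x \<noteq> 0"
      then have "K n x = 0" using Suc that by auto
      then show False using a(2) Suc that \<open>G x * h n x \<noteq> 0\<close> by auto
    qed
    then show ?case using Suc a(1) by (auto simp: KS distrib_left intro!: pf_add)
  qed
  note a = nx[of "K n" for n, folded h_def, OF conjunct1[OF Kprop] conjunct2[OF Kprop]]
  have Gh: "G x * h n x = 0" if "x \<in> X" for x n
  proof -
    have "G x * K n x = 0" "G x * K (Suc n) x = 0" using Kprop that by blast+
    then show ?thesis unfolding KS distrib_left by (metis add_0)
  qed
  have Kh: "K n x * h n x = 0" if "x \<in> X" for x n
  proof -
    have "(G x + K n x) * h n x = 0" using a(2) that by blast
    then show ?thesis using Gh[OF that, of n] unfolding distrib_right by (metis add_0)
  qed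
  \<comment> \<open>If \<open>h i\<close> and \<open>h n\<close> were both nonzero at
    \<open>x\<close>, then \<open>K\<close> would jump to \<open>h i x\<close> after step
    \<open>i\<close> and stay there, since every later \<open>h m\<close> with \<open>m < n\<close>
    is forced to vanish at \<open>x\<close>. Then \<open>K n\<close> and \<open>h n\<close> would
    both be nonzero at \<open>x\<close>.\<close>
  have orth: "h i x * h n x = 0" if x: "x \<in> X" and "i < n" for x i n
  proof (rule ccontr)
    assume ne: "h i x * h n x \<noteq> 0"
    have Ki: "K i x = 0" using Kh[OF x, of i] ne by auto
    have "K m x = h i x" if "i < m" "m \<le> n" for m
      using that
    proof (induction m)
      case (Suc m)
      show ?case
      proof (cases "m = i")
        case True
        then show ?thesis using Ki by (simp add: KS)
      next
        case False
        then have "K m x = h i x" using Suc by simp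
        then have "h m x = 0" using Kh[OF x, of m] ne by auto
        then show ?thesis using \<open>K m x = h i x\<close> by (simp add: KS)
      qed
    qed simp
    then show False using Kh[OF x, of n] ne \<open>i < n\<close> by auto
  qed
  obtain n where "h n \<in> fun_ideal (polyfun C) (h ` {..<n})"
    using noetherian_polyfun[OF C] a(1) unfolding noetherian_fun_def by blast
  then obtain s where s: "h n = (\<lambda>x. \<Sum>i<n. s i x * h i x)" using fun_ideal_coeffs by blast
  obtain x where x: "x \<in> X" "h n x \<noteq> 0" using a(3) by blast
  have "h i x = 0" if "i < n" for i using orth[OF x(1) that] x(2) by simp
  then have "h n x = 0" by (subst s) simp
  then show False using x(2) by simp
qed

lemma normal_varietyD:
  assumes nv: "normal_variety C X" and f: "f \<in> polyfun C" and g: "g \<in> polyfun C"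
    and reg: "\<And>h. h \<in> polyfun C \<Longrightarrow> \<forall>x\<in>X. g x * h x = 0 \<Longrightarrow> \<forall>x\<in>X. h x = 0"
    and m: "m > 0" and a: "\<And>i. a i \<in> polyfun C"
    and eq: "\<And>x. x \<in> X \<Longrightarrow> f x ^ m + (\<Sum>i=1..m. a i x * f x ^ (m - i) * g x ^ i) = 0"
  shows "\<exists>h \<in> polyfun C. \<forall>x \<in> X. f x = h x * g x"
proof (rule nv[unfolded normal_variety_def, THEN bspec, OF f, THEN bspec, OF g, THEN mp, THEN mp])
  show "\<forall>h\<in>polyfun C. (\<forall>x\<in>X. g x * h x = 0) \<longrightarrow> (\<forall>x\<in>X. h x = 0)"
    by (intro ballI impI) (drule (1) reg, simp)
  show "\<exists>m>0. \<exists>a. (\<forall>i. a i \<in> polyfun C) \<and>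
      (\<forall>x\<in>X. f x ^ m + (\<Sum>i = 1..m. a i x * f x ^ (m - i) * g x ^ i) = 0)"
    by (rule exI[of _ m], rule conjI[OF m], rule exI[of _ a]) (intro conjI allI ballI a eq)
qed

text \<open>Where \<open>G\<close> is nonzero its annihilator \<open>k\<close> vanishes, so the
  idempotent \<open>k / (G + k)\<close> is 0 at \<open>x0\<close>. The scaling joins every point of
  \<open>X\<close> to \<open>apex\<close> by a connected family inside \<open>X\<close>, which makes
  the idempotent constant, hence 0. So \<open>k\<close> vanishes on \<open>X\<close>, and
  \<open>G\<close> itself is a non-zero-divisor.\<close>

lemma normal_cone_domain:
  fixes sc :: "complex \<Rightarrow> 'a \<Rightarrow> 'a"
  assumes nv: "normal_variety C X" and C: "finite C"
    and sc: "\<And>s x. x \<in> X \<Longrightarrow> sc s x \<in> X" "\<And>x. x \<in> X \<Longrightarrow> sc 1 x = x" "\<And>x. x \<in> X \<Longrightarrow> sc 0 x = apex"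
    and coord: "\<And>c x. c \<in> C \<Longrightarrow> x \<in> X \<Longrightarrow> continuous_on UNIV (\<lambda>s. c (sc s x))"
    and G: "G \<in> polyfun C" and x0: "x0 \<in> X" "G x0 \<noteq> 0"
    and h: "h \<in> polyfun C" "\<And>x. x \<in> X \<Longrightarrow> G x * h x = 0" and x: "x \<in> X"
  shows "h x = 0"
proof -
  obtain k where k: "k \<in> polyfun C" "\<forall>x\<in>X. G x * k x = 0"
    and reg: "\<forall>h\<in>polyfun C. (\<forall>x\<in>X. (G x + k x) * h x = 0) \<longrightarrow> (\<forall>x\<in>X. h x = 0)"
    using ann_regularize[OF C G] by blast
  let ?g = "\<lambda>x. G x + k x"
  have g: "?g \<in> polyfun C" using G k by (intro pf_add)
  \<comment> \<open>Coefficients of the monic equation \<open>k ^ 2 - k * (G + k) = 0\<close>, which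
    holds on \<open>X\<close> because \<open>G * k = 0\<close> there.\<close>
  define a :: "nat \<Rightarrow> 'a \<Rightarrow> complex" where "a i = (if i = 1 then (\<lambda>_. -1) else (\<lambda>_. 0))" for i
  have "\<exists>e\<in>polyfun C. \<forall>x\<in>X. k x = e x * ?g x"
  proof -
    have "k x ^ 2 + (\<Sum>i=1..2. a i x * k x ^ (2 - i) * ?g x ^ i) = 0" if "x \<in> X" for x
    proof -
      have "G x * k x = 0" using k that by blast
      moreover have "{1..2::nat} = {1,2}" by auto
      ultimately show ?thesis by (auto simp: a_def power2_eq_square)
    qed
    note eq = this
    have a: "a i \<in> polyfun C" for i by (simp add: a_def pf_const)
    show ?thesis
    proof (rule normal_varietyD[OF nv k(1) g _ _ a eq])
      show "\<forall>x\<in>X. h x = 0" if "h \<in> polyfun C" "\<forall>x\<in>X. ?g x * h x = 0" for h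
        by (rule mp[OF bspec[OF reg that(1)] that(2)])
    qed simp_all
  qed
  then obtain e where e: "e \<in> polyfun C" "\<And>x. x \<in> X \<Longrightarrow> k x = e x * ?g x" by (elim bexE) simp
  have idem: "e x = 0 \<or> e x = 1" if "x \<in> X" for x
  proof -
    have 1: "(\<lambda>x. e x * e x - e x) \<in> polyfun C"
      by (intro pf_mult polyfun_minus e)
    have 2: "\<forall>x\<in>X. ?g x * (e x * e x - e x) = 0"
    proof
      fix x assume x: "x \<in> X"
      then have "k x = e x * (G x + k x)" "G x * k x = 0" using e(2) k(2) by blast+
      then show "?g x * (e x * e x - e x) = 0" by (cases "k x = 0") auto
    qed
    have "e x * e x - e x = 0"
      using bspec[OF mp[OF bspec[OF reg 1] 2] that] .
    then show ?thesis by (simp add: algebra_simps)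
  qed
  have const: "e x = e apex" if x: "x \<in> X" for x
  proof -
    have "continuous_on UNIV (\<lambda>s. f (sc s x))" if "f \<in> polyfun C" for f
      using that
    proof (induction)
      case (pf_coord c)
      then show ?case by (rule coord[OF _ x])
    qed (intro continuous_intros; assumption)+
    then have c: "continuous_on UNIV (\<lambda>s. e (sc s x))" using e by blast
    have "range (\<lambda>s. e (sc s x)) \<subseteq> {0,1}" using idem sc(1)[OF x] by blast
    then have "finite (range (\<lambda>s. e (sc s x)))" by (rule finite_subset) simp
    then have "(\<lambda>s. e (sc s x)) constant_on UNIV"
      using continuous_finite_range_constant[of "UNIV::complex set", OF connected_UNIV c] by simp
    then have "e (sc 1 x) = e (sc 0 x)" unfolding constant_on_def by (metis UNIV_I)
    then show ?thesis using sc x by simp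
  qed
  have "e x0 * G x0 = 0" using e(2)[OF x0(1)] k(2) x0 by auto
  then have "e x = 0" if "x \<in> X" for x using const[OF that] const[OF x0(1)] x0 by simp
  then have "k x = 0" if "x \<in> X" for x using e(2) that by simp
  then show ?thesis using reg h x by simp
qed

section \<open>Formal polynomials as a module over the Weyl algebra\<close>

text \<open>A formal polynomial is its coefficient function on exponent vectors; this is
  multiplication by the variable \<open>v\<close>. Finite support is imposed separately by
  \<open>fpoly\<close>, so the commutation rules hold for arbitrary coefficient functions.\<close>

definition fmul :: "'v \<Rightarrow> (('v \<Rightarrow> nat) \<Rightarrow> complex) \<Rightarrow> ('v \<Rightarrow> nat) \<Rightarrow> complex" where
  "fmul v f = (\<lambda>\<alpha>. if \<alpha> v = 0 then 0 else f (\<alpha>(v := \<alpha> v - 1)))"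

definition fder :: "'v \<Rightarrow> (('v \<Rightarrow> nat) \<Rightarrow> complex) \<Rightarrow> ('v \<Rightarrow> nat) \<Rightarrow> complex" where
  "fder v f = (\<lambda>\<alpha>. of_nat (Suc (\<alpha> v)) * f (\<alpha>(v := Suc (\<alpha> v))))"

definition fscale :: "complex \<Rightarrow> ('i \<Rightarrow> complex) \<Rightarrow> 'i \<Rightarrow> complex" where
  "fscale c f = (\<lambda>\<alpha>. c * f \<alpha>)"

lemma fun_sum_apply: "(\<Sum>i\<in>S. f i) x = (\<Sum>i\<in>S. f i x)"
  by (induction S rule: infinite_finite_induct) auto

definition flin :: "(('i \<Rightarrow> complex) \<Rightarrow> 'j \<Rightarrow> complex) \<Rightarrow> bool" where
  "flin T \<longleftrightarrow> (\<forall>f g. T (f + g) = T f + T g) \<and> (\<forall>c f. T (fscale c f) = fscale c (T f))"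

lemma flinI:
  "(\<And>f g. T (f + g) = T f + T g) \<Longrightarrow> (\<And>c f. T (fscale c f) = fscale c (T f)) \<Longrightarrow> flin T"
  unfolding flin_def by blast

lemma flin_add: "flin T \<Longrightarrow> T (f + g) = T f + T g"
  and flin_scale: "flin T \<Longrightarrow> T (fscale c f) = fscale c (T f)"
  unfolding flin_def by blast+

lemma flin_0: "flin T \<Longrightarrow> T 0 = 0"
  using flin_scale[of T 0 0] by (simp add: fscale_def zero_fun_def)

lemma flin_sum: "flin T \<Longrightarrow> T (\<Sum>i\<in>S. f i) = (\<Sum>i\<in>S. T (f i))"
  by (induction S rule: infinite_finite_induct) (auto simp: flin_0 flin_add)

lemma flin_diff: "flin T \<Longrightarrow> T (f - g) = T f - T g"
  using flin_add[of T "f - g" g] by (simp add: algebra_simps)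

lemma fscale_diff: "fscale c (f - g) = fscale c f - fscale c g"
  by (rule ext) (simp add: fscale_def right_diff_distrib)

lemma fscale_sum: "fscale c (\<Sum>i\<in>S. f i) = (\<Sum>i\<in>S. fscale c (f i))"
  by (rule ext) (simp add: fscale_def fun_sum_apply sum_distrib_left)

lemma flin_compose: "flin T \<Longrightarrow> flin U \<Longrightarrow> flin (\<lambda>f. T (U f))"
  unfolding flin_def by simp

lemma flin_sums: "(\<And>i. i \<in> S \<Longrightarrow> flin (T i)) \<Longrightarrow> flin (\<lambda>f. \<Sum>i\<in>S. T i f)"
proof (rule flinI)
  assume T: "\<And>i. i \<in> S \<Longrightarrow> flin (T i)"
  show "(\<Sum>i\<in>S. T i (f + g)) = (\<Sum>i\<in>S. T i f) + (\<Sum>i\<in>S. T i g)" for f g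
    unfolding sum.distrib[symmetric] by (rule sum.cong[OF refl flin_add[OF T]])
  show "(\<Sum>i\<in>S. T i (fscale c f)) = fscale c (\<Sum>i\<in>S. T i f)" for c f
    unfolding fscale_sum by (rule sum.cong[OF refl flin_scale[OF T]])
qed

lemma flin_diffs: "flin T \<Longrightarrow> flin U \<Longrightarrow> flin (\<lambda>f. T f - U f)"
  by (rule flinI) (simp_all only: flin_add flin_scale fscale_diff add_diff_add)

lemma flin_fmul: "flin (fmul v)"
  by (rule flinI; rule ext) (auto simp: fmul_def fscale_def)

lemma flin_fder: "flin (fder v)"
  by (rule flinI; rule ext) (auto simp: fder_def fscale_def algebra_simps)

lemma flin_power:
  fixes T :: "('i \<Rightarrow> complex) \<Rightarrow> 'i \<Rightarrow> complex"
  shows "flin T \<Longrightarrow> flin (T ^^ k)"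
proof (induction k)
  case 0
  show ?case by (rule flinI) (simp_all add: fun_eq_iff)
next
  case (Suc k)
  then show ?case using flin_compose[of T "T ^^ k"] by (simp add: o_def)
qed

lemma fmul_comm: "fmul v (fmul w f) = fmul w (fmul v f)"
  by (rule ext) (auto simp: fmul_def fun_upd_twist)

lemma fder_comm: "fder v (fder w f) = fder w (fder v f)"
  by (rule ext) (auto simp: fder_def fun_upd_twist)

text \<open>The canonical commutation relation of the Weyl algebra. Together with
  \<open>fmul_comm\<close> and \<open>fder_comm\<close> it yields all commutators of polarizations
  and contractions below.\<close>

lemma fder_fmul: "fder v (fmul w f) = fmul w (fder v f) + (if v = w then f else 0)"
proof (rule ext)
  fix \<alpha>
  show "fder v (fmul w f) \<alpha> = (fmul w (fder v f) + (if v = w then f else 0)) \<alpha>"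
  proof (cases "v = w")
    case True
    then show ?thesis by (cases "\<alpha> w") (auto simp: fder_def fmul_def algebra_simps fun_upd_idem)
  next
    case False
    then show ?thesis by (auto simp: fder_def fmul_def fun_upd_twist)
  qed
qed

section \<open>Polynomials of bounded degree and the Fischer inner product\<close>

definition mons :: "'v set \<Rightarrow> nat \<Rightarrow> ('v \<Rightarrow> nat) set" where
  "mons V d = {\<alpha>. (\<forall>v. v \<notin> V \<longrightarrow> \<alpha> v = 0) \<and> sum \<alpha> V < d}"

text \<open>The degree bound is strict: \<open>fpoly V 0\<close> contains only the zero polynomial,
  which makes \<open>d = 0\<close> a trivial start for inductions on the degree.\<close>

definition fpoly :: "'v set \<Rightarrow> nat \<Rightarrow> (('v \<Rightarrow> nat) \<Rightarrow> complex) set" where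
  "fpoly V d = {f. \<forall>\<alpha>. f \<alpha> \<noteq> 0 \<longrightarrow> \<alpha> \<in> mons V d}"

lemma finite_mons:
  assumes "finite V"
  shows "finite (mons V d)"
proof (rule finite_subset)
  show "mons V d \<subseteq> {\<alpha>. \<forall>v. (v \<in> V \<longrightarrow> \<alpha> v \<in> {..d}) \<and> (v \<notin> V \<longrightarrow> \<alpha> v = 0)}"
  proof (clarsimp simp: mons_def)
    fix \<alpha> v assume "sum \<alpha> V < d" "v \<in> V"
    then show "\<alpha> v \<le> d" using member_le_sum[of v V \<alpha>] assms by simp
  qed
qed (intro finite_set_of_finite_funs assms finite_atMost)

lemma mons_upd:
  assumes "finite V" "v \<in> V" "\<alpha> v > 0"
  shows "\<alpha>(v := \<alpha> v - 1) \<in> mons V d \<longleftrightarrow> \<alpha> \<in> mons V (Suc d)"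
proof -
  have "sum (\<alpha>(v := \<alpha> v - 1)) V + 1 = sum \<alpha> V"
    using assms by (simp add: sum.remove[of V v])
  then show ?thesis using assms by (auto simp: mons_def)
qed

lemma mons_Suc_upd:
  assumes "finite V" "v \<in> V"
  shows "\<alpha>(v := Suc (\<alpha> v)) \<in> mons V (Suc d) \<longleftrightarrow> \<alpha> \<in> mons V d"
  using mons_upd[of V v "\<alpha>(v := Suc (\<alpha> v))" d] assms by simp

lemma fpoly_add: "f \<in> fpoly V d \<Longrightarrow> g \<in> fpoly V d \<Longrightarrow> f + g \<in> fpoly V d"
  unfolding fpoly_def by clarsimp (metis add_0)

lemma fpoly_diff: "f \<in> fpoly V d \<Longrightarrow> g \<in> fpoly V d \<Longrightarrow> f - g \<in> fpoly V d"
  unfolding fpoly_def by clarsimp (metis diff_self)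

lemma fpoly_scale: "f \<in> fpoly V d \<Longrightarrow> fscale c f \<in> fpoly V d"
  by (auto simp: fpoly_def fscale_def)

lemma fpoly_0: "0 \<in> fpoly V d"
  by (auto simp: fpoly_def)

lemma fpoly_sum: "(\<And>i. i \<in> S \<Longrightarrow> f i \<in> fpoly V d) \<Longrightarrow> (\<Sum>i\<in>S. f i) \<in> fpoly V d"
  by (induction S rule: infinite_finite_induct) (auto intro: fpoly_add fpoly_0)

lemma fpoly_mono: "f \<in> fpoly V d \<Longrightarrow> d \<le> e \<Longrightarrow> f \<in> fpoly V e"
  by (force simp: fpoly_def mons_def)

lemma fpoly_zero: "f \<in> fpoly V 0 \<Longrightarrow> f = 0"
  by (auto simp: fpoly_def mons_def fun_eq_iff)

lemma fder_fpoly: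
  assumes "finite V" "v \<in> V" "f \<in> fpoly V (Suc d)"
  shows "fder v f \<in> fpoly V d"
  using assms(3) mons_Suc_upd[OF assms(1,2), of _ d] unfolding fpoly_def fder_def by auto

lemma fmul_fpoly:
  assumes "finite V" "v \<in> V" "f \<in> fpoly V d"
  shows "fmul v f \<in> fpoly V (Suc d)"
  using assms(3) mons_upd[OF assms(1,2), of _ d] unfolding fpoly_def fmul_def by auto

lemma fmul_fder_fpoly:
  assumes "finite V" "v \<in> V" "w \<in> V" "f \<in> fpoly V d"
  shows "fmul v (fder w f) \<in> fpoly V d"
proof (cases d)
  case 0
  then have "f = 0" using fpoly_zero assms(4) by blast
  then show ?thesis by (simp add: flin_0[OF flin_fder] flin_0[OF flin_fmul] fpoly_0)
next
  case (Suc e)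
  then show ?thesis using assms by (auto intro!: fmul_fpoly fder_fpoly)
qed

text \<open>The Fischer inner product in degrees below \<open>d\<close>: distinct monomials are
  orthogonal, and the square norm of the monomial with exponent \<alpha> is the product of the
  factorials of the entries of \<alpha>. This weight makes multiplication by a variable adjoint to
  differentiation.\<close>

definition fip :: "'v set \<Rightarrow> nat \<Rightarrow> (('v \<Rightarrow> nat) \<Rightarrow> complex) \<Rightarrow> (('v \<Rightarrow> nat) \<Rightarrow> complex) \<Rightarrow> complex" where
  "fip V d f g = (\<Sum>\<alpha>\<in>mons V d. of_nat (\<Prod>v\<in>V. fact (\<alpha> v)) * f \<alpha> * cnj (g \<alpha>))"

lemma fip_cnj: "cnj (fip V d f g) = fip V d g f"
  unfolding fip_def by (simp add: mult_ac)

lemma fip_sum_left: "fip V d (\<Sum>i\<in>S. f i) g = (\<Sum>i\<in>S. fip V d (f i) g)"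
  unfolding fip_def fun_sum_apply by (subst sum.swap) (simp add: sum_distrib_left sum_distrib_right)

lemma fip_sum_right: "fip V d g (\<Sum>i\<in>S. f i) = (\<Sum>i\<in>S. fip V d g (f i))"
  unfolding fip_def fun_sum_apply by (subst sum.swap) (simp add: sum_distrib_left)

lemma fip_diff_left: "fip V d (f - h) g = fip V d f g - fip V d h g"
  unfolding fip_def by (simp add: algebra_simps sum_subtractf)

lemma fip_diff_right: "fip V d g (f - h) = fip V d g f - fip V d g h"
  unfolding fip_def by (simp add: algebra_simps sum_subtractf)

lemma fip_0_left: "fip V d 0 g = 0"
  unfolding fip_def by simp

lemma fip_self: "fip V d f f = of_real (\<Sum>\<alpha>\<in>mons V d. (\<Prod>v\<in>V. fact (\<alpha> v)) * (cmod (f \<alpha>))\<^sup>2)"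
  unfolding fip_def of_real_sum by (intro sum.cong refl) (simp add: mult.assoc complex_norm_square[symmetric])

lemma fip_self_nonneg: "0 \<le> Re (fip V d f f)"
  unfolding fip_self Re_complex_of_real by (intro sum_nonneg mult_nonneg_nonneg prod_nonneg) auto

lemma fip_definite:
  assumes "finite V" "f \<in> fpoly V d" "fip V d f f = 0"
  shows "f = 0"
proof (rule ext)
  fix \<alpha>
  have "(\<Sum>\<alpha>\<in>mons V d. (\<Prod>v\<in>V. fact (\<alpha> v)) * (cmod (f \<alpha>))\<^sup>2) = 0"
    using assms(3) unfolding fip_self by (simp only: of_real_eq_0_iff)
  then have "\<forall>\<alpha>\<in>mons V d. (\<Prod>v\<in>V. fact (\<alpha> v)) * (cmod (f \<alpha>))\<^sup>2 = (0::real)"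
    by (subst (asm) sum_nonneg_eq_0_iff) (auto intro!: finite_mons assms(1) mult_nonneg_nonneg prod_nonneg)
  then have "f \<alpha> = 0" if "\<alpha> \<in> mons V d"
    using that assms(1) by auto
  then show "f \<alpha> = 0 \<alpha>" using assms(2) unfolding fpoly_def by auto
qed

text \<open>Raising the exponent of \<open>v\<close> by one multiplies the factorial weight by
  \<open>Suc (\<alpha> v)\<close>, which is the factor in \<open>fder\<close>. Multiplication raises
  the degree, hence the two different bounds.\<close>

lemma fip_fmul:
  assumes V: "finite V" "v \<in> V"
  shows "fip V (Suc d) (fmul v h) g = fip V d h (fder v g)"
proof -
  let ?u = "\<lambda>\<alpha>::_ \<Rightarrow> nat. \<alpha>(v := \<alpha> v - 1)" and ?s = "\<lambda>\<alpha>::_ \<Rightarrow> nat. \<alpha>(v := Suc (\<alpha> v))"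
  have fct: "(\<Prod>w\<in>V. fact ((?s \<alpha>) w)) = (Suc (\<alpha> v)) * (\<Prod>w\<in>V. fact (\<alpha> w) :: nat)" for \<alpha>
    using V by (simp add: prod.remove[of V v] algebra_simps)
  have "fip V (Suc d) (fmul v h) g =
    (\<Sum>\<alpha>\<in>{\<alpha>\<in>mons V (Suc d). \<alpha> v \<noteq> 0}. of_nat (\<Prod>v\<in>V. fact (\<alpha> v)) * h (?u \<alpha>) * cnj (g \<alpha>))"
    unfolding fip_def by (rule sum.mono_neutral_cong_right) (auto simp: finite_mons V fmul_def)
  also have "\<dots> = (\<Sum>\<alpha>\<in>mons V d. of_nat (\<Prod>w\<in>V. fact ((?s \<alpha>) w)) * h \<alpha> * cnj (g (?s \<alpha>)))"
    by (rule sum.reindex_bij_witness[of _ ?s ?u])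
       (use V mons_Suc_upd[OF V, of _ d] mons_upd[OF V, of _ d] in \<open>auto simp: fun_upd_idem\<close>)
  also have "\<dots> = fip V d h (fder v g)"
    unfolding fip_def fct by (rule sum.cong[OF refl]) (simp add: fder_def algebra_simps)
  finally show ?thesis .
qed

text \<open>Both sides equal the inner product of \<open>fder w f\<close> and
  \<open>fder v g\<close> in degree bound one less.\<close>

lemma fip_adjoint:
  assumes V: "finite V" "v \<in> V" "w \<in> V"
  shows "fip V d (fmul v (fder w f)) g = fip V d f (fmul w (fder v g))"
proof (cases d)
  case 0
  then show ?thesis by (simp add: fip_def mons_def)
next
  case (Suc e)
  have "fip V d (fmul v (fder w f)) g = fip V e (fder w f) (fder v g)"
    using Suc fip_fmul V by metis
  also have "\<dots> = cnj (fip V e (fder v g) (fder w f))" by (simp add: fip_cnj)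
  also have "\<dots> = cnj (fip V d (fmul w (fder v g)) f)" using Suc fip_fmul V by metis
  finally show ?thesis by (simp add: fip_cnj)
qed

text \<open>\<open>L\<close> is a sum of operators \<open>T' T\<close> with \<open>T'\<close>
  adjoint to \<open>T\<close>. So the product of \<open>L f\<close> with \<open>f\<close> is the sum
  of the square norms of the \<open>T k f\<close>; and as \<open>L\<close> is self-adjoint, the
  product of \<open>L (L f)\<close> with \<open>f\<close> is the square norm of
  \<open>L f\<close>.\<close>

lemma kernel_sum_squares:
  assumes V: "finite V" and K: "finite K"
    and adj: "\<And>k f g. k \<in> K \<Longrightarrow> fip V d (T' k f) g = fip V d f (T k g)"
    and pT: "\<And>k f. k \<in> K \<Longrightarrow> f \<in> fpoly V d \<Longrightarrow> T k f \<in> fpoly V d"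
    and pT': "\<And>k f. k \<in> K \<Longrightarrow> f \<in> fpoly V d \<Longrightarrow> T' k f \<in> fpoly V d"
    and L: "\<And>f. L f = (\<Sum>k\<in>K. T' k (T k f))"
    and f: "f \<in> fpoly V d"
  shows "L f = 0 \<Longrightarrow> k \<in> K \<Longrightarrow> T k f = 0" and "L (L f) = 0 \<Longrightarrow> L f = 0"
proof -
  have adj': "fip V d f (T' k g) = fip V d (T k f) g" if "k \<in> K" for k f g
    using arg_cong[OF adj[OF that, of g f], of cnj] by (simp add: fip_cnj)
  have sa: "fip V d (L f) g = fip V d f (L g)" for f g
    unfolding L fip_sum_left fip_sum_right by (intro sum.cong refl) (simp add: adj adj')
  have pL: "L f \<in> fpoly V d" if "f \<in> fpoly V d" for f
    unfolding L by (intro fpoly_sum pT' pT that)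
  show "T k f = 0" if "L f = 0" "k \<in> K"
  proof -
    have "0 = fip V d (L f) f" using that by (simp add: fip_0_left)
    also have "\<dots> = (\<Sum>k\<in>K. fip V d (T k f) (T k f))"
      unfolding L fip_sum_left by (intro sum.cong refl) (simp add: adj)
    finally have "(\<Sum>k\<in>K. Re (fip V d (T k f) (T k f))) = 0" by (metis Re_sum zero_complex.simps(1))
    then have "Re (fip V d (T k f) (T k f)) = 0"
      using that K by (subst (asm) sum_nonneg_eq_0_iff) (auto simp: fip_self_nonneg)
    then have "fip V d (T k f) (T k f) = 0" unfolding fip_self Re_complex_of_real by (simp only: of_real_0)
    then show ?thesis using fip_definite[OF V pT[OF that(2) f]] by blast
  qed
  show "L f = 0" if "L (L f) = 0"
  proof -
    have "fip V d (L f) (L f) = fip V d (L (L f)) f" by (simp add: sa)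
    also have "\<dots> = 0" using that by (simp add: fip_0_left)
    finally show ?thesis using fip_definite[OF V pL[OF f]] by blast
  qed
qed

text \<open>Gaussian elimination on the coordinates in \<open>M\<close>: a member \<open>p\<close>
  that is nonzero at \<open>\<beta>\<close> clears this coordinate from the other members, and its
  own coefficient is recovered at the end.\<close>

lemma linear_dependence:
  fixes f :: "'k \<Rightarrow> 'i \<Rightarrow> complex"
  assumes "finite M" "finite K" "card M < card K" "\<And>k \<alpha>. k \<in> K \<Longrightarrow> \<alpha> \<notin> M \<Longrightarrow> f k \<alpha> = 0"
  shows "\<exists>c. (\<exists>k\<in>K. c k \<noteq> 0) \<and> (\<Sum>k\<in>K. fscale (c k) (f k)) = 0"
  using assms
proof (induction M arbitrary: K f)
  case empty
  then obtain k where "k \<in> K" by (metis card_gt_0_iff ex_in_conv card.empty)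
  moreover have "(\<Sum>k\<in>K. fscale 1 (f k)) = 0"
    using empty by (intro ext) (simp add: fun_sum_apply fscale_def)
  ultimately show ?case by (intro exI[of _ "\<lambda>_. 1"]) auto
next
  case (insert \<beta> M)
  show ?case
  proof (cases "\<forall>k\<in>K. f k \<beta> = 0")
    case True
    have "f k \<alpha> = 0" if "k \<in> K" "\<alpha> \<notin> M" for k \<alpha>
      using True insert.prems(3)[of k \<alpha>] that by (cases "\<alpha> = \<beta>") auto
    then show ?thesis using insert.prems insert.hyps by (intro insert.IH) auto
  next
    case False
    then obtain p where p: "p \<in> K" "f p \<beta> \<noteq> 0" by blast
    define g where "g k = f k - fscale (f k \<beta> / f p \<beta>) (f p)" for k
    have "\<exists>c. (\<exists>k\<in>K - {p}. c k \<noteq> 0) \<and> (\<Sum>k\<in>K - {p}. fscale (c k) (g k)) = 0"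
    proof (rule insert.IH)
      show "card M < card (K - {p})" using insert p by simp
      show "g k \<alpha> = 0" if "k \<in> K - {p}" "\<alpha> \<notin> M" for k \<alpha>
        using that p insert.prems(3)[of k \<alpha>] insert.prems(3)[of p \<alpha>]
        by (cases "\<alpha> = \<beta>") (auto simp: g_def fscale_def)
    qed (use insert in auto)
    then obtain c where c: "\<exists>k\<in>K - {p}. c k \<noteq> 0" "(\<Sum>k\<in>K - {p}. fscale (c k) (g k)) = 0" by blast
    define c' where "c' = c(p := - (\<Sum>k\<in>K - {p}. c k * (f k \<beta> / f p \<beta>)))"
    have "(\<Sum>k\<in>K. fscale (c' k) (f k)) \<alpha> = 0" for \<alpha>
    proof -
      have "(\<Sum>k\<in>K. fscale (c' k) (f k)) \<alpha> = c' p * f p \<alpha> + (\<Sum>k\<in>K - {p}. c k * f k \<alpha>)"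
        using insert.prems p by (simp add: fun_sum_apply fscale_def sum.remove[of K p] c'_def)
      also have "\<dots> = (\<Sum>k\<in>K - {p}. fscale (c k) (g k)) \<alpha>"
        by (simp add: fun_sum_apply fscale_def g_def c'_def right_diff_distrib sum_subtractf sum_distrib_left sum_distrib_right mult_ac)
      finally show ?thesis using c by simp
    qed
    then show ?thesis using c(1) by (intro exI[of _ c']) (auto simp: c'_def fun_eq_iff)
  qed
qed

text \<open>The first relation among the iterates of \<open>L\<close> at \<open>h\<close> has a nonzero constant term, up to a
  factor that is a power of \<open>L\<close>, and such a power can be cancelled down to \<open>L\<close>.\<close>

lemma kernel_projection:
  assumes V: "finite V" and L: "flin L" and pL: "\<And>f. f \<in> fpoly V d \<Longrightarrow> L f \<in> fpoly V d"
    and ker: "\<And>f. f \<in> fpoly V d \<Longrightarrow> L (L f) = 0 \<Longrightarrow> L f = 0"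
    and h: "h \<in> fpoly V d"
  shows "\<exists>n c. L (h + L (\<Sum>k<(n::nat). fscale (c k) ((L ^^ k) h))) = 0"
proof -
  define N where "N = card (mons V d)"
  have it: "(L ^^ k) g \<in> fpoly V d" if "g \<in> fpoly V d" for k g
    using that by (induction k) (auto intro: pL)
  have "\<exists>c. (\<exists>k\<in>{..N}. c k \<noteq> 0) \<and> (\<Sum>k\<in>{..N}. fscale (c k) ((L ^^ k) h)) = 0"
  proof (rule linear_dependence[OF finite_mons[OF V]])
    show "card (mons V d) < card {..N}" by (simp add: N_def)
    show "(L ^^ k) h \<alpha> = 0" if "\<alpha> \<notin> mons V d" for k \<alpha>
      using it[OF h, of k] that unfolding fpoly_def by blast
  qed simp
  then obtain c where c: "\<exists>k\<le>N. c k \<noteq> 0" "(\<Sum>k\<le>N. fscale (c k) ((L ^^ k) h)) = 0" by auto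
  define e where "e = (LEAST k. c k \<noteq> 0)"
  obtain k0 where k0: "k0 \<le> N" "c k0 \<noteq> 0" using c(1) by blast
  have e: "c e \<noteq> 0" "e \<le> N"
    using LeastI[of "\<lambda>k. c k \<noteq> 0", OF k0(2)] Least_le[of "\<lambda>k. c k \<noteq> 0", OF k0(2)] k0(1)
    unfolding e_def by simp_all
  have lt: "c k = 0" if "k < e" for k
    using not_less_Least[of k "\<lambda>k. c k \<noteq> 0"] that unfolding e_def by simp
  \<comment> \<open>The relation divided by \<open>c e\<close> and formally by the power
    \<open>L ^^ e\<close>, so that \<open>u\<close> starts with \<open>h\<close> itself.\<close>
  define u where "u = (\<Sum>k\<le>N - e. fscale (c (e + k) / c e) ((L ^^ k) h))"
  have uf: "u \<in> fpoly V d" unfolding u_def by (intro fpoly_sum fpoly_scale it h)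
  have "(L ^^ e) u = (\<Sum>k\<le>N - e. fscale (1 / c e) (fscale (c (e + k)) ((L ^^ (e + k)) h)))"
    unfolding u_def by (simp add: flin_sum[OF flin_power[OF L]] flin_scale[OF flin_power[OF L]] funpow_add)
      (simp add: fscale_def)
  also have "\<dots> = fscale (1 / c e) (\<Sum>k\<le>N - e. fscale (c (e + k)) ((L ^^ (e + k)) h))"
    by (simp add: fscale_sum)
  also have "(\<Sum>k\<le>N - e. fscale (c (e + k)) ((L ^^ (e + k)) h)) = (\<Sum>k\<in>{e..N}. fscale (c k) ((L ^^ k) h))"
    by (rule sum.reindex_bij_witness[of _ "\<lambda>k. k - e" "\<lambda>k. e + k"]) (use e in auto)
  also have "\<dots> = (\<Sum>k\<le>N. fscale (c k) ((L ^^ k) h))"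
    by (rule sum.mono_neutral_left) (auto simp: lt fscale_def zero_fun_def)
  finally have Leu: "(L ^^ e) u = 0" using c(2) by (simp add: fscale_def zero_fun_def)
  have "(L ^^ j) u = 0 \<Longrightarrow> L u = 0" for j
  proof (induction j)
    case 0
    then have "u = 0" by (simp only: funpow_0)
    then show ?case by (simp only: flin_0[OF L])
  next
    case (Suc j)
    show ?case
    proof (cases j)
      case 0
      then show ?thesis using Suc by simp
    next
      case (Suc i)
      with Suc.prems have "L (L ((L ^^ i) u)) = 0" by (simp only: funpow.simps o_apply)
      then have "(L ^^ j) u = 0" using ker[OF it[OF uf]] Suc by (simp only: funpow.simps o_apply)
      then show ?thesis by (rule Suc.IH)
    qed
  qed
  then have Lu: "L u = 0" using Leu by blast
  have "u = h + (\<Sum>k<N - e. fscale (c (e + Suc k) / c e) ((L ^^ Suc k) h))"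
    unfolding u_def lessThan_Suc_atMost[symmetric] sum.lessThan_Suc_shift
    using e by (simp add: fscale_def)
  also have "(\<Sum>k<N - e. fscale (c (e + Suc k) / c e) ((L ^^ Suc k) h))
      = L (\<Sum>k<N - e. fscale (c (e + Suc k) / c e) ((L ^^ k) h))"
    by (simp add: flin_sum[OF L] flin_scale[OF L])
  finally have "L (h + L (\<Sum>k<N - e. fscale (c (e + Suc k) / c e) ((L ^^ k) h))) = 0"
    using Lu by (simp only:)
  then show ?thesis by (rule exI[of _ "N - e", OF exI[of _ "\<lambda>k. c (e + Suc k) / c e"]])
qed

section \<open>Evaluation of formal polynomials and the chain rule\<close>

definition fmon :: "'v set \<Rightarrow> ('v \<Rightarrow> complex) \<Rightarrow> ('v \<Rightarrow> nat) \<Rightarrow> complex" where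
  "fmon V e \<alpha> = (\<Prod>v\<in>V. e v ^ \<alpha> v)"

text \<open>Summing over the support keeps the value independent of a degree bound; for members of
  \<open>fpoly V d\<close> with \<open>V\<close> finite the support is finite.\<close>

definition fev :: "'v set \<Rightarrow> ('v \<Rightarrow> complex) \<Rightarrow> (('v \<Rightarrow> nat) \<Rightarrow> complex) \<Rightarrow> complex" where
  "fev V e f = (\<Sum>\<alpha> | f \<alpha> \<noteq> 0. f \<alpha> * fmon V e \<alpha>)"

lemma fev_eq:
  assumes "finite V" "f \<in> fpoly V d"
  shows "fev V e f = (\<Sum>\<alpha>\<in>mons V d. f \<alpha> * fmon V e \<alpha>)"
  unfolding fev_def using assms finite_mons[OF assms(1), of d]
  by (intro sum.mono_neutral_left) (auto simp: fpoly_def)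

lemma fev_add:
  assumes "finite V" "f \<in> fpoly V d" "g \<in> fpoly V d"
  shows "fev V e (f + g) = fev V e f + fev V e g"
  using fev_eq[OF assms(1)] assms fpoly_add[OF assms(2,3)] by (simp add: algebra_simps sum.distrib)

lemma fev_diff:
  assumes "finite V" "f \<in> fpoly V d" "g \<in> fpoly V d"
  shows "fev V e (f - g) = fev V e f - fev V e g"
  using fev_eq[OF assms(1)] assms fpoly_diff[OF assms(2,3)] by (simp add: algebra_simps sum_subtractf)

lemma fev_scale:
  assumes "finite V" "f \<in> fpoly V d"
  shows "fev V e (fscale c f) = c * fev V e f"
  unfolding fev_eq[OF assms] fev_eq[OF assms(1) fpoly_scale[OF assms(2)]]
  by (simp add: fscale_def sum_distrib_left mult_ac)

lemma fev_0: "fev V e 0 = 0"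
  by (simp add: fev_def)

(* As simp rules these rewrite f + g and 0 even where they are not applied to an argument. *)
declare plus_fun_apply [simp del] zero_fun_apply [simp del]

lemma fev_sum:
  assumes "finite V" "\<And>i. i \<in> S \<Longrightarrow> f i \<in> fpoly V d"
  shows "fev V e (\<Sum>i\<in>S. f i) = (\<Sum>i\<in>S. fev V e (f i))"
  using assms(2)
proof (induction S rule: infinite_finite_induct)
  case (insert i S)
  then show ?case using fev_add[OF assms(1), of "f i" d "\<Sum>i\<in>S. f i"] by (simp add: fpoly_sum)
qed (simp_all add: fev_0)

lemma fmon_Suc:
  assumes "finite V" "v \<in> V"
  shows "fmon V e (\<alpha>(v := Suc (\<alpha> v))) = e v * fmon V e \<alpha>"
  using assms by (simp add: fmon_def prod.remove[of V v])

lemma fev_fmul: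
  assumes V: "finite V" "v \<in> V" and f: "f \<in> fpoly V d"
  shows "fev V e (fmul v f) = e v * fev V e f"
proof -
  let ?u = "\<lambda>\<alpha>::_ \<Rightarrow> nat. \<alpha>(v := \<alpha> v - 1)" and ?s = "\<lambda>\<alpha>::_ \<Rightarrow> nat. \<alpha>(v := Suc (\<alpha> v))"
  have "fev V e (fmul v f) = (\<Sum>\<alpha>\<in>mons V (Suc d). fmul v f \<alpha> * fmon V e \<alpha>)"
    by (intro fev_eq fmul_fpoly V f)
  also have "\<dots> = (\<Sum>\<alpha>\<in>{\<alpha>\<in>mons V (Suc d). \<alpha> v \<noteq> 0}. f (?u \<alpha>) * fmon V e \<alpha>)"
    by (rule sum.mono_neutral_cong_right) (auto simp: finite_mons V fmul_def)
  also have "\<dots> = (\<Sum>\<alpha>\<in>mons V d. f \<alpha> * fmon V e (?s \<alpha>))"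
    by (rule sum.reindex_bij_witness[of _ ?s ?u])
       (use V mons_Suc_upd[OF V, of _ d] mons_upd[OF V, of _ d] in \<open>auto simp: fun_upd_idem\<close>)
  also have "\<dots> = e v * fev V e f"
    unfolding fev_eq[OF V(1) f] fmon_Suc[OF V] by (simp add: sum_distrib_left mult_ac)
  finally show ?thesis .
qed

text \<open>Matches the formal derivative with the termwise derivative of monomials. For
  \<open>\<alpha> v = 0\<close> the factor \<open>of_nat (\<alpha> v)\<close> neutralizes the
  truncated exponent.\<close>

lemma fev_fder:
  assumes V: "finite V" "v \<in> V" and f: "f \<in> fpoly V d"
  shows "fev V e (fder v f) = (\<Sum>\<alpha>\<in>mons V d. f \<alpha> * (of_nat (\<alpha> v) * e v ^ (\<alpha> v - 1) * (\<Prod>w\<in>V - {v}. e w ^ \<alpha> w)))"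
proof (cases d)
  case 0
  then show ?thesis using fpoly_zero[of f V] f by (simp add: flin_0[OF flin_fder] fev_0 zero_fun_apply)
next
  case (Suc d')
  let ?u = "\<lambda>\<alpha>::_ \<Rightarrow> nat. \<alpha>(v := \<alpha> v - 1)" and ?s = "\<lambda>\<alpha>::_ \<Rightarrow> nat. \<alpha>(v := Suc (\<alpha> v))"
  have "(\<Sum>\<alpha>\<in>mons V d. f \<alpha> * (of_nat (\<alpha> v) * e v ^ (\<alpha> v - 1) * (\<Prod>w\<in>V - {v}. e w ^ \<alpha> w)))
    = (\<Sum>\<alpha>\<in>{\<alpha>\<in>mons V d. \<alpha> v \<noteq> 0}. f \<alpha> * (of_nat (\<alpha> v) * e v ^ (\<alpha> v - 1) * (\<Prod>w\<in>V - {v}. e w ^ \<alpha> w)))"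
    by (rule sum.mono_neutral_right) (auto simp: finite_mons V)
  also have "\<dots> = (\<Sum>\<alpha>\<in>mons V d'. f (?s \<alpha>) * (of_nat (Suc (\<alpha> v)) * e v ^ \<alpha> v * (\<Prod>w\<in>V - {v}. e w ^ \<alpha> w)))"
    unfolding Suc
    by (rule sum.reindex_bij_witness[of _ ?s ?u])
       (use V mons_Suc_upd[OF V, of _ d'] mons_upd[OF V, of _ d'] in \<open>auto simp: fun_upd_idem\<close>)
  also have "\<dots> = (\<Sum>\<alpha>\<in>mons V d'. fder v f \<alpha> * fmon V e \<alpha>)"
    using V by (simp add: fder_def fmon_def prod.remove[of V v] mult_ac)
  also have "\<dots> = fev V e (fder v f)"
    using fev_eq[OF V(1) fder_fpoly[OF V], of f d'] f Suc by simp
  finally show ?thesis by simp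
qed

lemma fev_has_field_derivative:
  assumes V: "finite V" and f: "f \<in> fpoly V d"
    and e: "\<And>v. v \<in> V \<Longrightarrow> ((\<lambda>s. e s v) has_field_derivative e' v) (at s0)"
  shows "((\<lambda>s. fev V (e s) f) has_field_derivative (\<Sum>v\<in>V. e' v * fev V (e s0) (fder v f))) (at s0)"
proof -
  have mon: "((\<lambda>s. fmon V (e s) \<alpha>) has_field_derivative
      (\<Sum>v\<in>V. (of_nat (\<alpha> v) * (e s0 v ^ (\<alpha> v - 1) * e' v)) * (\<Prod>w\<in>V - {v}. e s0 w ^ \<alpha> w))) (at s0)" for \<alpha>
    unfolding fmon_def
    by (rule has_field_derivative_prod) (auto intro!: derivative_eq_intros e)
  have "((\<lambda>s. \<Sum>\<alpha>\<in>mons V d. f \<alpha> * fmon V (e s) \<alpha>) has_field_derivative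
      (\<Sum>\<alpha>\<in>mons V d. f \<alpha> * (\<Sum>v\<in>V. (of_nat (\<alpha> v) * (e s0 v ^ (\<alpha> v - 1) * e' v)) * (\<Prod>w\<in>V - {v}. e s0 w ^ \<alpha> w)))) (at s0)"
    by (intro DERIV_sum DERIV_cmult mon)
  moreover have "(\<Sum>\<alpha>\<in>mons V d. f \<alpha> * (\<Sum>v\<in>V. (of_nat (\<alpha> v) * (e s0 v ^ (\<alpha> v - 1) * e' v)) * (\<Prod>w\<in>V - {v}. e s0 w ^ \<alpha> w)))
     = (\<Sum>v\<in>V. e' v * fev V (e s0) (fder v f))"
    unfolding sum_distrib_left
    by (subst sum.swap, rule sum.cong[OF refl])
       (simp add: fev_fder[OF V _ f] sum_distrib_left mult_ac)
  ultimately show ?thesis unfolding fev_eq[OF V f] by simp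
qed

text \<open>Only variables that really occur in \<open>f\<close> have to take polynomial values. The
  first fundamental theorem uses this for a polynomial from which all matrix variables have dropped
  out.\<close>

lemma fev_polyfun:
  assumes "finite V" "f \<in> fpoly V d" "\<And>v. v \<in> V \<Longrightarrow> (\<exists>\<alpha>. f \<alpha> \<noteq> 0 \<and> \<alpha> v \<noteq> 0) \<Longrightarrow> (\<lambda>p. val p v) \<in> polyfun C"
  shows "(\<lambda>p. fev V (val p) f) \<in> polyfun C"
  unfolding fev_def fmon_def
proof (intro polyfun_sum pf_mult pf_const polyfun_prod)
  fix \<alpha> v assume "\<alpha> \<in> {\<alpha>. f \<alpha> \<noteq> 0}" "v \<in> V"
  then show "(\<lambda>p. val p v ^ \<alpha> v) \<in> polyfun C"
    by (cases "\<alpha> v = 0") (auto intro!: pf_const polyfun_power assms(3))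
qed

text \<open>The functions obtained by evaluation contain the coordinates and are closed under sums
  and products. The formal polynomial need not be unique, since the coordinates may be dependent as
  functions.\<close>

lemma polyfun_fev:
  fixes V :: "'v set" and f :: "'p \<Rightarrow> complex"
  assumes V: "finite V" and f: "f \<in> polyfun C" and C: "\<And>c. c \<in> C \<Longrightarrow> \<exists>v\<in>V. c = (\<lambda>p. val p v)"
  shows "\<exists>d g. g \<in> fpoly V d \<and> f = (\<lambda>p. fev V (val p) g)"
proof -
  define R where "R = {f. \<exists>d g. g \<in> fpoly V d \<and> f = (\<lambda>p. fev V (val p) g)}"
  have RI: "f \<in> R" if "g \<in> fpoly V d" "\<And>p. f p = fev V (val p) g" for f g d
    unfolding R_def using that by (intro CollectI exI[of _ d] exI[of _ g]) auto
  have RD: "\<exists>d g. g \<in> fpoly V d \<and> f = (\<lambda>p. fev V (val p) g)" if "f \<in> R" for f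
    using that unfolding R_def by (rule CollectD)
  have add: "(\<lambda>p. f p + g p) \<in> R" if fg: "f \<in> R" "g \<in> R" for f g
  proof -
    from RD[OF fg(1)] obtain d f' where f': "f' \<in> fpoly V d" "f = (\<lambda>p. fev V (val p) f')" by (elim exE conjE)
    from RD[OF fg(2)] obtain d' g' where g': "g' \<in> fpoly V d'" "g = (\<lambda>p. fev V (val p) g')" by (elim exE conjE)
    note a = fpoly_mono[OF f'(1), of "max d d'", simplified] fpoly_mono[OF g'(1), of "max d d'", simplified]
    show ?thesis
      by (rule RI[OF fpoly_add[OF a]]) (simp add: fev_add[OF V a] f'(2) g'(2))
  qed
  have const: "(\<lambda>p. c) \<in> R" for c
  proof (rule RI)
    show *: "(\<lambda>\<alpha>. if \<alpha> = (\<lambda>_. 0) then c else 0) \<in> fpoly V 1"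
      by (auto simp: fpoly_def mons_def)
    have "fev V (val p) (\<lambda>\<alpha>. if \<alpha> = (\<lambda>_. 0) then c else 0)
        = (\<Sum>\<alpha>\<in>{\<lambda>_. 0}. (if \<alpha> = (\<lambda>_. 0) then c else 0) * fmon V (val p) \<alpha>)" for p
      unfolding fev_def by (rule sum.mono_neutral_left) auto
    then show "c = fev V (val p) (\<lambda>\<alpha>. if \<alpha> = (\<lambda>_. 0) then c else 0)" for p
      by (simp add: fmon_def)
  qed
  have mulv: "(\<lambda>p. val p v * f p) \<in> R" if f: "f \<in> R" and v: "v \<in> V" for f v
  proof -
    from RD[OF f] obtain d f' where f': "f' \<in> fpoly V d" "f = (\<lambda>p. fev V (val p) f')" by (elim exE conjE)
    show ?thesis
      by (rule RI[OF fmul_fpoly[OF V v f'(1)]]) (simp add: fev_fmul[OF V v f'(1)] f'(2))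
  qed
  have mulc: "(\<lambda>p. c * f p) \<in> R" if f: "f \<in> R" for f c
  proof -
    from RD[OF f] obtain d f' where f': "f' \<in> fpoly V d" "f = (\<lambda>p. fev V (val p) f')" by (elim exE conjE)
    show ?thesis
      by (rule RI[OF fpoly_scale[OF f'(1), of c]]) (simp add: fev_scale[OF V f'(1)] f'(2))
  qed
  have mulpow: "(\<lambda>p. val p v ^ k * f p) \<in> R" if "f \<in> R" "v \<in> V" for f v k
  proof (induction k)
    case (Suc k)
    show ?case using mulv[OF Suc that(2)] by (simp add: mult.assoc)
  qed (simp add: that)
  have mulprod: "(\<lambda>p. (\<Prod>v\<in>S. val p v ^ \<alpha> v) * f p) \<in> R" if "f \<in> R" "S \<subseteq> V" for f S \<alpha>
  proof -
    have "finite S" using that V finite_subset by blast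
    then show ?thesis using that(2)
    proof (induction S)
      case (insert v S)
      then have "(\<lambda>p. val p v ^ \<alpha> v * ((\<Prod>v\<in>S. val p v ^ \<alpha> v) * f p)) \<in> R" by (intro mulpow) auto
      then show ?case using insert by (simp add: mult.assoc)
    qed (simp add: that)
  qed
  have sum: "(\<lambda>p. \<Sum>i\<in>S. f i p) \<in> R" if "\<And>i. i \<in> S \<Longrightarrow> f i \<in> R" for S :: "('v \<Rightarrow> nat) set" and f
    using that
  proof (induction S rule: infinite_finite_induct)
    case (insert i S)
    then have "(\<lambda>p. f i p + (\<Sum>i\<in>S. f i p)) \<in> R" by (intro add) auto
    then show ?case using insert by simp
  qed (simp_all add: const)
  have mul: "(\<lambda>p. f p * g p) \<in> R" if fg: "f \<in> R" "g \<in> R" for f g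
  proof -
    from RD[OF fg(1)] obtain d f' where f': "f' \<in> fpoly V d" "f = (\<lambda>p. fev V (val p) f')" by (elim exE conjE)
    have "(\<lambda>p. \<Sum>\<alpha> | f' \<alpha> \<noteq> 0. f' \<alpha> * (fmon V (val p) \<alpha> * g p)) \<in> R"
      unfolding fmon_def by (rule sum, rule mulc, rule mulprod[OF fg(2) order_refl])
    then show ?thesis unfolding f'(2) fev_def by (simp add: sum_distrib_right mult.assoc)
  qed
  have "f \<in> R" using f
  proof (induction)
    case (pf_coord c)
    then obtain v where v: "v \<in> V" "c = (\<lambda>p. val p v)" using C by blast
    show ?case using mulv[OF const[of 1] v(1)] unfolding v(2) by simp
  next
    case (pf_const c)
    show ?case by (rule const)
  next
    case (pf_add f g)
    show ?case by (rule add[OF pf_add.IH])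
  next
    case (pf_mult f g)
    show ?case by (rule mul[OF pf_mult.IH])
  qed
  then show ?thesis by (rule RD)
qed

section \<open>Reynolds operator and first fundamental theorem for the general linear group\<close>

text \<open>The entries of an N x m matrix A (\<open>VA\<close>), of an m x M matrix B
  (\<open>VB\<close>), and spectator variables (\<open>VR\<close>). An invertible m x m matrix g
  sends (A, B) to (A g^-1, g B) and fixes the spectators.\<close>

datatype 'r qvar = VA nat nat | VB nat nat | VR 'r

definition qvars :: "nat \<Rightarrow> nat \<Rightarrow> nat \<Rightarrow> 'r set \<Rightarrow> 'r qvar set" where
  "qvars N m M R = (\<lambda>(i, c). VA i c) ` ({..<N} \<times> {..<m}) \<union> (\<lambda>(c, j). VB c j) ` ({..<m} \<times> {..<M}) \<union> VR ` R"

lemma finite_qvars: "finite R \<Longrightarrow> finite (qvars N m M R)"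
  by (simp add: qvars_def)

lemma qvars_simps [simp]:
  "VA i c \<in> qvars N m M R \<longleftrightarrow> i < N \<and> c < m"
  "VB c j \<in> qvars N m M R \<longleftrightarrow> c < m \<and> j < M"
  "VR \<rho> \<in> qvars N m M R \<longleftrightarrow> \<rho> \<in> R"
  by (auto simp: qvars_def image_iff)

text \<open>Polarization operator: the derivation that replaces variables of column \<open>b\<close>
  of A by those of column \<open>a\<close>. The operator \<open>EB\<close> does the same with rows
  of B.\<close>

definition EA :: "nat \<Rightarrow> nat \<Rightarrow> nat \<Rightarrow> (('r qvar \<Rightarrow> nat) \<Rightarrow> complex) \<Rightarrow> ('r qvar \<Rightarrow> nat) \<Rightarrow> complex" where
  "EA N a b f = (\<Sum>i<N. fmul (VA i a) (fder (VA i b) f))"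

definition EB :: "nat \<Rightarrow> nat \<Rightarrow> nat \<Rightarrow> (('r qvar \<Rightarrow> nat) \<Rightarrow> complex) \<Rightarrow> ('r qvar \<Rightarrow> nat) \<Rightarrow> complex" where
  "EB M a b f = (\<Sum>j<M. fmul (VB a j) (fder (VB b j) f))"

text \<open>The derivative at s = 0 along the action of g = 1 + s E, where E has its single entry 1
  in row \<open>b\<close> and column \<open>a\<close>; the minus sign comes from g^-1 acting on A.
  Invariance is expressed as annihilation by all these operators.\<close>

definition gl_act :: "nat \<Rightarrow> nat \<Rightarrow> nat \<Rightarrow> nat \<Rightarrow> (('r qvar \<Rightarrow> nat) \<Rightarrow> complex) \<Rightarrow> ('r qvar \<Rightarrow> nat) \<Rightarrow> complex" where
  "gl_act N M a b f = EB M a b f - EA N b a f"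

definition contr :: "nat \<Rightarrow> nat \<Rightarrow> nat \<Rightarrow> (('r qvar \<Rightarrow> nat) \<Rightarrow> complex) \<Rightarrow> ('r qvar \<Rightarrow> nat) \<Rightarrow> complex" where
  "contr m i j f = (\<Sum>c<m. fmul (VA i c) (fmul (VB c j) f))"

text \<open>The Fischer adjoint of \<open>contr\<close>: every variable is replaced by its partial
  derivative.\<close>

definition contr_der :: "nat \<Rightarrow> nat \<Rightarrow> nat \<Rightarrow> (('r qvar \<Rightarrow> nat) \<Rightarrow> complex) \<Rightarrow> ('r qvar \<Rightarrow> nat) \<Rightarrow> complex" where
  "contr_der m i j f = (\<Sum>c<m. fder (VA i c) (fder (VB c j) f))"

lemma flin_EA: "flin (EA N a b)"
  unfolding EA_def by (intro flin_sums flin_compose[OF flin_fmul flin_fder])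

lemma flin_EB: "flin (EB N a b)"
  unfolding EB_def by (intro flin_sums flin_compose[OF flin_fmul flin_fder])

lemma flin_gl_act: "flin (gl_act N M a b)"
  unfolding gl_act_def by (intro flin_diffs flin_EA flin_EB)

lemma flin_contr: "flin (contr m i j)"
  unfolding contr_def by (intro flin_sums flin_compose[OF flin_fmul flin_fmul])

lemma flin_contr_der: "flin (contr_der m i j)"
  unfolding contr_der_def by (intro flin_sums flin_compose[OF flin_fder flin_fder])

section \<open>Commutators with the polarization operators\<close>

lemma euler_fmul:
  "fmul v (fder w (fmul u f)) = fmul u (fmul v (fder w f)) + (if w = u then fmul v f else 0)"
  by (simp add: fder_fmul flin_add[OF flin_fmul] flin_0[OF flin_fmul] fmul_comm[of v u])

lemma euler_fder:
  "fmul v (fder w (fder u f)) = fder u (fmul v (fder w f)) - (if u = v then fder w f else 0)"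
  by (simp add: fder_fmul fder_comm[of u w])

lemma EB_fmul_VA: "EB M a b (fmul (VA i c) f) = fmul (VA i c) (EB M a b f)"
  by (simp add: EB_def euler_fmul flin_sum[OF flin_fmul])

lemma EA_fmul_VB: "EA N a b (fmul (VB c j) f) = fmul (VB c j) (EA N a b f)"
  by (simp add: EA_def euler_fmul flin_sum[OF flin_fmul])

lemma EB_fder_VA: "EB M a b (fder (VA i c) f) = fder (VA i c) (EB M a b f)"
  by (simp add: EB_def euler_fder flin_sum[OF flin_fder])

lemma EA_fder_VB: "EA N a b (fder (VB c j) f) = fder (VB c j) (EA N a b f)"
  by (simp add: EA_def euler_fder flin_sum[OF flin_fder])

lemma EB_fmul_VB:
  "j < M \<Longrightarrow> EB M a b (fmul (VB c j) f) = fmul (VB c j) (EB M a b f) + (if b = c then fmul (VB a j) f else 0)"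
  by (cases "b = c") (simp_all add: EB_def euler_fmul flin_sum[OF flin_fmul] sum.distrib sum.delta)

lemma EA_fmul_VA:
  "i < N \<Longrightarrow> EA N a b (fmul (VA i c) f) = fmul (VA i c) (EA N a b f) + (if b = c then fmul (VA i a) f else 0)"
  by (cases "b = c") (simp_all add: EA_def euler_fmul flin_sum[OF flin_fmul] sum.distrib sum.delta)

lemma EB_fder_VB:
  "j < M \<Longrightarrow> EB M a b (fder (VB c j) f) = fder (VB c j) (EB M a b f) - (if a = c then fder (VB b j) f else 0)"
  by (cases "a = c") (auto simp: EB_def euler_fder flin_sum[OF flin_fder] sum_subtractf sum.delta)

lemma EA_fder_VA:
  "i < N \<Longrightarrow> EA N a b (fder (VA i c) f) = fder (VA i c) (EA N a b f) - (if a = c then fder (VA i b) f else 0)"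
  by (cases "a = c") (auto simp: EA_def euler_fder flin_sum[OF flin_fder] sum_subtractf sum.delta)

lemma if_zero_fun:
  "flin T \<Longrightarrow> T (if P then f else 0) = (if P then T f else 0)"
  by (simp add: flin_0)

text \<open>The two halves of \<open>gl_act\<close> produce the same extra term, the product of the
  variables \<open>VA i b\<close> and \<open>VB a j\<close>, and it cancels in their
  difference.\<close>

lemma gl_act_contr:
  assumes "i < N" "j < M" "a < m" "b < m"
  shows "gl_act N M a b (contr m i j f) = contr m i j (gl_act N M a b f)"
proof -
  have 1: "EB M a b (contr m i j f) = contr m i j (EB M a b f) + fmul (VA i b) (fmul (VB a j) f)"
    using assms
    by (simp add: contr_def flin_sum[OF flin_EB] EB_fmul_VA EB_fmul_VB flin_add[OF flin_fmul]
        if_zero_fun[OF flin_fmul] sum.distrib sum.delta)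
  have 2: "EA N b a (contr m i j f) = contr m i j (EA N b a f) + fmul (VA i b) (fmul (VB a j) f)"
    using assms
    by (simp add: contr_def flin_sum[OF flin_EA] EA_fmul_VA EA_fmul_VB flin_add[OF flin_fmul]
        if_zero_fun[OF flin_fmul] sum.distrib sum.delta)
  show ?thesis unfolding gl_act_def 1 2 by (simp add: flin_diff[OF flin_contr])
qed

lemma gl_act_contr_der:
  assumes "i < N" "j < M" "a < m" "b < m"
  shows "gl_act N M a b (contr_der m i j f) = contr_der m i j (gl_act N M a b f)"
proof -
  have 1: "EB M a b (contr_der m i j f) = contr_der m i j (EB M a b f) - fder (VA i a) (fder (VB b j) f)"
    using assms
    by (simp add: contr_der_def flin_sum[OF flin_EB] EB_fder_VA EB_fder_VB flin_diff[OF flin_fder]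
        if_zero_fun[OF flin_fder] sum_subtractf sum.delta)
  have 2: "EA N b a (contr_der m i j f) = contr_der m i j (EA N b a f) - fder (VA i a) (fder (VB b j) f)"
    using assms
    by (simp add: contr_der_def flin_sum[OF flin_EA] EA_fder_VA EA_fder_VB flin_diff[OF flin_fder]
        if_zero_fun[OF flin_fder] sum_subtractf sum.delta)
  show ?thesis unfolding gl_act_def 1 2 by (simp add: flin_diff[OF flin_contr_der])
qed

lemma EA_fpoly:
  "finite R \<Longrightarrow> a < m \<Longrightarrow> b < m \<Longrightarrow> f \<in> fpoly (qvars N m M R) d \<Longrightarrow> EA N a b f \<in> fpoly (qvars N m M R) d"
  unfolding EA_def by (intro fpoly_sum fmul_fder_fpoly finite_qvars) auto

lemma EB_fpoly:
  "finite R \<Longrightarrow> a < m \<Longrightarrow> b < m \<Longrightarrow> f \<in> fpoly (qvars N m M R) d \<Longrightarrow> EB M a b f \<in> fpoly (qvars N m M R) d"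
  unfolding EB_def by (intro fpoly_sum fmul_fder_fpoly finite_qvars) auto

lemma gl_act_fpoly:
  "finite R \<Longrightarrow> a < m \<Longrightarrow> b < m \<Longrightarrow> f \<in> fpoly (qvars N m M R) d \<Longrightarrow> gl_act N M a b f \<in> fpoly (qvars N m M R) d"
  unfolding gl_act_def by (intro fpoly_diff EA_fpoly EB_fpoly)

lemma EA_adjoint:
  "finite R \<Longrightarrow> a < m \<Longrightarrow> b < m \<Longrightarrow> fip (qvars N m M R) d (EA N a b f) g = fip (qvars N m M R) d f (EA N b a g)"
  unfolding EA_def fip_sum_left fip_sum_right by (intro sum.cong refl fip_adjoint finite_qvars) auto

lemma EB_adjoint:
  "finite R \<Longrightarrow> a < m \<Longrightarrow> b < m \<Longrightarrow> fip (qvars N m M R) d (EB M a b f) g = fip (qvars N m M R) d f (EB M b a g)"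
  unfolding EB_def fip_sum_left fip_sum_right by (intro sum.cong refl fip_adjoint finite_qvars) auto

lemma gl_act_adjoint:
  "finite R \<Longrightarrow> a < m \<Longrightarrow> b < m \<Longrightarrow>
    fip (qvars N m M R) d (gl_act N M a b f) g = fip (qvars N m M R) d f (gl_act N M b a g)"
  unfolding gl_act_def fip_diff_left fip_diff_right by (simp add: EA_adjoint EB_adjoint)

text \<open>Since the Casimir operator is positive in positive degree, this identity expresses an invariant
  through contractions times invariants of lower degree.\<close>

lemma casimir_invariant:
  assumes inv: "\<And>a b. a < m \<Longrightarrow> b < m \<Longrightarrow> gl_act N M a b f = 0"
  shows "(\<Sum>(a, b)\<in>{..<m} \<times> {..<m}. EA N b a (EA N a b f)) = (\<Sum>(i, j)\<in>{..<N} \<times> {..<M}. contr m i j (contr_der m i j f))"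
proof -
  \<comment> \<open>On an invariant the inner \<open>EA\<close> can be traded for an
    \<open>EB\<close> with the indices of the outer \<open>EA\<close>. The two then involve disjoint
    variables, so multiplications can be collected to the left of derivatives.\<close>
  have EAB: "EB M a b f = EA N b a f" if "a < m" "b < m" for a b
    using inv[OF that] unfolding gl_act_def by simp
  have c1: "fmul (VB a j) (fder (VA i b) g) = fder (VA i b) (fmul (VB a j) g)" for a j i b and g :: "('a qvar \<Rightarrow> nat) \<Rightarrow> complex"
    by (simp add: fder_fmul)
  have "(\<Sum>(i, j)\<in>{..<N} \<times> {..<M}. contr m i j (contr_der m i j f))
    = (\<Sum>i<N. \<Sum>j<M. \<Sum>b<m. \<Sum>a<m. fmul (VA i b) (fder (VA i a) (fmul (VB b j) (fder (VB a j) f))))"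
    by (simp add: sum.cartesian_product[symmetric] contr_def contr_der_def flin_sum[OF flin_fmul] c1)
  also have "\<dots> = (\<Sum>i<N. \<Sum>b<m. \<Sum>j<M. \<Sum>a<m. fmul (VA i b) (fder (VA i a) (fmul (VB b j) (fder (VB a j) f))))"
    by (intro sum.cong refl sum.swap)
  also have "\<dots> = (\<Sum>i<N. \<Sum>b<m. \<Sum>a<m. \<Sum>j<M. fmul (VA i b) (fder (VA i a) (fmul (VB b j) (fder (VB a j) f))))"
    by (intro sum.cong refl sum.swap)
  also have "\<dots> = (\<Sum>b<m. \<Sum>i<N. \<Sum>a<m. \<Sum>j<M. fmul (VA i b) (fder (VA i a) (fmul (VB b j) (fder (VB a j) f))))"
    by (rule sum.swap)
  also have "\<dots> = (\<Sum>b<m. \<Sum>a<m. \<Sum>i<N. \<Sum>j<M. fmul (VA i b) (fder (VA i a) (fmul (VB b j) (fder (VB a j) f))))"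
    by (intro sum.cong refl sum.swap)
  also have "\<dots> = (\<Sum>b<m. \<Sum>a<m. EA N b a (EB M b a f))"
    by (simp add: EA_def EB_def flin_sum[OF flin_fmul] flin_sum[OF flin_fder])
  also have "\<dots> = (\<Sum>b<m. \<Sum>a<m. EA N b a (EA N a b f))"
    by (intro sum.cong refl) (simp add: EAB)
  also have "\<dots> = (\<Sum>(a, b)\<in>{..<m} \<times> {..<m}. EA N b a (EA N a b f))"
    unfolding sum.cartesian_product[symmetric] by (rule sum.swap)
  finally show ?thesis by simp
qed

text \<open>The Euler operator of column \<open>a\<close> multiplies a monomial by its degree in
  that column. Being annihilated by it thus means that no variable of the column occurs.\<close>

lemma EA_diag: "EA N a a f \<alpha> = of_nat (\<Sum>i<N. \<alpha> (VA i a)) * f \<alpha>"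
proof -
  have "fmul v (fder v f) \<alpha> = of_nat (\<alpha> v) * f \<alpha>" for v
    by (cases "\<alpha> v") (auto simp: fmul_def fder_def fun_upd_idem)
  then show ?thesis by (simp add: EA_def fun_sum_apply sum_distrib_right)
qed

lemma EB_diag: "EB M a a f \<alpha> = of_nat (\<Sum>j<M. \<alpha> (VB a j)) * f \<alpha>"
proof -
  have "fmul v (fder v f) \<alpha> = of_nat (\<alpha> v) * f \<alpha>" for v
    by (cases "\<alpha> v") (auto simp: fmul_def fder_def fun_upd_idem)
  then show ?thesis by (simp add: EB_def fun_sum_apply sum_distrib_right)
qed

text \<open>Induction on the degree bound. With \<open>L\<close> the Casimir operator of the
  \<open>VA\<close> half, one writes \<open>f = u - L r\<close> where \<open>L u = 0\<close>. The
  kernel of \<open>L\<close> is the common kernel of the \<open>EA\<close>, so \<open>u\<close> is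
  free of \<open>VA\<close> variables and, being invariant, also of \<open>VB\<close> variables. And
  \<open>L r\<close> is a sum of contractions of the invariants \<open>contr_der m i j r\<close>,
  whose degree is lower.\<close>

lemma first_fundamental_theorem:
  fixes val :: "'p \<Rightarrow> 'r qvar \<Rightarrow> complex"
  assumes R: "finite R"
    and Z: "\<And>i j. i < N \<Longrightarrow> j < M \<Longrightarrow> (\<lambda>p. \<Sum>c<m. val p (VA i c) * val p (VB c j)) \<in> polyfun C"
    and RC: "\<And>\<rho>. \<rho> \<in> R \<Longrightarrow> (\<lambda>p. val p (VR \<rho>)) \<in> polyfun C"
    and f: "f \<in> fpoly (qvars N m M R) d"
    and inv: "\<And>a b. a < m \<Longrightarrow> b < m \<Longrightarrow> gl_act N M a b f = 0"
  shows "(\<lambda>p. fev (qvars N m M R) (val p) f) \<in> polyfun C"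
  using f inv
proof (induction d arbitrary: f)
  case 0
  then have "f = 0" using fpoly_zero by blast
  then show ?case by (simp add: fev_0 pf_const)
next
  case (Suc d f)
  let ?V = "qvars N m M R"
  have V: "finite ?V" using R by (rule finite_qvars)
  define Inv where "Inv = {f \<in> fpoly ?V (Suc d). \<forall>a<m. \<forall>b<m. gl_act N M a b f = 0}"
  have fI: "f \<in> Inv" using Suc.prems by (simp add: Inv_def)
  define L where "L g = (\<Sum>(a, b)\<in>{..<m} \<times> {..<m}. EA N b a (EA N a b g))" for g :: "('r qvar \<Rightarrow> nat) \<Rightarrow> complex"
  have L_alt: "L g = (\<Sum>(i, j)\<in>{..<N} \<times> {..<M}. contr m i j (contr_der m i j g))" if "g \<in> Inv" for g
    unfolding L_def by (rule casimir_invariant) (use that in \<open>auto simp: Inv_def\<close>)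
  have linL: "flin L"
    unfolding L_def case_prod_beta by (intro flin_sums flin_compose[OF flin_EA flin_EA])
  have pL: "L g \<in> fpoly ?V (Suc d)" if "g \<in> fpoly ?V (Suc d)" for g
    unfolding L_def by (rule fpoly_sum) (use that R in \<open>auto intro!: EA_fpoly\<close>)
  \<comment> \<open>By definition \<open>L\<close> involves only one half of the action. Invariance
    of \<open>L g\<close> is seen in the contraction form, both factors of which commute with
    \<open>gl_act\<close>.\<close>
  have LI: "L g \<in> Inv" if "g \<in> Inv" for g
  proof -
    have "gl_act N M a b (L g) = 0" if ab: "a < m" "b < m" for a b
    proof -
      have "gl_act N M a b (L g) = (\<Sum>(i, j)\<in>{..<N} \<times> {..<M}. contr m i j (contr_der m i j (gl_act N M a b g)))"
        unfolding L_alt[OF \<open>g \<in> Inv\<close>] flin_sum[OF flin_gl_act]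
        by (rule sum.cong[OF refl]) (use ab in \<open>auto simp: gl_act_contr gl_act_contr_der\<close>)
      also have "gl_act N M a b g = 0" using \<open>g \<in> Inv\<close> ab by (simp add: Inv_def)
      finally show ?thesis by (simp add: flin_0[OF flin_contr_der] flin_0[OF flin_contr] case_prod_beta)
    qed
    then show ?thesis using pL that by (simp add: Inv_def)
  qed
  have addI: "g + h \<in> Inv" if "g \<in> Inv" "h \<in> Inv" for g h
    using that by (simp add: Inv_def fpoly_add flin_add[OF flin_gl_act])
  have scaleI: "fscale c g \<in> Inv" if "g \<in> Inv" for c g
  proof -
    have "fscale c 0 = (0 :: ('r qvar \<Rightarrow> nat) \<Rightarrow> complex)" by (rule ext) (simp add: fscale_def zero_fun_apply)
    then show ?thesis using that by (simp add: Inv_def fpoly_scale flin_scale[OF flin_gl_act])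
  qed
  have zeroI: "0 \<in> Inv" by (simp add: Inv_def fpoly_0 flin_0[OF flin_gl_act])
  have sumI: "(\<Sum>i\<in>S. g i) \<in> Inv" if "\<And>i. i \<in> S \<Longrightarrow> g i \<in> Inv" for S :: "nat set" and g
    using that by (induction S rule: infinite_finite_induct) (auto intro: addI zeroI)
  have itI: "(L ^^ k) f \<in> Inv" for k by (induction k) (auto intro: LI fI)
  note ks = kernel_sum_squares[where K = "{..<m} \<times> {..<m}" and V = ?V and d = "Suc d"
      and T = "\<lambda>(a, b). EA N a b" and T' = "\<lambda>(a, b). EA N b a" and L = L, OF V]
  have ker: "L (L g) = 0 \<Longrightarrow> L g = 0" and kerE: "L g = 0 \<Longrightarrow> a < m \<Longrightarrow> b < m \<Longrightarrow> EA N a b g = 0"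
    if "g \<in> fpoly ?V (Suc d)" for g a b
    using ks(2)[of g] ks(1)[of g "(a, b)"] that R
    by (auto simp: EA_adjoint EA_fpoly L_def case_prod_beta split_beta)
  obtain n c where nc: "L (f + L (\<Sum>k<(n::nat). fscale (c k) ((L ^^ k) f))) = 0"
    using kernel_projection[OF V linL pL ker Suc.prems(1)] by blast
  \<comment> \<open>A combination of iterates of \<open>L\<close> at \<open>f\<close>, hence again
    invariant.\<close>
  define r where "r = (\<Sum>k<(n::nat). fscale (c k) ((L ^^ k) f))"
  have rI: "r \<in> Inv" unfolding r_def by (intro sumI scaleI itI)
  define u where "u = f + L r"
  have uI: "u \<in> Inv" unfolding u_def by (intro addI fI LI rI)
  have Lu: "L u = 0" using nc unfolding u_def r_def .
  have u0A: "\<alpha> (VA i a) = 0" if "u \<alpha> \<noteq> 0" "i < N" "a < m" for \<alpha> i a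
  proof -
    have "EA N a a u \<alpha> = 0" using kerE[OF _ Lu] uI that by (simp add: Inv_def zero_fun_apply)
    then show ?thesis using that by (simp add: EA_diag del: of_nat_sum)
  qed
  have u0B: "\<alpha> (VB a j) = 0" if "u \<alpha> \<noteq> 0" "a < m" "j < M" for \<alpha> j a
  proof -
    have "EA N a a u = 0" using kerE[OF _ Lu] uI that by (simp add: Inv_def)
    then have "EB M a a u \<alpha> = 0" using uI that by (simp add: Inv_def gl_act_def zero_fun_apply)
    then show ?thesis using that by (simp add: EB_diag del: of_nat_sum)
  qed
  have up: "(\<lambda>p. fev ?V (val p) u) \<in> polyfun C"
  proof (rule fev_polyfun[OF V])
    show "u \<in> fpoly ?V (Suc d)" using uI by (simp add: Inv_def)
    show "(\<lambda>p. val p v) \<in> polyfun C" if "v \<in> ?V" "\<exists>\<alpha>. u \<alpha> \<noteq> 0 \<and> \<alpha> v \<noteq> 0" for v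
    proof (cases v)
      case (VR \<rho>)
      then show ?thesis using RC that(1) by simp
    qed (use that u0A u0B in force)+
  qed
  have fr: "(\<lambda>p. fev ?V (val p) (contr m i j (contr_der m i j r))) \<in> polyfun C" if ij: "i < N" "j < M" for i j
  proof -
    define q where "q = contr_der m i j r"
    have r1: "fder (VB c j) r \<in> fpoly ?V d" if "c < m" for c
      using fder_fpoly[OF V] rI ij that by (simp add: Inv_def)
    have q: "q \<in> fpoly ?V d" unfolding q_def contr_der_def
    proof (rule fpoly_sum)
      fix c assume c: "c \<in> {..<m}"
      show "fder (VA i c) (fder (VB c j) r) \<in> fpoly ?V d"
        using fder_fpoly[OF V, of "VA i c" "fder (VB c j) r" d] r1[of c] c ij by (simp add: fpoly_mono)
    qed
    have "gl_act N M a b q = 0" if "a < m" "b < m" for a b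
      using rI that ij unfolding q_def
      by (simp add: gl_act_contr_der Inv_def flin_0[OF flin_contr_der])
    then have qC: "(\<lambda>p. fev ?V (val p) q) \<in> polyfun C" by (rule Suc.IH[OF q])
    have "fev ?V (val p) (contr m i j q) = (\<Sum>c<m. val p (VA i c) * val p (VB c j)) * fev ?V (val p) q" for p
    proof -
      have "fev ?V (val p) (contr m i j q) = (\<Sum>c<m. fev ?V (val p) (fmul (VA i c) (fmul (VB c j) q)))"
        unfolding contr_def by (rule fev_sum[OF V, where d = "Suc (Suc d)"]) (use ij q V in \<open>auto intro!: fmul_fpoly\<close>)
      also have "\<dots> = (\<Sum>c<m. val p (VA i c) * (val p (VB c j) * fev ?V (val p) q))"
        using ij q V by (intro sum.cong refl) (simp add: fev_fmul[where d = "Suc d"] fev_fmul[where d = d] fmul_fpoly)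
      finally show ?thesis by (simp add: sum_distrib_right mult.assoc)
    qed
    then show ?thesis unfolding q_def[symmetric] using pf_mult[OF Z[OF ij] qC] by simp
  qed
  have cp: "contr m i j (contr_der m i j r) \<in> fpoly ?V (Suc (Suc (Suc d)))" if "i < N" "j < M" for i j
  proof -
    have "contr_der m i j r \<in> fpoly ?V (Suc d)"
      unfolding contr_der_def
    proof (rule fpoly_sum)
      fix c assume c: "c \<in> {..<m}"
      have "fder (VB c j) r \<in> fpoly ?V d" using fder_fpoly[OF V] rI that c by (simp add: Inv_def)
      then show "fder (VA i c) (fder (VB c j) r) \<in> fpoly ?V (Suc d)"
        using fder_fpoly[OF V, of "VA i c" "fder (VB c j) r" d] c that by (simp add: fpoly_mono)
    qed
    then show ?thesis unfolding contr_def using that V by (intro fpoly_sum fmul_fpoly) auto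
  qed
  have "fev ?V (val p) f = fev ?V (val p) u - (\<Sum>(i, j)\<in>{..<N} \<times> {..<M}. fev ?V (val p) (contr m i j (contr_der m i j r)))" for p
  proof -
    have "f = u - L r" by (simp add: u_def)
    then have "fev ?V (val p) f = fev ?V (val p) u - fev ?V (val p) (L r)"
      using fev_diff[OF V, of u "Suc d" "L r"] uI LI[OF rI] by (simp add: Inv_def)
    also have "fev ?V (val p) (L r) = (\<Sum>(i, j)\<in>{..<N} \<times> {..<M}. fev ?V (val p) (contr m i j (contr_der m i j r)))"
      unfolding L_alt[OF rI] case_prod_beta
      by (rule fev_sum[OF V, where d = "Suc (Suc (Suc d))"]) (use cp in auto)
    finally show ?thesis .
  qed
  moreover have "(\<lambda>p. fev ?V (val p) u - (\<Sum>(i, j)\<in>{..<N} \<times> {..<M}. fev ?V (val p) (contr m i j (contr_der m i j r)))) \<in> polyfun C"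
    unfolding case_prod_beta by (intro polyfun_minus up polyfun_sum fr) auto
  ultimately show ?case by simp
qed

section \<open>Differentiation along elementary matrices\<close>

lemma elementary_row_sum:
  fixes B :: "nat \<Rightarrow> complex"
  assumes "x < m" "a < m"
  shows "(\<Sum>c<m. ((if x = c then 1 else 0) + (if x = b \<and> c = a then s else 0)) * B c) = B x + (if x = b then s * B a else 0)"
proof -
  have "(\<Sum>c<m. ((if x = c then 1 else 0) + (if x = b \<and> c = a then s else 0)) * B c)
      = (\<Sum>c<m. (if x = c then B c else 0) + (if c = a then (if x = b then s * B c else 0) else 0))"
    by (intro sum.cong) (auto simp: distrib_right)
  then show ?thesis using assms by (simp add: sum.distrib sum.delta sum.delta')
qed

lemma elementary_column_sum:
  fixes A :: "nat \<Rightarrow> complex"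
  assumes "x < m" "b < m"
  shows "(\<Sum>d<m. A d * ((if d = x then 1 else 0) + (if d = b \<and> x = a then s else 0))) = A x + (if x = a then s * A b else 0)"
proof -
  have "(\<Sum>d<m. A d * ((if d = x then 1 else 0) + (if d = b \<and> x = a then s else 0)))
      = (\<Sum>d<m. (if d = x then A d else 0) + (if d = b then (if x = a then s * A d else 0) else 0))"
    by (intro sum.cong) (auto simp: distrib_left)
  then show ?thesis using assms by (simp add: sum.distrib sum.delta)
qed

text \<open>\<open>gl_act\<close> is a vector field whose component at each variable is the value of
  the case expression. This is the shape in which \<open>fev_has_field_derivative\<close> delivers
  the derivative along a curve of group elements.\<close>

lemma fev_gl_act:
  assumes R: "finite R" and f: "f \<in> fpoly (qvars N m M R) d" and ab: "a < m" "b < m"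
  shows "fev (qvars N m M R) e (gl_act N M a b f) =
    (\<Sum>v\<in>qvars N m M R. (case v of VA i c \<Rightarrow> if c = a then - e (VA i b) else 0
      | VB c j \<Rightarrow> if c = b then e (VB a j) else 0 | VR \<rho> \<Rightarrow> 0) * fev (qvars N m M R) e (fder v f))" (is "?l = (\<Sum>v\<in>_. ?e v * ?f v)")
proof -
  let ?V = "qvars N m M R"
  have V: "finite ?V" using R by (rule finite_qvars)
  have f1: "fder v f \<in> fpoly ?V d" if "v \<in> ?V" for v
  proof (cases d)
    case 0
    then have "f = 0" using f fpoly_zero by blast
    then show ?thesis by (simp add: flin_0[OF flin_fder] fpoly_0)
  next
    case (Suc k)
    then have "fder v f \<in> fpoly ?V k" using fder_fpoly[OF V that] f by blast
    then show ?thesis by (rule fpoly_mono) (simp add: Suc)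
  qed
  have A: "fev ?V e (EA N b a f) = (\<Sum>i<N. e (VA i b) * ?f (VA i a))"
  proof -
    have "fev ?V e (EA N b a f) = (\<Sum>i<N. fev ?V e (fmul (VA i b) (fder (VA i a) f)))"
      unfolding EA_def by (rule fev_sum[OF V, where d = d]) (use ab V f in \<open>auto intro!: fmul_fder_fpoly\<close>)
    also have "\<dots> = (\<Sum>i<N. e (VA i b) * ?f (VA i a))"
      by (rule sum.cong[OF refl fev_fmul[OF V _ f1]]) (use ab in auto)
    finally show ?thesis .
  qed
  have B: "fev ?V e (EB M a b f) = (\<Sum>j<M. e (VB a j) * ?f (VB b j))"
  proof -
    have "fev ?V e (EB M a b f) = (\<Sum>j<M. fev ?V e (fmul (VB a j) (fder (VB b j) f)))"
      unfolding EB_def by (rule fev_sum[OF V, where d = d]) (use ab V f in \<open>auto intro!: fmul_fder_fpoly\<close>)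
    also have "\<dots> = (\<Sum>j<M. e (VB a j) * ?f (VB b j))"
      by (rule sum.cong[OF refl fev_fmul[OF V _ f1]]) (use ab in auto)
    finally show ?thesis .
  qed
  have "(\<Sum>v\<in>?V. ?e v * ?f v) = (\<Sum>v\<in>(\<lambda>(i, c). VA i c) ` ({..<N} \<times> {..<m}). ?e v * ?f v)
      + (\<Sum>v\<in>(\<lambda>(c, j). VB c j) ` ({..<m} \<times> {..<M}). ?e v * ?f v) + (\<Sum>v\<in>VR ` R. ?e v * ?f v)"
    unfolding qvars_def using R by (subst sum.union_disjoint; (subst sum.union_disjoint)?) auto
  also have "(\<Sum>v\<in>VR ` R. ?e v * ?f v) = 0" by (rule sum.neutral) auto
  also have "(\<Sum>v\<in>(\<lambda>(i, c). VA i c) ` ({..<N} \<times> {..<m}). ?e v * ?f v)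
      = (\<Sum>i<N. \<Sum>c<m. if c = a then - e (VA i b) * ?f (VA i c) else 0)"
    unfolding sum.cartesian_product by (subst sum.reindex) (auto simp: inj_on_def intro!: sum.cong)
  also have "(\<Sum>v\<in>(\<lambda>(c, j). VB c j) ` ({..<m} \<times> {..<M}). ?e v * ?f v)
      = (\<Sum>c<m. \<Sum>j<M. if c = b then e (VB a j) * ?f (VB c j) else 0)"
    unfolding sum.cartesian_product by (subst sum.reindex) (auto simp: inj_on_def intro!: sum.cong)
  also have "\<dots> = (\<Sum>j<M. \<Sum>c<m. if c = b then e (VB a j) * ?f (VB c j) else 0)"
    by (rule sum.swap)
  finally show ?thesis
    using ab fev_diff[OF V EB_fpoly[OF R ab f] EA_fpoly[OF R ab(2,1) f], of e] A B
    by (simp add: gl_act_def sum.delta sum_negf)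
qed

lemma fev_cong: "(\<And>v. v \<in> V \<Longrightarrow> e v = e' v) \<Longrightarrow> fev V e f = fev V e' f"
  unfolding fev_def fmon_def by (intro sum.cong refl arg_cong2[of _ _ _ _ "(*)"] prod.cong) auto

text \<open>The projection of \<open>h\<close> to the invariants differs from \<open>h\<close> by a combination of images of \<open>h\<close> under
  operators \<open>D\<close> from the Lie algebra, and \<open>(D h) G = 0\<close> on \<open>X\<close> because \<open>h G\<close> is invariant.\<close>

theorem invariant_quotient:
  fixes X :: "'p set" and aa bb :: "nat \<Rightarrow> nat \<Rightarrow> 'p \<Rightarrow> complex" and F G :: "'p \<Rightarrow> complex"
  assumes R: "finite R"
    and h: "h \<in> polyfun ({aa i c | i c. i < N \<and> c < m} \<union> {bb c j | c j. c < m \<and> j < M} \<union> R)"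
    and inv: "\<And>p g g'. p \<in> X \<Longrightarrow>
       \<forall>x<m. \<forall>y<m. (\<Sum>c<m. g x c * g' c y) = (if x = y then 1 else 0) \<Longrightarrow>
       \<forall>x<m. \<forall>y<m. (\<Sum>c<m. g' x c * g c y) = (if x = y then 1 else 0) \<Longrightarrow>
       \<exists>q\<in>X. (\<forall>i<N. \<forall>c<m. aa i c q = (\<Sum>d<m. aa i d p * g' d c)) \<and>
         (\<forall>c<m. \<forall>j<M. bb c j q = (\<Sum>d<m. g c d * bb d j p)) \<and>
         (\<forall>\<rho>\<in>R. \<rho> q = \<rho> p) \<and> F q = F p \<and> G q = G p"
    and FG: "\<And>p. p \<in> X \<Longrightarrow> F p = h p * G p"
  shows "\<exists>h'\<in>polyfun ({\<lambda>p. \<Sum>c<m. aa i c p * bb c j p | i j. i < N \<and> j < M} \<union> R). \<forall>p\<in>X. F p = h' p * G p"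
proof -
  let ?V = "qvars N m M R"
  have V: "finite ?V" using R by (rule finite_qvars)
  define val where "val p = case_qvar (\<lambda>i c. aa i c p) (\<lambda>c j. bb c j p) (\<lambda>\<rho>. \<rho> p)" for p :: 'p
  have val [simp]: "val p (VA i c) = aa i c p" "val p (VB c j) = bb c j p" "val p (VR \<rho>) = \<rho> p" for p i c j \<rho>
    by (simp_all add: val_def)
  have "\<exists>d h0. h0 \<in> fpoly ?V d \<and> h = (\<lambda>p. fev ?V (val p) h0)"
  proof (rule polyfun_fev[OF V h])
    fix c assume "c \<in> {aa i c | i c. i < N \<and> c < m} \<union> {bb c j | c j. c < m \<and> j < M} \<union> R"
    then consider i k where "c = aa i k" "i < N" "k < m" | k j where "c = bb k j" "k < m" "j < M" | "c \<in> R"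
      by blast
    then show "\<exists>v\<in>?V. c = (\<lambda>p. val p v)"
    proof cases
      case 1
      then show ?thesis by (intro bexI[of _ "VA i k"]) auto
    next
      case 2
      then show ?thesis by (intro bexI[of _ "VB k j"]) auto
    next
      case 3
      then show ?thesis by (intro bexI[of _ "VR c"]) auto
    qed
  qed
  then obtain d h0 where h0: "h0 \<in> fpoly ?V d" "h = (\<lambda>p. fev ?V (val p) h0)" by (elim exE conjE)
  \<comment> \<open>Stated for a general right side \<open>E\<close> because it is used twice: with
    \<open>E = F\<close> for the lift of \<open>h\<close>, and with \<open>E = 0\<close> for
    polynomials already known to vanish on \<open>X\<close> after multiplication by
    \<open>G\<close>.\<close>
  have key: "fev ?V (val p) (gl_act N M a b f) * G p = 0"
    if f: "f \<in> fpoly ?V d" and E: "\<And>q. q \<in> X \<Longrightarrow> fev ?V (val q) f * G q = E q"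
      and Einv: "\<And>q q'. F q = F q' \<Longrightarrow> E q = E q'"
      and p: "p \<in> X" and ab: "a < m" "b < m" for f E p a b
  proof -
    \<comment> \<open>For the elementary matrix E with entry 1 in row \<open>b\<close> and column
      \<open>a\<close>, the inverse of 1 + s E is 1 - (\<tau> s) E: the square of E is 0 for
      \<open>a \<noteq> b\<close> and E for \<open>a = b\<close>. In the latter case s = -1 has to
      be avoided, which is harmless near 0.\<close>
    define \<tau> where "\<tau> s = (if a = b then s / (1 + s) else s)" for s :: complex
    define e where "e s v = (case v of VA i c \<Rightarrow> aa i c p + (if c = a then - \<tau> s * aa i b p else 0)
      | VB c j \<Rightarrow> bb c j p + (if c = b then s * bb a j p else 0) | VR \<rho> \<Rightarrow> \<rho> p)" for s v
    have const: "fev ?V (e s) f * G p = E p" if s: "s \<noteq> -1" for s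
    proof -
      define g where "g x c = (if x = c then 1 else 0) + (if x = b \<and> c = a then s else 0)" for x c :: nat
      define g' where "g' c y = (if c = y then 1 else 0) + (if c = b \<and> y = a then - \<tau> s else 0)" for c y :: nat
      have \<tau>: "s - \<tau> s - (if a = b then s * \<tau> s else 0) = 0"
      proof (cases "a = b")
        case True
        have "1 + s \<noteq> 0" using s by (simp add: add_eq_0_iff)
        then have "\<tau> s * (1 + s) = s" using True by (simp add: \<tau>_def)
        then show ?thesis using True by (simp add: algebra_simps)
      qed (simp add: \<tau>_def)
      have gg': "\<forall>x<m. \<forall>y<m. (\<Sum>c<m. g x c * g' c y) = (if x = y then 1 else 0)"
        unfolding g_def g'_def
        by (intro allI impI, subst elementary_row_sum, assumption, rule ab(1))
           (use \<tau> in \<open>auto simp: algebra_simps split: if_splits\<close>)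
      have g'g: "\<forall>x<m. \<forall>y<m. (\<Sum>c<m. g' x c * g c y) = (if x = y then 1 else 0)"
        unfolding g_def g'_def
        by (intro allI impI, subst elementary_row_sum, assumption, rule ab(1))
           (use \<tau> in \<open>auto simp: algebra_simps split: if_splits\<close>)
      from inv[OF p gg' g'g] obtain q where q: "q \<in> X" "\<And>i c. i < N \<Longrightarrow> c < m \<Longrightarrow> aa i c q = (\<Sum>d<m. aa i d p * g' d c)"
        "\<And>c j. c < m \<Longrightarrow> j < M \<Longrightarrow> bb c j q = (\<Sum>d<m. g c d * bb d j p)"
        "\<And>\<rho>. \<rho> \<in> R \<Longrightarrow> \<rho> q = \<rho> p" "F q = F p" "G q = G p"
        by (elim bexE conjE) simp
      have "fev ?V (e s) f = fev ?V (val q) f"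
      proof (rule fev_cong)
        fix v assume v: "v \<in> ?V"
        show "e s v = val q v"
        proof (cases v)
          case (VA i c)
          then have "i < N" "c < m" using v by simp_all
          then show ?thesis unfolding VA e_def val qvar.case q(2)[OF \<open>i < N\<close> \<open>c < m\<close>] g'_def
            using elementary_column_sum[of c m b "\<lambda>d. aa i d p" a "- \<tau> s"] ab by simp
        next
          case (VB c j)
          then have "c < m" "j < M" using v by simp_all
          then show ?thesis unfolding VB e_def val qvar.case q(3)[OF \<open>c < m\<close> \<open>j < M\<close>] g_def
            using elementary_row_sum[of c m a b s "\<lambda>d. bb d j p"] ab by simp
        next
          case (VR \<rho>)
          then show ?thesis using v q(4)[of \<rho>] by (simp add: e_def)
        qed
      qed
      then show ?thesis using E[OF q(1)] Einv[OF q(5)] q(6) by simp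
    qed
    define e' :: "('p \<Rightarrow> complex) qvar \<Rightarrow> complex" where "e' v = (case v of VA i c \<Rightarrow> if c = a then - aa i b p else 0
      | VB c j \<Rightarrow> if c = b then bb a j p else 0 | VR \<rho> \<Rightarrow> 0)" for v
    have d\<tau>: "(\<tau> has_field_derivative 1) (at 0)"
      unfolding \<tau>_def by (cases "a = b") (auto intro!: derivative_eq_intros)
    have de: "((\<lambda>s. e s v) has_field_derivative e' v) (at 0)" for v
      unfolding e_def e'_def
      by (cases v) (auto intro!: derivative_eq_intros d\<tau>)
    have e0: "e 0 = val p" by (rule ext) (auto simp: e_def \<tau>_def split: qvar.split)
    have "((\<lambda>s. fev ?V (e s) f * G p) has_field_derivative (\<Sum>v\<in>?V. e' v * fev ?V (e 0) (fder v f)) * G p) (at 0)"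
      by (intro DERIV_cmult_right fev_has_field_derivative[OF V f] de)
    moreover have "((\<lambda>s. fev ?V (e s) f * G p) has_field_derivative 0) (at 0)"
    proof (rule DERIV_cong_ev[THEN iffD1, OF refl _ refl DERIV_const])
      show "\<forall>\<^sub>F s in nhds 0. E p = fev ?V (e s) f * G p"
        using const by (intro eventually_mono[OF t1_space_nhds[of 0 "-1"]]) auto
    qed
    ultimately have "(\<Sum>v\<in>?V. e' v * fev ?V (val p) (fder v f)) * G p = 0"
      unfolding e0 by (rule DERIV_unique)
    moreover have "(\<Sum>v\<in>?V. e' v * fev ?V (val p) (fder v f)) = fev ?V (val p) (gl_act N M a b f)"
      unfolding fev_gl_act[OF R f ab] e'_def val ..
    ultimately show ?thesis by simp
  qed
  \<comment> \<open>The space of errors that \<open>G\<close> cannot detect on \<open>X\<close>. It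
    is stable under the Lie algebra and contains the images of \<open>h0\<close> under it, although
    \<open>h0\<close> itself need not lie in it.\<close>
  define K where "K = {f \<in> fpoly ?V d. \<forall>p\<in>X. fev ?V (val p) f * G p = 0}"
  have Kgl: "gl_act N M a b f \<in> K" if "f \<in> K" "a < m" "b < m" for f a b
    using key[of f "\<lambda>_. 0" _ a b] that gl_act_fpoly[OF R that(2,3)] by (auto simp: K_def)
  have Kgl0: "gl_act N M a b h0 \<in> K" if "a < m" "b < m" for a b
    using key[OF h0(1), of F _ a b] FG that gl_act_fpoly[OF R that h0(1)] by (auto simp: K_def h0(2))
  have Kadd: "f + g \<in> K" if "f \<in> K" "g \<in> K" for f g
    using that by (force simp: K_def fpoly_add fev_add[OF V])
  have Kscale: "fscale c f \<in> K" if "f \<in> K" for c f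
    using that by (force simp: K_def fpoly_scale fev_scale[OF V])
  have K0: "0 \<in> K" by (simp add: K_def fpoly_0 fev_0)
  have Ksum': "(\<Sum>i\<in>S. f i) \<in> K" if "\<And>i. i \<in> S \<Longrightarrow> f i \<in> K" for S :: "nat set" and f
    using that by (induction S rule: infinite_finite_induct) (auto intro: Kadd K0)
  define L where "L f = (\<Sum>(a, b)\<in>{..<m} \<times> {..<m}. gl_act N M b a (gl_act N M a b f))"
    for f :: "(('p \<Rightarrow> complex) qvar \<Rightarrow> nat) \<Rightarrow> complex"
  have linL: "flin L"
    unfolding L_def case_prod_beta by (intro flin_sums flin_compose[OF flin_gl_act flin_gl_act])
  have pL: "L g \<in> fpoly ?V d" if "g \<in> fpoly ?V d" for g
    unfolding L_def by (rule fpoly_sum) (use that R in \<open>auto intro!: gl_act_fpoly\<close>)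
  have LK: "L f \<in> K" if "\<And>a b. a < m \<Longrightarrow> b < m \<Longrightarrow> gl_act N M a b f \<in> K" for f
  proof -
    have "(\<Sum>a<m. \<Sum>b<m. gl_act N M b a (gl_act N M a b f)) \<in> K"
      by (intro Ksum' Kgl that) auto
    then show ?thesis by (simp add: L_def sum.cartesian_product)
  qed
  have LitK: "(L ^^ Suc k) h0 \<in> K" for k
  proof (induction k)
    case 0
    show ?case using LK[OF Kgl0] by simp
  next
    case (Suc k)
    show ?case unfolding funpow.simps(2)[of "Suc k"] o_apply by (rule LK[OF Kgl[OF Suc]])
  qed
  note ks = kernel_sum_squares[where K = "{..<m} \<times> {..<m}" and V = ?V and d = d
      and T = "\<lambda>(a, b). gl_act N M a b" and T' = "\<lambda>(a, b). gl_act N M b a" and L = L, OF V]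
  have ker: "L (L g) = 0 \<Longrightarrow> L g = 0" and kerE: "L g = 0 \<Longrightarrow> a < m \<Longrightarrow> b < m \<Longrightarrow> gl_act N M a b g = 0"
    if "g \<in> fpoly ?V d" for g a b
    using ks(2)[of g] ks(1)[of g "(a, b)"] that R
    by (auto simp: gl_act_adjoint gl_act_fpoly L_def case_prod_beta split_beta)
  obtain n c where nc: "L (h0 + L (\<Sum>k<(n::nat). fscale (c k) ((L ^^ k) h0))) = 0"
    using kernel_projection[OF V linL pL ker h0(1)] by blast
  \<comment> \<open>Every term of \<open>r\<close> contains at least one factor \<open>L\<close>, so
    \<open>r\<close> lies in \<open>K\<close>, and adding it to \<open>h0\<close> preserves the
    identity between \<open>F\<close> and \<open>G\<close> on \<open>X\<close>.\<close>
  define r where "r = L (\<Sum>k<n. fscale (c k) ((L ^^ k) h0))"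
  have "r = (\<Sum>k<n. fscale (c k) ((L ^^ Suc k) h0))"
    unfolding r_def by (simp add: flin_sum[OF linL] flin_scale[OF linL])
  then have rK: "r \<in> K" using Ksum'[of "{..<n}" "\<lambda>k. fscale (c k) ((L ^^ Suc k) h0)"] Kscale[OF LitK] by simp
  have h'f: "h0 + r \<in> fpoly ?V d" using h0(1) rK by (intro fpoly_add) (auto simp: K_def)
  let ?C = "{\<lambda>p. \<Sum>c<m. aa i c p * bb c j p | i j. i < N \<and> j < M} \<union> R"
  have C: "(\<lambda>p. fev ?V (val p) (h0 + r)) \<in> polyfun ?C"
  proof (rule first_fundamental_theorem[OF R _ _ h'f])
    show "(\<lambda>p. \<Sum>c<m. val p (VA i c) * val p (VB c j)) \<in> polyfun ?C" if "i < N" "j < M" for i j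
      by (rule pf_coord) (use that in auto)
    show "(\<lambda>p. val p (VR \<rho>)) \<in> polyfun ?C" if "\<rho> \<in> R" for \<rho>
      by (rule pf_coord) (use that in auto)
    show "gl_act N M a b (h0 + r) = 0" if "a < m" "b < m" for a b
      using kerE[OF h'f _ that] nc unfolding r_def by blast
  qed
  have "F p = fev ?V (val p) (h0 + r) * G p" if "p \<in> X" for p
  proof -
    have r: "r \<in> fpoly ?V d" "fev ?V (val p) r * G p = 0" using rK that unfolding K_def by blast+
    then show ?thesis
      using FG[OF that] unfolding fev_add[OF V h0(1) r(1)] distrib_right h0(2) r(2) by simp
  qed
  then show ?thesis by (intro bexI[OF _ C] ballI)
qed

section \<open>Eliminating the inner vertices of the quiver\<close>

definition xmat :: "nat \<Rightarrow> (nat \<Rightarrow> nat) \<Rightarrow> quiver_pt \<Rightarrow> nat \<Rightarrow> nat \<Rightarrow> complex" where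
  "xmat t r p = (\<lambda>a b. \<Sum>c<qdim r (t - 1). fst (snd p) (t - 1) a c * snd (snd p) (t - 1) c b)"

definition qproj :: "nat \<Rightarrow> (nat \<Rightarrow> nat) \<Rightarrow> quiver_pt \<Rightarrow> (nat \<Rightarrow> complex) \<times> (nat \<Rightarrow> nat \<Rightarrow> complex)" where
  "qproj t r p = (fst p t, xmat t r p)"

text \<open>What is left after the vertices below \<open>k\<close> have been eliminated. The entries
  of x are kept at every stage: they are fixed by the base changes at the inner vertices, and they
  are the only trace of A_(t-1) and B_(t-1) once vertex t - 1 is gone.\<close>

definition tail_coords :: "nat \<Rightarrow> (nat \<Rightarrow> nat) \<Rightarrow> nat \<Rightarrow> (quiver_pt \<Rightarrow> complex) set" where
  "tail_coords t r k =
     {(\<lambda>p. fst p i a) | i a. k \<le> i \<and> i \<le> t \<and> a < qdim r i} \<union>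
     {(\<lambda>p. fst (snd p) i a b) | i a b. k \<le> i \<and> i < t \<and> a < qdim r (Suc i) \<and> b < qdim r i} \<union>
     {(\<lambda>p. snd (snd p) i a b) | i a b. k \<le> i \<and> i < t \<and> a < qdim r i \<and> b < qdim r (Suc i)} \<union>
     {(\<lambda>p. xmat t r p a b) | a b. a < qdim r t \<and> b < qdim r t}"

lemma tail_coordsE:
  assumes "c \<in> tail_coords t r k"
  obtains (u) i a where "c = (\<lambda>p. fst p i a)" "k \<le> i" "i \<le> t" "a < qdim r i"
    | (A) i a b where "c = (\<lambda>p. fst (snd p) i a b)" "k \<le> i" "i < t" "a < qdim r (Suc i)" "b < qdim r i"
    | (B) i a b where "c = (\<lambda>p. snd (snd p) i a b)" "k \<le> i" "i < t" "a < qdim r i" "b < qdim r (Suc i)"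
    | (x) a b where "c = (\<lambda>p. xmat t r p a b)" "a < qdim r t" "b < qdim r t"
  using assms unfolding tail_coords_def Un_iff mem_Collect_eq by (elim disjE exE conjE) metis+

lemma tail_coordsI:
  "k \<le> i \<Longrightarrow> i \<le> t \<Longrightarrow> a < qdim r i \<Longrightarrow> (\<lambda>p. fst p i a) \<in> tail_coords t r k"
  "k \<le> i \<Longrightarrow> i < t \<Longrightarrow> a < qdim r (Suc i) \<Longrightarrow> b < qdim r i \<Longrightarrow> (\<lambda>p. fst (snd p) i a b) \<in> tail_coords t r k"
  "k \<le> i \<Longrightarrow> i < t \<Longrightarrow> a < qdim r i \<Longrightarrow> b < qdim r (Suc i) \<Longrightarrow> (\<lambda>p. snd (snd p) i a b) \<in> tail_coords t r k"
  "a < qdim r t \<Longrightarrow> b < qdim r t \<Longrightarrow> (\<lambda>p. xmat t r p a b) \<in> tail_coords t r k"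
  unfolding tail_coords_def Un_iff mem_Collect_eq by metis+

lemma finite_tail_coords: "finite (tail_coords t r k)"
proof (rule finite_subset)
  show "tail_coords t r k \<subseteq>
     (\<lambda>(i, a) p. fst p i a) ` (SIGMA i:{..t}. {..<qdim r i}) \<union>
     (\<lambda>(i, a, b) p. fst (snd p) i a b) ` (SIGMA i:{..<t}. {..<qdim r (Suc i)} \<times> {..<qdim r i}) \<union>
     (\<lambda>(i, a, b) p. snd (snd p) i a b) ` (SIGMA i:{..<t}. {..<qdim r i} \<times> {..<qdim r (Suc i)}) \<union>
     (\<lambda>(a, b) p. xmat t r p a b) ` ({..<qdim r t} \<times> {..<qdim r t})" (is "_ \<subseteq> ?u \<union> ?A \<union> ?B \<union> ?x")
  proof
    fix c assume "c \<in> tail_coords t r k"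
    then show "c \<in> ?u \<union> ?A \<union> ?B \<union> ?x"
    proof (cases rule: tail_coordsE)
      case (u i a)
      then have "c \<in> ?u" by (intro image_eqI[of _ _ "(i, a)"]) auto
      then show ?thesis by simp
    next
      case (A i a b)
      then have "c \<in> ?A" by (intro image_eqI[of _ _ "(i, a, b)"]) auto
      then show ?thesis by simp
    next
      case (B i a b)
      then have "c \<in> ?B" by (intro image_eqI[of _ _ "(i, a, b)"]) auto
      then show ?thesis by simp
    next
      case (x a b)
      then have "c \<in> ?x" by (intro image_eqI[of _ _ "(a, b)"]) auto
      then show ?thesis by simp
    qed
  qed
qed (intro finite_UnI finite_imageI finite_SigmaI; simp)

lemma quiver_coords_eq:
  "quiver_coords t r =
     {(\<lambda>p. fst p i a) | i a. i \<le> t \<and> a < qdim r i} \<union>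
     {(\<lambda>p. fst (snd p) i a b) | i a b. i < t \<and> a < qdim r (Suc i) \<and> b < qdim r i} \<union>
     {(\<lambda>p. snd (snd p) i a b) | i a b. i < t \<and> a < qdim r i \<and> b < qdim r (Suc i)}"
  by (simp add: quiver_coords_def case_prod_unfold)

lemma quiver_coordsE:
  assumes "c \<in> quiver_coords t r"
  obtains (u) i a where "c = (\<lambda>p. fst p i a)" "i \<le> t" "a < qdim r i"
    | (A) i a b where "c = (\<lambda>p. fst (snd p) i a b)" "i < t" "a < qdim r (Suc i)" "b < qdim r i"
    | (B) i a b where "c = (\<lambda>p. snd (snd p) i a b)" "i < t" "a < qdim r i" "b < qdim r (Suc i)"
  using assms unfolding quiver_coords_eq Un_iff mem_Collect_eq by (elim disjE exE conjE) metis+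

text \<open>Vertex 0 carries no coordinates because U_0 = 0, so the elimination can begin at vertex
  1.\<close>

lemma quiver_coords_tail: "quiver_coords t r \<subseteq> tail_coords t r 1"
proof
  fix c assume "c \<in> quiver_coords t r"
  moreover have "1 \<le> i" if "a < qdim r i" for a i using that by (cases i) (auto simp: qdim_def)
  ultimately show "c \<in> tail_coords t r 1"
    by (cases rule: quiver_coordsE) (simp_all add: tail_coordsI)
qed

lemma finite_quiver_coords: "finite (quiver_coords t r)"
  by (rule finite_subset[OF quiver_coords_tail finite_tail_coords])

lemma sum_sandwich:
  fixes g h :: "nat \<Rightarrow> complex"
  shows "(\<Sum>c<N. (\<Sum>d<m. g d * P d c) * (\<Sum>e<m'. Q c e * h e)) = (\<Sum>d<m. \<Sum>e<m'. g d * (\<Sum>c<N. P d c * Q c e) * h e)"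
proof -
  have "(\<Sum>c<N. (\<Sum>d<m. g d * P d c) * (\<Sum>e<m'. Q c e * h e)) = (\<Sum>c<N. \<Sum>d<m. \<Sum>e<m'. g d * (P d c * Q c e) * h e)"
    by (simp add: sum_product mult_ac)
  also have "\<dots> = (\<Sum>d<m. \<Sum>c<N. \<Sum>e<m'. g d * (P d c * Q c e) * h e)"
    by (rule sum.swap)
  also have "\<dots> = (\<Sum>d<m. \<Sum>e<m'. \<Sum>c<N. g d * (P d c * Q c e) * h e)"
    by (intro sum.cong refl sum.swap)
  finally show ?thesis by (simp add: sum_distrib_left sum_distrib_right)
qed

text \<open>An inverse pair inserted between two matrix factors at the moved vertex
  disappears.\<close>

lemma sum_cancel:
  fixes g g' :: "nat \<Rightarrow> nat \<Rightarrow> complex"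
  assumes "\<forall>x<m. \<forall>y<m. (\<Sum>c<m. g' x c * g c y) = (if x = y then 1 else 0)"
  shows "(\<Sum>c<m. (\<Sum>d<m. x d * g' d c) * (\<Sum>e<m. g c e * y e)) = (\<Sum>d<m. x d * y d)"
proof -
  have "(\<Sum>c<m. (\<Sum>d<m. x d * g' d c) * (\<Sum>e<m. g c e * y e)) = (\<Sum>d<m. \<Sum>e<m. x d * (\<Sum>c<m. g' d c * g c e) * y e)"
    by (rule sum_sandwich)
  also have "\<dots> = (\<Sum>d<m. \<Sum>e<m. if d = e then x d * y d else 0)"
    by (intro sum.cong refl) (auto simp: assms)
  finally show ?thesis by (simp add: sum.delta')
qed

lemma sum_swap_left:
  fixes g :: "nat \<Rightarrow> complex"
  shows "(\<Sum>c<N. (\<Sum>d<m. g d * P d c) * u c) = (\<Sum>d<m. g d * (\<Sum>c<N. P d c * u c))"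
  unfolding sum_distrib_left sum_distrib_right by (subst sum.swap) (simp add: mult_ac)

text \<open>Base change in U_k by the matrix \<open>g\<close>, whose inverse \<open>g'\<close> is
  passed separately. The case \<open>i = k\<close> concerns the maps between U_k and U_(k+1), the
  case \<open>Suc i = k\<close> those between U_(k-1) and U_k. Entries beyond \<open>m\<close> are
  set to 0 so that the point stays in the ambient space.\<close>

definition gl_move :: "nat \<Rightarrow> nat \<Rightarrow> (nat \<Rightarrow> nat \<Rightarrow> complex) \<Rightarrow> (nat \<Rightarrow> nat \<Rightarrow> complex) \<Rightarrow> quiver_pt \<Rightarrow> quiver_pt" where
  "gl_move k m g g' p =
    ((\<lambda>i a. if i = k then (if a < m then \<Sum>d<m. g a d * fst p k d else 0) else fst p i a),
     (\<lambda>i a b. if i = k then (if b < m then \<Sum>d<m. fst (snd p) k a d * g' d b else 0)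
        else if Suc i = k then (if a < m then \<Sum>d<m. g a d * fst (snd p) i d b else 0) else fst (snd p) i a b),
     (\<lambda>i a b. if i = k then (if a < m then \<Sum>d<m. g a d * snd (snd p) k d b else 0)
        else if Suc i = k then (if b < m then \<Sum>d<m. snd (snd p) i a d * g' d b else 0) else snd (snd p) i a b))"

lemma enh_quiverD:
  assumes "p \<in> enh_quiver_variety t r I"
  shows "\<And>i a. \<not> (i \<le> t \<and> a < qdim r i) \<Longrightarrow> fst p i a = 0"
    and "\<And>i a b. \<not> (i < t \<and> a < qdim r (Suc i) \<and> b < qdim r i) \<Longrightarrow> fst (snd p) i a b = 0"
    and "\<And>i a b. \<not> (i < t \<and> a < qdim r i \<and> b < qdim r (Suc i)) \<Longrightarrow> snd (snd p) i a b = 0"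
    and "\<And>i a b. 1 \<le> i \<Longrightarrow> i \<le> t - 1 \<Longrightarrow> a < qdim r i \<Longrightarrow> b < qdim r i \<Longrightarrow>
        (\<Sum>c<qdim r (Suc i). snd (snd p) i a c * fst (snd p) i c b) = (\<Sum>c<qdim r (i - 1). fst (snd p) (i - 1) a c * snd (snd p) (i - 1) c b)"
    and "\<And>i a. i \<in> I \<Longrightarrow> a < qdim r i \<Longrightarrow> (\<Sum>c<qdim r (Suc i). snd (snd p) i a c * fst p (Suc i) c) = fst p i a"
    and "\<And>i a. i < t \<Longrightarrow> i \<notin> I \<Longrightarrow> a < qdim r (Suc i) \<Longrightarrow> (\<Sum>c<qdim r i. fst (snd p) i a c * fst p i c) = fst p (Suc i) a"
  using assms unfolding enh_quiver_variety_def quiver_ambient_def by (auto simp: split_beta)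

lemma enh_quiverI:
  assumes "\<And>i a. \<not> (i \<le> t \<and> a < qdim r i) \<Longrightarrow> fst p i a = 0"
    and "\<And>i a b. \<not> (i < t \<and> a < qdim r (Suc i) \<and> b < qdim r i) \<Longrightarrow> fst (snd p) i a b = 0"
    and "\<And>i a b. \<not> (i < t \<and> a < qdim r i \<and> b < qdim r (Suc i)) \<Longrightarrow> snd (snd p) i a b = 0"
    and "\<And>i a b. 1 \<le> i \<Longrightarrow> i \<le> t - 1 \<Longrightarrow> a < qdim r i \<Longrightarrow> b < qdim r i \<Longrightarrow>
        (\<Sum>c<qdim r (Suc i). snd (snd p) i a c * fst (snd p) i c b) = (\<Sum>c<qdim r (i - 1). fst (snd p) (i - 1) a c * snd (snd p) (i - 1) c b)"
    and "\<And>i a. i \<in> I \<Longrightarrow> a < qdim r i \<Longrightarrow> (\<Sum>c<qdim r (Suc i). snd (snd p) i a c * fst p (Suc i) c) = fst p i a"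
    and "\<And>i a. i < t \<Longrightarrow> i \<notin> I \<Longrightarrow> a < qdim r (Suc i) \<Longrightarrow> (\<Sum>c<qdim r i. fst (snd p) i a c * fst p i c) = fst p (Suc i) a"
  shows "p \<in> enh_quiver_variety t r I"
  unfolding enh_quiver_variety_def quiver_ambient_def mem_Collect_eq split_beta fst_conv snd_conv
  by (intro conjI allI impI ballI assms) (elim conjE; assumption | simp)+

lemma gl_move_in:
  assumes p: "p \<in> enh_quiver_variety t r I" and k: "1 \<le> k" "k < t"
    and g'g: "\<forall>x<qdim r k. \<forall>y<qdim r k. (\<Sum>c<qdim r k. g' x c * g c y) = (if x = y then 1 else 0)"
  shows "gl_move k (qdim r k) g g' p \<in> enh_quiver_variety t r I"
proof -
  let ?m = "qdim r k"
  note D = enh_quiverD[OF p]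
  define q where "q = gl_move k ?m g g' p"
  have qu: "fst q i a = (if i = k then (if a < ?m then \<Sum>d<?m. g a d * fst p k d else 0) else fst p i a)" for i a
    by (simp add: q_def gl_move_def)
  have qA: "fst (snd q) i a b = (if i = k then (if b < ?m then \<Sum>d<?m. fst (snd p) k a d * g' d b else 0)
        else if Suc i = k then (if a < ?m then \<Sum>d<?m. g a d * fst (snd p) i d b else 0) else fst (snd p) i a b)" for i a b
    by (simp add: q_def gl_move_def)
  have qB: "snd (snd q) i a b = (if i = k then (if a < ?m then \<Sum>d<?m. g a d * snd (snd p) k d b else 0)
        else if Suc i = k then (if b < ?m then \<Sum>d<?m. snd (snd p) i a d * g' d b else 0) else snd (snd p) i a b)" for i a b
    by (simp add: q_def gl_move_def)
  have "q \<in> enh_quiver_variety t r I"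
  proof (rule enh_quiverI)
    fix i a b :: nat
    show "fst q i a = 0" if "\<not> (i \<le> t \<and> a < qdim r i)"
      using that D(1)[OF that] k by (auto simp: qu)
    show "fst (snd q) i a b = 0" if "\<not> (i < t \<and> a < qdim r (Suc i) \<and> b < qdim r i)"
    proof -
      have "fst (snd p) i a d = 0" if "\<not> (i < t \<and> a < qdim r (Suc i))" for d
        using D(2) that by blast
      moreover have "fst (snd p) i d b = 0" if "\<not> (i < t \<and> b < qdim r i)" for d
        using D(2) that by blast
      ultimately show ?thesis using that k by (auto simp: qA)
    qed
    show "snd (snd q) i a b = 0" if "\<not> (i < t \<and> a < qdim r i \<and> b < qdim r (Suc i))"
    proof -
      have "snd (snd p) i a d = 0" if "\<not> (i < t \<and> a < qdim r i)" for d
        using D(3) that by blast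
      moreover have "snd (snd p) i d b = 0" if "\<not> (i < t \<and> b < qdim r (Suc i))" for d
        using D(3) that by blast
      ultimately show ?thesis using that k by (auto simp: qB)
    qed
    show "(\<Sum>c<qdim r (Suc i). snd (snd q) i a c * fst (snd q) i c b) = (\<Sum>c<qdim r (i - 1). fst (snd q) (i - 1) a c * snd (snd q) (i - 1) c b)"
      if i: "1 \<le> i" "i \<le> t - 1" "a < qdim r i" "b < qdim r i"
    proof -
      note R = D(4)[OF i(1,2)]
      consider "i = k" | "i = Suc k" | "Suc i = k" | "i \<noteq> k" "i \<noteq> Suc k" "Suc i \<noteq> k" by blast
      then show ?thesis
      proof cases
        case 1
        have "(\<Sum>c<qdim r (Suc i). snd (snd q) i a c * fst (snd q) i c b)
          = (\<Sum>d<?m. \<Sum>e<?m. g a d * (\<Sum>c<qdim r (Suc i). snd (snd p) k d c * fst (snd p) k c e) * g' e b)"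
          using i 1 by (simp add: qA qB sum_sandwich)
        also have "\<dots> = (\<Sum>d<?m. \<Sum>e<?m. g a d * (\<Sum>c<qdim r (i - 1). fst (snd p) (i - 1) d c * snd (snd p) (i - 1) c e) * g' e b)"
          using R 1 by (intro sum.cong refl) simp
        also have "\<dots> = (\<Sum>c<qdim r (i - 1). fst (snd q) (i - 1) a c * snd (snd q) (i - 1) c b)"
          using i 1 by (cases k) (simp_all add: qA qB sum_sandwich)
        finally show ?thesis .
      next
        case 2
        then show ?thesis using R[OF i(3,4)] i by (simp add: qA qB sum_cancel[OF g'g])
      next
        case 3
        then have "(\<Sum>c<qdim r (Suc i). snd (snd q) i a c * fst (snd q) i c b) = (\<Sum>c<qdim r (Suc i). snd (snd p) i a c * fst (snd p) i c b)"
          by (auto simp: qA qB sum_cancel[OF g'g])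
        then show ?thesis using R[OF i(3,4)] 3 i by (cases i) (auto simp: qA qB)
      next
        case 4
        then show ?thesis using R[OF i(3,4)] i by (cases i) (auto simp: qA qB)
      qed
    qed
    show "(\<Sum>c<qdim r (Suc i). snd (snd q) i a c * fst q (Suc i) c) = fst q i a" if i: "i \<in> I" "a < qdim r i"
    proof -
      consider "i = k" | "Suc i = k" | "i \<noteq> k" "Suc i \<noteq> k" by blast
      then show ?thesis
      proof cases
        case 1
        then show ?thesis using D(5)[OF i(1)] i by (auto simp: qu qB sum_swap_left)
      next
        case 2
        then show ?thesis using D(5)[OF i] i by (auto simp: qu qB sum_cancel[OF g'g])
      next
        case 3
        then show ?thesis using D(5)[OF i] i by (auto simp: qu qB)
      qed
    qed
    show "(\<Sum>c<qdim r i. fst (snd q) i a c * fst q i c) = fst q (Suc i) a" if i: "i < t" "i \<notin> I" "a < qdim r (Suc i)"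
    proof -
      consider "i = k" | "Suc i = k" | "i \<noteq> k" "Suc i \<noteq> k" by blast
      then show ?thesis
      proof cases
        case 1
        then show ?thesis using D(6)[OF i] i by (auto simp: qu qA sum_cancel[OF g'g])
      next
        case 2
        then show ?thesis using D(6)[OF i(1,2)] i by (auto simp: qu qA sum_swap_left)
      next
        case 3
        then show ?thesis using D(6)[OF i] i by (auto simp: qu qA)
      qed
    qed
  qed
  then show ?thesis by (simp add: q_def)
qed

lemma xmat_gl_move:
  assumes k: "1 \<le> k" "k < t"
    and g'g: "\<forall>x<qdim r k. \<forall>y<qdim r k. (\<Sum>c<qdim r k. g' x c * g c y) = (if x = y then 1 else 0)"
  shows "xmat t r (gl_move k (qdim r k) g g' p) = xmat t r p"
proof (cases "k = t - 1")
  case True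
  show ?thesis unfolding xmat_def True[symmetric] by (simp add: gl_move_def sum_cancel[OF g'g])
next
  case False
  then show ?thesis using k by (auto simp: xmat_def gl_move_def fun_eq_iff)
qed

text \<open>The vector u_k is appended to B_k as column number \<open>qdim r (Suc k)\<close>, so
  both kinds of invariants are entries of one matrix product. On \<open>X\<close>, A_k B_k equals
  B_(k+1) A_(k+1), or x if k + 1 = t. And A_k u_k equals u_(k+1) for k outside \<open>I\<close>, but
  A_k B_k u_(k+1) for k in \<open>I\<close>, because then u_k = B_k u_(k+1).\<close>

lemma eliminate_vertex:
  fixes f g :: "(nat \<Rightarrow> complex) \<times> (nat \<Rightarrow> nat \<Rightarrow> complex) \<Rightarrow> complex"
  assumes k: "1 \<le> k" "k < t" and X: "X = enh_quiver_variety t r I"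
    and h: "h \<in> polyfun (tail_coords t r k)" and eq: "\<And>p. p \<in> X \<Longrightarrow> f (qproj t r p) = h p * g (qproj t r p)"
  shows "\<exists>h'\<in>polyfun (tail_coords t r (Suc k)). \<forall>p\<in>X. f (qproj t r p) = h' p * g (qproj t r p)"
proof -
  let ?m = "qdim r k" and ?N = "qdim r (Suc k)"
  let ?T = "tail_coords t r (Suc k)"
  define aa where "aa i c p = fst (snd p) k i c" for i c :: nat and p :: quiver_pt
  define bb where "bb c j p = (if j < ?N then snd (snd p) k c j else fst p k c)" for c j :: nat and p :: quiver_pt
  define S where "S = {aa i c | i c. i < ?N \<and> c < ?m} \<union> {bb c j | c j. c < ?m \<and> j < Suc ?N}"
  have aaS: "aa i c \<in> S" if "i < ?N" "c < ?m" for i c using that unfolding S_def by blast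
  have bbS: "bb c j \<in> S" if "c < ?m" "j < Suc ?N" for c j using that unfolding S_def by blast
  have "tail_coords t r k \<subseteq> S \<union> ?T"
  proof
    fix c assume "c \<in> tail_coords t r k"
    then show "c \<in> S \<union> ?T"
    proof (cases rule: tail_coordsE)
      case (u i a)
      show ?thesis
      proof (cases "i = k")
        case True
        then have "c = bb a ?N" unfolding bb_def u(1) by simp
        then show ?thesis using bbS[of a ?N] u True by simp
      next
        case False
        then show ?thesis using u by (simp add: tail_coordsI)
      qed
    next
      case (A i a b)
      show ?thesis
      proof (cases "i = k")
        case True
        then have "c = aa a b" unfolding aa_def A(1) by simp
        then show ?thesis using aaS[of a b] A True by simp
      next
        case False
        then show ?thesis using A by (simp add: tail_coordsI)
      qed
    next
      case (B i a b)
      show ?thesis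
      proof (cases "i = k")
        case True
        then have "c = bb a b" using B unfolding bb_def B(1) by simp
        then show ?thesis using bbS[of a b] B True by simp
      next
        case False
        then show ?thesis using B by (simp add: tail_coordsI)
      qed
    next
      case (x a b)
      then show ?thesis by (simp add: tail_coordsI)
    qed
  qed
  with h have h': "h \<in> polyfun ({aa i c | i c. i < ?N \<and> c < ?m} \<union> {bb c j | c j. c < ?m \<and> j < Suc ?N} \<union> ?T)"
    unfolding S_def by (rule polyfun_mono)
  have "\<exists>h'\<in>polyfun ({\<lambda>p. \<Sum>c<?m. aa i c p * bb c j p | i j. i < ?N \<and> j < Suc ?N} \<union> ?T).
      \<forall>p\<in>X. f (qproj t r p) = h' p * g (qproj t r p)"
  proof (rule invariant_quotient[OF finite_tail_coords h' _ eq])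
    fix p and \<gamma> \<gamma>' :: "nat \<Rightarrow> nat \<Rightarrow> complex" assume p: "p \<in> X"
      and "\<forall>x<?m. \<forall>y<?m. (\<Sum>c<?m. \<gamma> x c * \<gamma>' c y) = (if x = y then 1 else 0)"
      and g'g: "\<forall>x<?m. \<forall>y<?m. (\<Sum>c<?m. \<gamma>' x c * \<gamma> c y) = (if x = y then 1 else 0)"
    let ?q = "gl_move k ?m \<gamma> \<gamma>' p"
    note x = xmat_gl_move[OF k g'g, where p = p]
    have pr: "qproj t r ?q = qproj t r p"
      unfolding qproj_def x using k by (simp add: gl_move_def fun_eq_iff)
    have T: "\<rho> ?q = \<rho> p" if "\<rho> \<in> ?T" for \<rho>
      using that by (cases rule: tail_coordsE) (simp_all add: x, auto simp: gl_move_def)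
    show "\<exists>q\<in>X. (\<forall>i<?N. \<forall>c<?m. aa i c q = (\<Sum>d<?m. aa i d p * \<gamma>' d c)) \<and>
         (\<forall>c<?m. \<forall>j<Suc ?N. bb c j q = (\<Sum>d<?m. \<gamma> c d * bb d j p)) \<and>
         (\<forall>\<rho>\<in>?T. \<rho> q = \<rho> p) \<and> f (qproj t r q) = f (qproj t r p) \<and> g (qproj t r q) = g (qproj t r p)"
    proof (intro bexI[of _ ?q] conjI)
      show "?q \<in> X" using gl_move_in[OF p[unfolded X] k g'g] by (simp add: X)
      show "\<forall>\<rho>\<in>?T. \<rho> ?q = \<rho> p" by (intro ballI T)
      show "f (qproj t r ?q) = f (qproj t r p)" "g (qproj t r ?q) = g (qproj t r p)" by (simp_all only: pr)
    qed (simp_all add: aa_def bb_def gl_move_def)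
  qed
  then obtain h1 where h1: "h1 \<in> polyfun ({\<lambda>p. \<Sum>c<?m. aa i c p * bb c j p | i j. i < ?N \<and> j < Suc ?N} \<union> ?T)"
    "\<And>p. p \<in> X \<Longrightarrow> f (qproj t r p) = h1 p * g (qproj t r p)" by (elim bexE) simp
  have AB: "\<exists>d\<in>polyfun ?T. \<forall>p\<in>X. (\<Sum>c<?m. fst (snd p) k i c * snd (snd p) k c j) = d p" if ij: "i < ?N" "j < ?N" for i j
  proof (cases "Suc k = t")
    case True
    then have k': "k = t - 1" by simp
    show ?thesis
    proof (rule bexI[of _ "\<lambda>p. xmat t r p i j"])
      show "(\<lambda>p. xmat t r p i j) \<in> polyfun ?T"
        by (intro pf_coord tail_coordsI) (use ij True in auto)
    qed (simp add: xmat_def k')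
  next
    case False
    show ?thesis
    proof (rule bexI[of _ "\<lambda>p. \<Sum>c<qdim r (Suc (Suc k)). snd (snd p) (Suc k) i c * fst (snd p) (Suc k) c j"])
      show "(\<lambda>p. \<Sum>c<qdim r (Suc (Suc k)). snd (snd p) (Suc k) i c * fst (snd p) (Suc k) c j) \<in> polyfun ?T"
      proof (intro polyfun_sum pf_mult)
        fix c assume "c \<in> {..<qdim r (Suc (Suc k))}"
        then show "(\<lambda>p. snd (snd p) (Suc k) i c) \<in> polyfun ?T" "(\<lambda>p. fst (snd p) (Suc k) c j) \<in> polyfun ?T"
          using ij k False by (auto intro!: pf_coord tail_coordsI)
      qed
      show "\<forall>p\<in>X. (\<Sum>c<?m. fst (snd p) k i c * snd (snd p) k c j) =
          (\<Sum>c<qdim r (Suc (Suc k)). snd (snd p) (Suc k) i c * fst (snd p) (Suc k) c j)"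
        using enh_quiverD(4)[of _ t r I "Suc k" i j] ij k False unfolding X by simp
    qed
  qed
  have ut: "(\<lambda>p. fst p (Suc k) j) \<in> polyfun ?T" if "j < ?N" for j
    by (intro pf_coord tail_coordsI) (use that k in auto)
  have "\<exists>h2\<in>polyfun ?T. \<forall>p\<in>X. h1 p = h2 p"
  proof (rule polyfun_agree[OF h1(1)])
    fix c assume "c \<in> {\<lambda>p. \<Sum>c<?m. aa i c p * bb c j p | i j. i < ?N \<and> j < Suc ?N} \<union> ?T"
    then consider i j where "c = (\<lambda>p. \<Sum>c<?m. aa i c p * bb c j p)" "i < ?N" "j < ?N"
      | i where "c = (\<lambda>p. \<Sum>c<?m. aa i c p * bb c ?N p)" "i < ?N" | "c \<in> ?T"
      by (auto simp: less_Suc_eq)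
    then show "\<exists>d\<in>polyfun ?T. \<forall>p\<in>X. c p = d p"
    proof cases
      case 1
      then show ?thesis using AB[of i j] by (simp add: aa_def bb_def)
    next
      case 2
      show ?thesis
      proof (cases "k \<in> I")
        case False
        show ?thesis
          by (rule bexI[OF _ ut[OF 2(2)]])
             (use 2 k False in \<open>auto simp: X aa_def bb_def enh_quiverD(6)\<close>)
      next
        case True
        have "\<forall>j\<in>{..<?N}. \<exists>d. d \<in> polyfun ?T \<and> (\<forall>p\<in>X. (\<Sum>c<?m. fst (snd p) k i c * snd (snd p) k c j) = d p)"
          using AB[OF 2(2)] by (auto simp: Bex_def)
        from bchoice[OF this] obtain d where "\<forall>j\<in>{..<?N}. d j \<in> polyfun ?T \<and>
            (\<forall>p\<in>X. (\<Sum>c<?m. fst (snd p) k i c * snd (snd p) k c j) = d j p)" by (rule exE)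
        then have d: "d j \<in> polyfun ?T"
          "p \<in> X \<Longrightarrow> (\<Sum>c<?m. fst (snd p) k i c * snd (snd p) k c j) = d j p" if "j < ?N" for j p
          using that by simp_all
        show ?thesis
        proof (rule bexI[of _ "\<lambda>p. \<Sum>j<?N. d j p * fst p (Suc k) j"])
          show "(\<lambda>p. \<Sum>j<?N. d j p * fst p (Suc k) j) \<in> polyfun ?T"
            by (intro polyfun_sum pf_mult; rule d(1) ut) auto
          show "\<forall>p\<in>X. c p = (\<Sum>j<?N. d j p * fst p (Suc k) j)"
          proof
            fix p assume p: "p \<in> X"
            have "c p = (\<Sum>c<?m. fst (snd p) k i c * (\<Sum>j<?N. snd (snd p) k c j * fst p (Suc k) j))"
              unfolding 2(1) aa_def bb_def using enh_quiverD(5)[OF p[unfolded X] True] by simp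
            also have "\<dots> = (\<Sum>j<?N. (\<Sum>c<?m. fst (snd p) k i c * snd (snd p) k c j) * fst p (Suc k) j)"
              by (rule sum_swap_left[symmetric])
            finally show "c p = (\<Sum>j<?N. d j p * fst p (Suc k) j)" using d(2) p by simp
          qed
        qed
      qed
    next
      case 3
      then show ?thesis by (intro bexI[of _ c] pf_coord) auto
    qed
  qed
  then show ?thesis using h1(2) by (elim bexE) (rule bexI, auto)
qed

lemma polyfun_factor:
  assumes "f \<in> polyfun {\<lambda>x. c (\<phi> x) | c. c \<in> C}"
  shows "\<exists>h\<in>polyfun C. f = (\<lambda>x. h (\<phi> x))"
  using assms
proof (induction)
  case (pf_const c)
  show ?case by (rule bexI[OF refl polyfun.pf_const])
next
  case (pf_coord f)
  then obtain c where "c \<in> C" "f = (\<lambda>x. c (\<phi> x))" by blast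
  then show ?case by (intro bexI[of _ c] polyfun.pf_coord)
next
  case (pf_add f g)
  then obtain h k where "h \<in> polyfun C" "f = (\<lambda>x. h (\<phi> x))" "k \<in> polyfun C" "g = (\<lambda>x. k (\<phi> x))" by (elim bexE)
  then show ?case by (intro bexI[of _ "\<lambda>x. h x + k x"] polyfun.pf_add) simp_all
next
  case (pf_mult f g)
  then obtain h k where "h \<in> polyfun C" "f = (\<lambda>x. h (\<phi> x))" "k \<in> polyfun C" "g = (\<lambda>x. k (\<phi> x))" by (elim bexE)
  then show ?case by (intro bexI[of _ "\<lambda>x. h x * k x"] polyfun.pf_mult) simp_all
qed

lemma VN_coords_eq:
  "VN_coords n = {(\<lambda>q. fst q a) | a. a < n} \<union> {(\<lambda>q. snd q a b) | a b. a < n \<and> b < n}"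
  by (simp add: VN_coords_def case_prod_unfold)

lemma tail_coords_last:
  "tail_coords t r t \<subseteq> {\<lambda>p. c (qproj t r p) | c. c \<in> VN_coords (qdim r t)}"
proof
  fix c assume "c \<in> tail_coords t r t"
  then show "c \<in> {\<lambda>p. c (qproj t r p) | c. c \<in> VN_coords (qdim r t)}"
  proof (cases rule: tail_coordsE)
    case (u i a)
    then show ?thesis unfolding mem_Collect_eq qproj_def VN_coords_eq
      by (intro exI[of _ "\<lambda>q. fst q a"]) auto
  next
    case (x a b)
    then show ?thesis unfolding mem_Collect_eq qproj_def VN_coords_eq
      by (intro exI[of _ "\<lambda>q. snd q a b"]) auto
  qed simp_all
qed

text \<open>The vertices 1 to t - 1 are eliminated in increasing order. What remains are u_t and x,
  the coordinates of \<open>qproj\<close>.\<close>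

theorem quotient_descends:
  fixes f g :: "(nat \<Rightarrow> complex) \<times> (nat \<Rightarrow> nat \<Rightarrow> complex) \<Rightarrow> complex"
  assumes t: "1 \<le> t" and X: "X = enh_quiver_variety t r I"
    and h: "h \<in> polyfun (quiver_coords t r)" and eq: "\<And>p. p \<in> X \<Longrightarrow> f (qproj t r p) = h p * g (qproj t r p)"
  shows "\<exists>h'\<in>polyfun (VN_coords (qdim r t)). \<forall>p\<in>X. f (qproj t r p) = h' (qproj t r p) * g (qproj t r p)"
proof -
  have "k \<le> t \<Longrightarrow> \<exists>h'\<in>polyfun (tail_coords t r k). \<forall>p\<in>X. f (qproj t r p) = h' p * g (qproj t r p)"
    if "1 \<le> k" for k
    using that
  proof (induction k rule: dec_induct)
    case base
    show ?case by (rule bexI[OF _ polyfun_mono[OF h quiver_coords_tail]]) (use eq in simp)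
  next
    case (step k)
    then obtain h' where h': "h' \<in> polyfun (tail_coords t r k)" "\<And>p. p \<in> X \<Longrightarrow> f (qproj t r p) = h' p * g (qproj t r p)"
      by (auto elim!: bexE)
    show ?case by (rule eliminate_vertex[OF _ _ X h']) (use step in auto)
  qed
  from this[OF t order_refl] obtain h' where h': "h' \<in> polyfun (tail_coords t r t)"
    "\<forall>p\<in>X. f (qproj t r p) = h' p * g (qproj t r p)" by (elim bexE)
  from polyfun_factor[OF polyfun_mono[OF h'(1) tail_coords_last]]
  obtain h2 where "h2 \<in> polyfun (VN_coords (qdim r t))" "h' = (\<lambda>p. h2 (qproj t r p))" by (elim bexE)
  then show ?thesis using h'(2) by (intro bexI[of _ h2]) auto
qed

text \<open>Weight 1 for all A and B respects the relation between B A and A B. The equations for u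
  force its weight \<open>w\<close> to drop by 1 from \<open>i\<close> to \<open>Suc i\<close> when
  \<open>i \<in> I\<close> and to rise by 1 otherwise. The offset t + 1 keeps the weights positive,
  so that scaling by 0 sends every point to the origin.\<close>

lemma quiver_domain:
  assumes nv: "normal_variety (quiver_coords t r) X" and X: "X = enh_quiver_variety t r I"
    and G: "G \<in> polyfun (quiver_coords t r)" and p0: "p0 \<in> X" "G p0 \<noteq> 0"
    and h: "h \<in> polyfun (quiver_coords t r)" "\<And>p. p \<in> X \<Longrightarrow> G p * h p = 0" and p: "p \<in> X"
  shows "h p = 0"
proof -
  define w where "w i = t + 1 + card ({..<i} - I) - card ({..<i} \<inter> I)" for i
  have le: "card ({..<i} \<inter> I) \<le> t" if "i \<le> t" for i
    using card_mono[of "{..<i}" "{..<i} \<inter> I"] that by simp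
  have wpos: "w i > 0" if "i \<le> t" for i using le[OF that] by (simp add: w_def)
  have wI: "w i = Suc (w (Suc i))" if "i < t" "i \<in> I" for i
  proof -
    have "{..<Suc i} - I = {..<i} - I" "{..<Suc i} \<inter> I = insert i ({..<i} \<inter> I)"
      using that by (simp_all add: lessThan_Suc insert_Diff_if Int_insert_left)
    then show ?thesis using le[of "Suc i"] that by (simp add: w_def)
  qed
  have wnI: "w (Suc i) = Suc (w i)" if "i < t" "i \<notin> I" for i
  proof -
    have "{..<Suc i} - I = insert i ({..<i} - I)" "{..<Suc i} \<inter> I = {..<i} \<inter> I"
      using that by (simp_all add: lessThan_Suc insert_Diff_if Int_insert_left)
    then show ?thesis using le[of i] that by (simp add: w_def)
  qed
  define sc :: "complex \<Rightarrow> quiver_pt \<Rightarrow> quiver_pt" where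
    "sc s p = ((\<lambda>i a. s ^ w i * fst p i a), (\<lambda>i a b. s * fst (snd p) i a b), (\<lambda>i a b. s * snd (snd p) i a b))" for s p
  have in_X: "sc s p \<in> X" if "p \<in> X" for s p
  proof -
    note D = enh_quiverD[OF that[unfolded X]]
    show ?thesis unfolding X
    proof (rule enh_quiverI)
      fix i a b :: nat
      show "(\<Sum>c<qdim r (Suc i). snd (snd (sc s p)) i a c * fst (snd (sc s p)) i c b) = (\<Sum>c<qdim r (i - 1). fst (snd (sc s p)) (i - 1) a c * snd (snd (sc s p)) (i - 1) c b)"
        if i: "1 \<le> i" "i \<le> t - 1" "a < qdim r i" "b < qdim r i"
      proof -
        have "(\<Sum>c<qdim r (Suc i). snd (snd (sc s p)) i a c * fst (snd (sc s p)) i c b)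
            = s * s * (\<Sum>c<qdim r (Suc i). snd (snd p) i a c * fst (snd p) i c b)"
          by (simp add: sc_def sum_distrib_left mult_ac)
        also have "\<dots> = (\<Sum>c<qdim r (i - 1). fst (snd (sc s p)) (i - 1) a c * snd (snd (sc s p)) (i - 1) c b)"
          unfolding D(4)[OF i] by (simp add: sc_def sum_distrib_left mult_ac)
        finally show ?thesis .
      qed
      show "(\<Sum>c<qdim r (Suc i). snd (snd (sc s p)) i a c * fst (sc s p) (Suc i) c) = fst (sc s p) i a" if i: "i \<in> I" "a < qdim r i"
      proof (cases "i < t")
        case True
        have "(\<Sum>c<qdim r (Suc i). snd (snd (sc s p)) i a c * fst (sc s p) (Suc i) c)
            = s * s ^ w (Suc i) * (\<Sum>c<qdim r (Suc i). snd (snd p) i a c * fst p (Suc i) c)"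
          by (simp add: sc_def sum_distrib_left mult_ac)
        then show ?thesis unfolding D(5)[OF i] by (simp add: sc_def wI[OF True i(1)])
      next
        case False
        \<comment> \<open>Here \<open>I\<close> is not confined to indices below \<open>t\<close>;
          from \<open>t\<close> on its equations merely say that u_i is 0.\<close>
        have "fst p i a = 0" using D(5)[OF i] D(1)[of "Suc i"] False by simp
        then show ?thesis using False D(1)[of "Suc i"] by (simp add: sc_def)
      qed
      show "(\<Sum>c<qdim r i. fst (snd (sc s p)) i a c * fst (sc s p) i c) = fst (sc s p) (Suc i) a"
        if i: "i < t" "i \<notin> I" "a < qdim r (Suc i)"
      proof -
        have "(\<Sum>c<qdim r i. fst (snd (sc s p)) i a c * fst (sc s p) i c) = s * s ^ w i * (\<Sum>c<qdim r i. fst (snd p) i a c * fst p i c)"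
          by (simp add: sc_def sum_distrib_left mult_ac)
        then show ?thesis unfolding D(6)[OF i] by (simp add: sc_def wnI[OF i(1,2)])
      qed
    qed (use D(1-3) in \<open>auto simp: sc_def\<close>)
  qed
  show ?thesis
  proof (rule normal_cone_domain[OF nv finite_quiver_coords in_X _ _ _ G p0 h p])
    show "sc 1 p = p" for p by (simp add: sc_def)
    show "sc 0 p = (\<lambda>_ _. 0, \<lambda>_ _ _. 0, \<lambda>_ _ _. 0)" if "p \<in> X" for p
    proof -
      have "0 ^ w i * fst p i a = 0" for i a
        using wpos[of i] enh_quiverD(1)[OF that[unfolded X], of i a] by (cases "i \<le> t") (auto simp: zero_power)
      then show ?thesis unfolding sc_def by (simp only: mult_zero_left)
    qed
    show "continuous_on UNIV (\<lambda>s. c (sc s p))" if "c \<in> quiver_coords t r" for c p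
      using that by (cases rule: quiver_coordsE) (auto simp: sc_def intro!: continuous_intros)
  qed
qed

section \<open>Bases and matrices depending polynomially on a point\<close>

text \<open>The coordinates of \<open>w\<close> in the basis \<open>e\<close>. The convention that
  they are 0 outside \<open>J\<close> later absorbs the ends of Jordan chains.\<close>

definition bco :: "nat \<Rightarrow> (nat \<times> nat) set \<Rightarrow> (nat \<times> nat \<Rightarrow> nat \<Rightarrow> complex) \<Rightarrow> (nat \<Rightarrow> complex) \<Rightarrow> nat \<times> nat \<Rightarrow> complex" where
  "bco n J e w = (THE c. (\<forall>p. p \<notin> J \<longrightarrow> c p = 0) \<and> w = (\<lambda>a. \<Sum>p\<in>J. c p * e p a))"

lemma
  assumes "is_basis_family n J e" "vec_in n w"
  shows bco_outside: "q \<notin> J \<Longrightarrow> bco n J e w q = 0"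
    and bco_expand: "w = (\<lambda>a. \<Sum>q\<in>J. bco n J e w q * e q a)"
    and bco_unique: "(\<And>q. q \<notin> J \<Longrightarrow> c q = 0) \<Longrightarrow> w = (\<lambda>a. \<Sum>q\<in>J. c q * e q a) \<Longrightarrow> bco n J e w = c"
proof -
  have ex: "\<exists>!c. (\<forall>p. p \<notin> J \<longrightarrow> c p = 0) \<and> w = (\<lambda>a. \<Sum>p\<in>J. c p * e p a)"
    using assms unfolding is_basis_family_def by blast
  have th: "(\<forall>p. p \<notin> J \<longrightarrow> bco n J e w p = 0) \<and> w = (\<lambda>a. \<Sum>p\<in>J. bco n J e w p * e p a)"
    unfolding bco_def by (rule theI'[OF ex])
  show "q \<notin> J \<Longrightarrow> bco n J e w q = 0" by (rule mp[OF spec[OF conjunct1[OF th]]])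
  show "w = (\<lambda>a. \<Sum>q\<in>J. bco n J e w q * e q a)" by (rule conjunct2[OF th])
  show "bco n J e w = c" if "\<And>q. q \<notin> J \<Longrightarrow> c q = 0" "w = (\<lambda>a. \<Sum>q\<in>J. c q * e q a)"
    unfolding bco_def by (rule the1_equality[OF ex]) (intro conjI allI impI that; assumption)
qed

lemma basis_vec_in: "is_basis_family n J e \<Longrightarrow> q \<in> J \<Longrightarrow> vec_in n (e q)"
  unfolding is_basis_family_def by blast

lemma vec_in_sum: "(\<And>q. q \<in> J \<Longrightarrow> vec_in n (e q)) \<Longrightarrow> vec_in n (\<lambda>a. \<Sum>q\<in>J. c q * e q a)"
  unfolding vec_in_def by simp

lemma bco_basis:
  assumes "is_basis_family n J e" "finite J" "q \<in> J"
  shows "bco n J e (e q) = (\<lambda>q'. if q' = q then 1 else 0)"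
proof (rule bco_unique[OF assms(1) basis_vec_in[OF assms(1,3)]])
  have "e q a = (\<Sum>q'\<in>J. if q' = q then e q' a else 0)" for a
    using assms by (simp add: sum.delta)
  also have "\<dots> a = (\<Sum>q'\<in>J. (if q' = q then 1 else 0) * e q' a)" for a
    by (intro sum.cong) auto
  finally show "e q = (\<lambda>a. \<Sum>q'\<in>J. (if q' = q then 1 else 0) * e q' a)" by (rule ext)
qed (use assms in auto)

lemma bco_sum:
  assumes b: "is_basis_family n J e" and w: "\<And>i. i \<in> S \<Longrightarrow> vec_in n (w i)"
  shows "bco n J e (\<lambda>a. \<Sum>i\<in>S. x i * w i a) = (\<lambda>q. \<Sum>i\<in>S. x i * bco n J e (w i) q)"
proof (rule bco_unique[OF b vec_in_sum[OF w]])
  show "(\<Sum>i\<in>S. x i * bco n J e (w i) q) = 0" if "q \<notin> J" for q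
    using bco_outside[OF b w that] by (intro sum.neutral) simp
  show "(\<lambda>a. \<Sum>i\<in>S. x i * w i a) = (\<lambda>a. \<Sum>q\<in>J. (\<Sum>i\<in>S. x i * bco n J e (w i) q) * e q a)"
  proof
    fix a
    have "(\<Sum>i\<in>S. x i * w i a) = (\<Sum>i\<in>S. x i * (\<Sum>q\<in>J. bco n J e (w i) q * e q a))"
      using fun_cong[OF bco_expand[OF b w]] by (intro sum.cong refl arg_cong2[of _ _ _ _ "(*)"]) blast
    also have "\<dots> = (\<Sum>q\<in>J. (\<Sum>i\<in>S. x i * bco n J e (w i) q) * e q a)"
      unfolding sum_distrib_left sum_distrib_right by (subst sum.swap) (simp add: mult.assoc)
    finally show "(\<Sum>i\<in>S. x i * w i a) = (\<Sum>q\<in>J. (\<Sum>i\<in>S. x i * bco n J e (w i) q) * e q a)" .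
  qed
qed auto

definition unit_vec' :: "nat \<Rightarrow> nat \<Rightarrow> complex" where
  "unit_vec' b = (\<lambda>a. if a = b then 1 else 0)"

lemma vec_in_unit: "b < n \<Longrightarrow> vec_in n (unit_vec' b)"
  by (simp add: vec_in_def unit_vec'_def)

lemma vec_unit_expand: "vec_in n w \<Longrightarrow> w = (\<lambda>a. \<Sum>b<n. w b * unit_vec' b a)"
proof
  fix a assume w: "vec_in n w"
  have "(\<Sum>b<n. w b * unit_vec' b a) = (\<Sum>b<n. if a = b then w b else 0)"
    by (intro sum.cong) (auto simp: unit_vec'_def)
  then show "w a = (\<Sum>b<n. w b * unit_vec' b a)" using w by (simp add: vec_in_def)
qed

lemma bco_units:
  assumes b: "is_basis_family n J e" and w: "vec_in n w"
  shows "bco n J e w q = (\<Sum>a<n. w a * bco n J e (unit_vec' a) q)"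
  using bco_sum[OF b, of "{..<n}" unit_vec' w] vec_unit_expand[OF w] vec_in_unit by (metis lessThan_iff)

lemma mv_sum: "mv k M (\<lambda>a. \<Sum>i\<in>S. x i * w i a) = (\<lambda>a. \<Sum>i\<in>S. x i * mv k M (w i) a)"
proof
  fix a
  have "mv k M (\<lambda>a. \<Sum>i\<in>S. x i * w i a) a = (\<Sum>b<k. \<Sum>i\<in>S. x i * (M a b * w i b))"
    by (simp add: mv_def sum_distrib_left mult_ac)
  also have "\<dots> = (\<Sum>i\<in>S. \<Sum>b<k. x i * (M a b * w i b))" by (rule sum.swap)
  finally show "mv k M (\<lambda>a. \<Sum>i\<in>S. x i * w i a) a = (\<Sum>i\<in>S. x i * mv k M (w i) a)"
    by (simp add: mv_def sum_distrib_left)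
qed

lemma mv_scale: "mv k M (\<lambda>a. c * w a) = (\<lambda>a. c * mv k M w a)"
  by (simp add: mv_def sum_distrib_left mult_ac)

lemma mv_diff: "mv k M (\<lambda>a. w a - w' a) = (\<lambda>a. mv k M w a - mv k M w' a)"
  by (simp add: mv_def right_diff_distrib sum_subtractf)

lemma mv_zero: "mv k M (\<lambda>_. 0) = (\<lambda>_. 0)"
  by (simp add: mv_def)

lemma mv_vec_in: "mat_in m k M \<Longrightarrow> vec_in m (mv k M w)"
  by (simp add: mv_def vec_in_def mat_in_def)

lemma exists_matrix:
  assumes b: "is_basis_family k J e" and J: "finite J" and f: "\<And>q. q \<in> J \<Longrightarrow> vec_in m (f q)"
  shows "\<exists>M. mat_in m k M \<and> (\<forall>q\<in>J. mv k M (e q) = f q)"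
proof (intro exI conjI ballI)
  define M where "M a c = (if c < k then \<Sum>q\<in>J. bco k J e (unit_vec' c) q * f q a else 0)" for a c
  show "mat_in m k M" using f by (auto simp: mat_in_def M_def vec_in_def)
  fix q assume q: "q \<in> J"
  have "mv k M (e q) a = f q a" for a
  proof -
    have "mv k M (e q) a = (\<Sum>c<k. \<Sum>q'\<in>J. (e q c * bco k J e (unit_vec' c) q') * f q' a)"
      by (simp add: mv_def M_def sum_distrib_left sum_distrib_right mult_ac)
    also have "\<dots> = (\<Sum>q'\<in>J. (\<Sum>c<k. e q c * bco k J e (unit_vec' c) q') * f q' a)"
      by (subst sum.swap) (simp add: sum_distrib_right)
    also have "\<dots> = (\<Sum>q'\<in>J. (if q' = q then f q' a else 0))"
      unfolding bco_units[OF b basis_vec_in[OF b q], symmetric] bco_basis[OF b J q] by (intro sum.cong) auto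
    finally show ?thesis using q J by (simp add: sum.delta)
  qed
  then show "mv k M (e q) = f q" by blast
qed

lemma mv_eq_on_basis:
  assumes b: "is_basis_family k J e" and w: "vec_in k w" and eq: "\<And>q. q \<in> J \<Longrightarrow> mv k M (e q) = mv k' M' (f q)"
    and w': "w' = (\<lambda>a. \<Sum>q\<in>J. bco k J e w q * f q a)"
  shows "mv k M w = mv k' M' w'"
proof -
  have "mv k M w = mv k M (\<lambda>a. \<Sum>q\<in>J. bco k J e w q * e q a)"
    using bco_expand[OF b w] by simp
  then show ?thesis unfolding w' mv_sum using eq by simp
qed

lemma mv_unit: "b < k \<Longrightarrow> mv k M (unit_vec' b) = (\<lambda>a. M a b)"
  by (simp add: mv_def unit_vec'_def mult_delta_right)

lemma mat_eqI:
  assumes "mat_in m k M" "mat_in m k M'" "\<And>w. vec_in k w \<Longrightarrow> mv k M w = mv k M' w"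
  shows "M = M'"
proof (intro ext)
  fix a b
  show "M a b = M' a b"
  proof (cases "b < k")
    case True
    then show ?thesis using assms(3)[OF vec_in_unit[OF True]] by (simp add: mv_unit fun_eq_iff)
  next
    case False
    then show ?thesis using assms(1,2) by (simp add: mat_in_def)
  qed
qed

lemma exists_basis:
  assumes "finite J" "card J = k"
  shows "\<exists>e. is_basis_family k J e"
proof -
  obtain f where f: "bij_betw f J {..<k}"
    using ex_bij_betw_finite_nat[OF assms(1)] assms(2) atLeast0LessThan by auto
  have "is_basis_family k J (\<lambda>q. unit_vec' (f q))"
    unfolding is_basis_family_def
  proof (intro conjI ballI allI impI)
    show "vec_in k (unit_vec' (f q))" if "q \<in> J" for q
      using bij_betwE[OF f] that by (intro vec_in_unit) auto
    fix w :: "nat \<Rightarrow> complex" assume w: "vec_in k w"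
    show "\<exists>!c. (\<forall>p. p \<notin> J \<longrightarrow> c p = 0) \<and> w = (\<lambda>a. \<Sum>p\<in>J. c p * unit_vec' (f p) a)"
    proof (rule ex1I[of _ "\<lambda>p. if p \<in> J then w (f p) else 0"])
      have "(\<Sum>p\<in>J. (if p \<in> J then w (f p) else 0) * unit_vec' (f p) a) = (\<Sum>b<k. w b * unit_vec' b a)" for a
        using sum.reindex_bij_betw[OF f, of "\<lambda>b. w b * unit_vec' b a"] by simp
      then show "(\<forall>p. p \<notin> J \<longrightarrow> (if p \<in> J then w (f p) else 0) = 0) \<and> w = (\<lambda>a. \<Sum>p\<in>J. (if p \<in> J then w (f p) else 0) * unit_vec' (f p) a)"
        using vec_unit_expand[OF w] by simp
      fix c assume c: "(\<forall>p. p \<notin> J \<longrightarrow> c p = 0) \<and> w = (\<lambda>a. \<Sum>p\<in>J. c p * unit_vec' (f p) a)"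
      have "c p = w (f p)" if p: "p \<in> J" for p
      proof -
        have "w (f p) = (\<Sum>p'\<in>J. c p' * unit_vec' (f p') (f p))" using c by metis
        also have "\<dots> = (\<Sum>p'\<in>J. if p' = p then c p' else 0)"
          using f p by (intro sum.cong refl) (auto simp: unit_vec'_def bij_betw_def inj_on_def)
        finally show ?thesis using p assms by (simp add: sum.delta)
      qed
      then show "c = (\<lambda>p. if p \<in> J then w (f p) else 0)" using conjunct1[OF c] by (intro ext) metis
    qed
  qed
  then show ?thesis by blast
qed

section \<open>Adjugates of matrices with polynomial entries\<close>

lemma polyfun_det:
  assumes "\<And>i j. i < m \<Longrightarrow> j < m \<Longrightarrow> M i j \<in> polyfun C"
  shows "(\<lambda>p. Determinant.det (mat m m (\<lambda>(i, j). M i j p))) \<in> polyfun C"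
proof -
  have pl: "\<pi> i < m" if "\<pi> permutes {0..<m}" "i < m" for \<pi> i
    using permutes_in_image[OF that(1), of i] that(2) by simp
  have "Determinant.det (mat m m (\<lambda>(i, j). M i j p)) = (\<Sum>\<pi> \<in> {\<pi>. \<pi> permutes {0..<m}}. signof \<pi> * (\<Prod>i = 0..<m. M i (\<pi> i) p))" for p
    by (subst det_def'[of _ m]) (auto intro!: sum.cong prod.cong simp: pl)
  moreover have "(\<lambda>p. \<Sum>\<pi> \<in> {\<pi>. \<pi> permutes {0..<m}}. signof \<pi> * (\<Prod>i = 0..<m. M i (\<pi> i) p)) \<in> polyfun C"
  proof (intro polyfun_sum pf_mult pf_const polyfun_prod)
    fix \<pi> i assume "\<pi> \<in> {\<pi>. \<pi> permutes {0..<m}}" "i \<in> {0..<m}"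
    then show "M i (\<pi> i) \<in> polyfun C" by (intro assms) (auto simp: pl)
  qed
  ultimately show ?thesis by simp
qed

text \<open>\<open>N\<close> is the adjugate and \<open>\<delta>\<close> the determinant. Since
  \<open>M\<close> is the identity at \<open>p0\<close>, so is \<open>N\<close>; constructions that
  use \<open>N\<close> as an inverse therefore keep their prescribed values at
  \<open>p0\<close>.\<close>

lemma polyfun_adjugate:
  fixes M :: "nat \<Rightarrow> nat \<Rightarrow> 'p \<Rightarrow> complex" and m :: nat
  assumes M_all: "\<forall>i<m. \<forall>j<m. M i j \<in> polyfun C \<and> M i j p0 = (if i = j then 1 else 0)"
  shows "\<exists>\<delta> N. \<delta> \<in> polyfun C \<and> (\<forall>i<m. \<forall>j<m. N i j \<in> polyfun C \<and> N i j p0 = (if i = j then 1 else 0)) \<and> \<delta> p0 = 1 \<and>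
     (\<forall>p. \<forall>i<m. \<forall>j<m. (\<Sum>k<m. M i k p * N k j p) = (if i = j then \<delta> p else 0)) \<and>
     (\<forall>p. \<forall>i<m. \<forall>j<m. (\<Sum>k<m. N i k p * M k j p) = (if i = j then \<delta> p else 0))"
proof -
  have M: "M i j \<in> polyfun C" and p0: "M i j p0 = (if i = j then 1 else 0)" if "i < m" "j < m" for i j
    using M_all that by auto
  define A where "A p = mat m m (\<lambda>(i, j). M i j p)" for p
  define \<delta> where "\<delta> p = Determinant.det (A p)" for p
  define N where "N i j p = cofactor (A p) j i" for i j p
  have A: "A p \<in> carrier_mat m m" for p by (simp add: A_def)
  have \<delta>P: "\<delta> \<in> polyfun C" unfolding \<delta>_def A_def by (rule polyfun_det[OF M])
  have NP: "N i j \<in> polyfun C" if ij: "i < m" "j < m" for i j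
  proof -
    have "N i j = (\<lambda>p. (-1) ^ (j + i) * Determinant.det (mat (m - 1) (m - 1) (\<lambda>(i', j').
        M (if i' < j then i' else Suc i') (if j' < i then j' else Suc j') p)))"
      unfolding N_def cofactor_def mat_delete_def A_def
      by (intro ext arg_cong2[of _ _ _ _ "(*)"] refl arg_cong[of _ _ Determinant.det] cong_mat) (use ij in auto)
    also have "\<dots> \<in> polyfun C"
      by (intro pf_mult pf_const polyfun_det M) (use ij in auto)
    finally show ?thesis .
  qed
  have adj: "adj_mat (A p) $$ (i, j) = N i j p" if "i < m" "j < m" for i j p
    using that A[of p] by (simp add: adj_mat_def N_def)
  have 1: "(\<Sum>k<m. M i k p * N k j p) = (if i = j then \<delta> p else 0)" if ij: "i < m" "j < m" for i j p
  proof -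
    have "(A p * adj_mat (A p)) $$ (i, j) = (\<Sum>k<m. M i k p * N k j p)"
      using ij A[of p] adj_mat(1)[OF A[of p]]
      by (simp add: scalar_prod_def atLeast0LessThan adj) (simp add: A_def)
    then show ?thesis using adj_mat(2)[OF A[of p]] ij by (cases "i = j") (simp_all add: \<delta>_def)
  qed
  have 2: "(\<Sum>k<m. N i k p * M k j p) = (if i = j then \<delta> p else 0)" if ij: "i < m" "j < m" for i j p
  proof -
    have "(adj_mat (A p) * A p) $$ (i, j) = (\<Sum>k<m. N i k p * M k j p)"
      using ij A[of p] adj_mat(1)[OF A[of p]]
      by (simp add: scalar_prod_def atLeast0LessThan adj) (simp add: A_def)
    then show ?thesis using adj_mat(3)[OF A[of p]] ij by (cases "i = j") (simp_all add: \<delta>_def)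
  qed
  have "A p0 = 1\<^sub>m m" unfolding A_def one_mat_def by (rule cong_mat) (auto simp: p0)
  then have \<delta>0: "\<delta> p0 = 1" by (simp add: \<delta>_def)
  have N0: "N i j p0 = (if i = j then 1 else 0)" if ij: "i < m" "j < m" for i j
  proof -
    have "N i j p0 = (\<Sum>k<m. if k = j then N i k p0 else 0)" using ij by (simp add: sum.delta)
    also have "\<dots> = (\<Sum>k<m. N i k p0 * M k j p0)" using ij by (intro sum.cong) (auto simp: p0)
    finally show ?thesis using 2[OF ij, of p0] \<delta>0 by simp
  qed
  show ?thesis
    by (intro exI[of _ \<delta>] exI[of _ N] conjI allI impI) (simp_all add: \<delta>P NP \<delta>0 N0 1 2)
qed

text \<open>Written in the basis given at \<open>p0\<close>, the family at \<open>p\<close> has a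
  matrix \<open>M\<close> that is the identity at \<open>p0\<close>. Its adjugate provides the dual
  functionals multiplied by \<open>\<delta> p\<close>; the identities hold at every point, including
  those where \<open>\<delta>\<close> vanishes.\<close>

lemma polyfun_dual_basis:
  assumes b: "is_basis_family n J (\<lambda>q. E q p0)" and J: "finite J" "card J = n"
    and E_all: "\<forall>q\<in>J. \<forall>a<n. (\<lambda>p. E q p a) \<in> polyfun C"
  shows "\<exists>\<delta> N. \<delta> \<in> polyfun C \<and> \<delta> p0 = 1 \<and> (\<forall>q\<in>J. \<forall>a<n. N q a \<in> polyfun C) \<and>
     (\<forall>p. \<forall>a<n. \<forall>c<n. (\<Sum>q\<in>J. N q a p * E q p c) = (if a = c then \<delta> p else 0)) \<and>
     (\<forall>p. \<forall>q\<in>J. \<forall>q'\<in>J. (\<Sum>a<n. N q a p * E q' p a) = (if q = q' then \<delta> p else 0))"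
proof -
  let ?e = "\<lambda>q. E q p0"
  have E: "(\<lambda>p. E q p a) \<in> polyfun C" if "q \<in> J" "a < n" for q a using E_all that by blast
  \<comment> \<open>An enumeration of \<open>J\<close>, to pass to matrices indexed by
    numbers.\<close>
  obtain \<psi> where \<psi>: "bij_betw \<psi> {..<n} J"
    using ex_bij_betw_nat_finite[OF J(1)] J(2) atLeast0LessThan by auto
  define \<phi> where "\<phi> = the_inv_into {..<n} \<psi>"
  have \<phi>\<psi>: "\<phi> (\<psi> i) = i" if "i < n" for i
    using \<psi> that by (simp add: \<phi>_def bij_betw_def the_inv_into_f_f)
  have \<psi>J: "\<psi> i \<in> J" if "i < n" for i using bij_betwE[OF \<psi>] that by auto
  have \<phi>n: "\<phi> q < n" and \<psi>\<phi>: "\<psi> (\<phi> q) = q" if "q \<in> J" for q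
    using \<psi> that the_inv_into_into[of \<psi> "{..<n}" q "{..<n}"] f_the_inv_into_f[of \<psi> "{..<n}" q]
    by (auto simp: \<phi>_def bij_betw_def)
  define L where "L q a = bco n J ?e (unit_vec' a) q" for q a
  have Le: "(\<Sum>a<n. L q a * ?e q' a) = (if q = q' then 1 else 0)" if "q' \<in> J" for q q'
    using bco_units[OF b basis_vec_in[OF b that], of q] bco_basis[OF b J(1) that] by (simp add: L_def mult.commute)
  have eL: "(\<Sum>q\<in>J. L q a * ?e q c) = (if a = c then 1 else 0)" if "a < n" for a c
    using fun_cong[OF bco_expand[OF b vec_in_unit[OF that]], of c] by (simp add: L_def unit_vec'_def eq_commute)
  have exp: "E q p c = (\<Sum>q'\<in>J. (\<Sum>a<n. L q' a * E q p a) * ?e q' c)" if "c < n" for q p c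
  proof -
    have "(\<Sum>q'\<in>J. (\<Sum>a<n. L q' a * E q p a) * ?e q' c) = (\<Sum>a<n. E q p a * (\<Sum>q'\<in>J. L q' a * ?e q' c))"
      unfolding sum_distrib_left sum_distrib_right by (subst sum.swap) (simp add: mult_ac)
    also have "\<dots> = (\<Sum>a<n. if a = c then E q p a else 0)"
      by (intro sum.cong refl) (simp add: eL)
    finally show ?thesis using that by (simp add: sum.delta)
  qed
  define M where "M i j p = (\<Sum>a<n. L (\<psi> i) a * E (\<psi> j) p a)" for i j p
  have MP: "M i j \<in> polyfun C" if "i < n" "j < n" for i j
    unfolding M_def[abs_def]
    by (rule polyfun_sum, rule pf_mult, rule pf_const, rule E, rule \<psi>J[OF that(2)]) simp
  have M0: "M i j p0 = (if i = j then 1 else 0)" if "i < n" "j < n" for i j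
  proof -
    have "\<psi> i = \<psi> j \<longleftrightarrow> i = j" using \<phi>\<psi>[OF that(1)] \<phi>\<psi>[OF that(2)] by metis
    then show ?thesis unfolding M_def Le[OF \<psi>J[OF that(2)]] by simp
  qed
  have "\<forall>i<n. \<forall>j<n. M i j \<in> polyfun C \<and> M i j p0 = (if i = j then 1 else 0)" using MP M0 by simp
  from polyfun_adjugate[OF this] obtain \<delta> R where
    \<delta>: "\<delta> \<in> polyfun C" "\<delta> p0 = 1" and RP: "\<forall>i<n. \<forall>j<n. R i j \<in> polyfun C \<and> R i j p0 = (if i = j then 1 else 0)"
    and MR: "\<forall>p. \<forall>i<n. \<forall>j<n. (\<Sum>k<n. M i k p * R k j p) = (if i = j then \<delta> p else 0)"
    and RM: "\<forall>p. \<forall>i<n. \<forall>j<n. (\<Sum>k<n. R i k p * M k j p) = (if i = j then \<delta> p else 0)"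
    by (elim exE conjE)
  define N where "N q a p = (\<Sum>j<n. R (\<phi> q) j p * L (\<psi> j) a)" for q a p
  have NP: "N q a \<in> polyfun C" if "q \<in> J" for q a
    unfolding N_def[abs_def]
    by (rule polyfun_sum, rule pf_mult, use RP \<phi>n[OF that] in simp, rule pf_const)
  have 2: "(\<Sum>a<n. N q a p * E q' p a) = (if q = q' then \<delta> p else 0)" if q: "q \<in> J" "q' \<in> J" for q q' p
  proof -
    have "(\<Sum>a<n. N q a p * E q' p a) = (\<Sum>j<n. R (\<phi> q) j p * M j (\<phi> q') p)"
      unfolding N_def M_def \<psi>\<phi>[OF q(2)] sum_distrib_left sum_distrib_right
      by (subst sum.swap) (simp add: mult_ac)
    also have "\<dots> = (if \<phi> q = \<phi> q' then \<delta> p else 0)" using RM \<phi>n[OF q(1)] \<phi>n[OF q(2)] by simp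
    finally show ?thesis using \<psi>\<phi>[OF q(1)] \<psi>\<phi>[OF q(2)] by auto
  qed
  have 1: "(\<Sum>q\<in>J. N q a p * E q p c) = (if a = c then \<delta> p else 0)" if ac: "a < n" "c < n" for a c p
  proof -
    have re: "(\<Sum>q\<in>J. f q) = (\<Sum>i<n. f (\<psi> i))" for f :: "nat \<times> nat \<Rightarrow> complex"
      using sum.reindex_bij_betw[OF \<psi>, of f] by simp
    have E': "E (\<psi> k) p c = (\<Sum>i<n. ?e (\<psi> i) c * M i k p)" for k
      unfolding exp[OF ac(2), of "\<psi> k"] re M_def by (simp add: mult.commute)
    have "(\<Sum>q\<in>J. N q a p * E q p c) = (\<Sum>k<n. (\<Sum>i<n. ?e (\<psi> i) c * M i k p) * (\<Sum>j<n. R k j p * L (\<psi> j) a))"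
      unfolding re by (intro sum.cong refl) (simp add: N_def \<phi>\<psi> E' mult.commute)
    also have "\<dots> = (\<Sum>i<n. \<Sum>j<n. ?e (\<psi> i) c * (\<Sum>k<n. M i k p * R k j p) * L (\<psi> j) a)"
      by (rule sum_sandwich)
    also have "\<dots> = (\<Sum>i<n. \<Sum>j<n. if i = j then \<delta> p * (L (\<psi> j) a * ?e (\<psi> j) c) else 0)"
      using MR by (intro sum.cong refl) auto
    also have "\<dots> = \<delta> p * (\<Sum>i<n. L (\<psi> i) a * ?e (\<psi> i) c)"
      by (simp add: sum.delta' sum_distrib_left)
    also have "\<dots> = \<delta> p * (\<Sum>q\<in>J. L q a * ?e q c)" unfolding re ..
    finally show ?thesis using eL[OF ac(1)] by simp
  qed
  show ?thesis
    by (intro exI[of _ \<delta>] exI[of _ N] conjI allI impI ballI) (simp_all add: \<delta> NP 1 2)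
qed

text \<open>For \<open>d \<noteq> 0\<close> the functionals \<open>N q\<close> divided by
  \<open>d\<close> give coefficients of an expansion. Pairing any expansion with \<open>N q\<close>
  isolates its coefficient at \<open>q\<close>, which yields uniqueness.\<close>

lemma basis_of_dual:
  assumes J: "finite J" and E: "\<And>q. q \<in> J \<Longrightarrow> vec_in n (E q)" and d: "d \<noteq> 0"
    and 1: "\<And>a c. a < n \<Longrightarrow> c < n \<Longrightarrow> (\<Sum>q\<in>J. N q a * E q c) = (if a = c then d else 0)"
    and 2: "\<And>q q'. q \<in> J \<Longrightarrow> q' \<in> J \<Longrightarrow> (\<Sum>a<n. N q a * E q' a) = (if q = q' then d else 0)"
  shows "is_basis_family n J E"
    and "vec_in n w \<Longrightarrow> q \<in> J \<Longrightarrow> d * bco n J E w q = (\<Sum>a<n. N q a * w a)"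
proof -
  have key: "d * c q = (\<Sum>a<n. N q a * w a)" if "w = (\<lambda>a. \<Sum>q\<in>J. c q * E q a)" "q \<in> J" for c w q
  proof -
    have "(\<Sum>a<n. N q a * w a) = (\<Sum>q'\<in>J. c q' * (\<Sum>a<n. N q a * E q' a))"
      unfolding that(1) sum_distrib_left by (subst sum.swap) (simp add: mult_ac)
    also have "\<dots> = (\<Sum>q'\<in>J. if q' = q then d * c q' else 0)"
      using that(2) by (intro sum.cong refl) (auto simp: 2)
    finally show ?thesis using that(2) J by (simp add: sum.delta)
  qed
  show b: "is_basis_family n J E"
    unfolding is_basis_family_def
  proof (intro conjI ballI allI impI E)
    fix w :: "nat \<Rightarrow> complex" assume w: "vec_in n w"
    define c where "c q = (if q \<in> J then (\<Sum>a<n. N q a * w a) / d else 0)" for q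
    have "w a' = (\<Sum>q\<in>J. c q * E q a')" for a'
    proof (cases "a' < n")
      case True
      have "(\<Sum>q\<in>J. c q * E q a') = (\<Sum>q\<in>J. \<Sum>a<n. w a * (N q a * E q a') / d)"
        by (intro sum.cong refl) (simp add: c_def sum_distrib_left sum_distrib_right sum_divide_distrib mult_ac)
      also have "\<dots> = (\<Sum>a<n. w a * (\<Sum>q\<in>J. N q a * E q a') / d)"
        by (subst sum.swap) (simp add: sum_distrib_left sum_divide_distrib)
      also have "\<dots> = (\<Sum>a<n. if a = a' then w a else 0)"
        using True d by (intro sum.cong refl) (simp add: 1)
      finally show ?thesis using True by (simp add: sum.delta)
    next
      case False
      then show ?thesis using w E by (simp add: vec_in_def)
    qed
    then have "w = (\<lambda>a. \<Sum>q\<in>J. c q * E q a)" by (rule ext)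
    moreover have "\<forall>p. p \<notin> J \<longrightarrow> c p = 0" by (simp add: c_def)
    ultimately have cw: "(\<forall>p. p \<notin> J \<longrightarrow> c p = 0) \<and> w = (\<lambda>a. \<Sum>q\<in>J. c q * E q a)" by (intro conjI)
    show "\<exists>!c. (\<forall>p. p \<notin> J \<longrightarrow> c p = 0) \<and> w = (\<lambda>a. \<Sum>q\<in>J. c q * E q a)"
    proof (rule ex1I, rule cw)
      fix c' assume c': "(\<forall>p. p \<notin> J \<longrightarrow> c' p = 0) \<and> w = (\<lambda>a. \<Sum>q\<in>J. c' q * E q a)"
      show "c' = c"
      proof
        fix q
        show "c' q = c q"
        proof (cases "q \<in> J")
          case True
          then show ?thesis using key[OF conjunct2[OF c'] True] key[OF conjunct2[OF cw] True] d by (metis mult_cancel_left)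
        next
          case False
          then show ?thesis using conjunct1[OF c'] conjunct1[OF cw] by metis
        qed
      qed
    qed
  qed
  show "d * bco n J E w q = (\<Sum>a<n. N q a * w a)" if "vec_in n w" "q \<in> J"
    by (rule key[OF bco_expand[OF b that(1)] that(2)])
qed

lemma basis_scale:
  assumes b: "is_basis_family n J e" and s: "s \<noteq> 0"
  shows "is_basis_family n J (\<lambda>q a. s * e q a)"
  unfolding is_basis_family_def
proof (intro conjI ballI allI impI)
  show "vec_in n (\<lambda>a. s * e q a)" if "q \<in> J" for q
    using basis_vec_in[OF b that] by (simp add: vec_in_def)
  fix w :: "nat \<Rightarrow> complex" assume w: "vec_in n w"
  show "\<exists>!c. (\<forall>p. p \<notin> J \<longrightarrow> c p = 0) \<and> w = (\<lambda>a. \<Sum>q\<in>J. c q * (s * e q a))"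
  proof (rule ex1I[of _ "\<lambda>q. bco n J e w q / s"])
    have "w = (\<lambda>a. \<Sum>q\<in>J. bco n J e w q / s * (s * e q a))"
      using bco_expand[OF b w] s by simp
    then show "(\<forall>p. p \<notin> J \<longrightarrow> bco n J e w p / s = 0) \<and> w = (\<lambda>a. \<Sum>q\<in>J. bco n J e w q / s * (s * e q a))"
      using bco_outside[OF b w] by simp
    fix c assume c: "(\<forall>p. p \<notin> J \<longrightarrow> c p = 0) \<and> w = (\<lambda>a. \<Sum>q\<in>J. c q * (s * e q a))"
    have "bco n J e w = (\<lambda>q. c q * s)"
    proof (rule bco_unique[OF b w])
      show "c q * s = 0" if "q \<notin> J" for q using conjunct1[OF c] that by (metis mult_zero_left)
      show "w = (\<lambda>a. \<Sum>q\<in>J. c q * s * e q a)" using conjunct2[OF c] by (simp only: mult.assoc)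
    qed
    then show "c = (\<lambda>q. bco n J e w q / s)" using s by auto
  qed
qed

section \<open>Combinatorics of the bipartition\<close>

lemma partition_antimono:
  assumes "is_partition p" "1 \<le> i" "i \<le> j"
  shows "p j \<le> p i"
  using assms(3)
proof (induction j rule: dec_induct)
  case (step j)
  then have "p (Suc j) \<le> p j" using assms(1,2) unfolding is_partition_def by (metis le_trans)
  then show ?case using step by simp
qed simp

text \<open>The rows of length at least \<open>s\<close> form an initial segment, since
  \<open>p\<close> is weakly decreasing. So \<open>k\<close> is at most their number exactly when
  row \<open>k\<close> is one of them.\<close>

lemma ptrans_galois:
  assumes p: "is_partition p" and s: "1 \<le> s" and k: "1 \<le> k"
  shows "k \<le> ptrans p s \<longleftrightarrow> s \<le> p k"
proof -
  define S where "S = {i. 1 \<le> i \<and> s \<le> p i}"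
  have fin: "finite S"
    using p s unfolding is_partition_def S_def by (elim conjE) (erule rev_finite_subset, auto)
  have down: "i \<in> S" if "j \<in> S" "1 \<le> i" "i \<le> j" for i j
    using that partition_antimono[OF p that(2,3)] by (auto simp: S_def)
  have eq: "ptrans p s = card S" using s by (simp add: ptrans_def S_def)
  show ?thesis
  proof
    assume "s \<le> p k"
    then have "{1..k} \<subseteq> S" using down[of k] k by (auto simp: S_def)
    then show "k \<le> ptrans p s" using card_mono[OF fin, of "{1..k}"] by (simp add: eq)
  next
    assume le: "k \<le> ptrans p s"
    show "s \<le> p k"
    proof (rule ccontr)
      assume "\<not> s \<le> p k"
      then have "k \<notin> S" by (simp add: S_def)
      have "S \<subseteq> {1..k - 1}"
      proof
        fix i assume i: "i \<in> S"
        then have "\<not> k \<le> i" using down[OF i k] \<open>k \<notin> S\<close> by blast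
        then show "i \<in> {1..k - 1}" using i by (auto simp: S_def)
      qed
      then have "card S \<le> k - 1" using card_mono[of "{1..k - 1}" S] by simp
      then show False using le k by (simp add: eq)
    qed
  qed
qed

locale bipartition =
  fixes \<mu> \<nu> :: "nat \<Rightarrow> nat" and n :: nat and I :: "nat set"
  assumes part: "is_partition \<mu>" "is_partition \<nu>" and size: "psize \<mu> + psize \<nu> = n"
    and pos: "n \<ge> 1" and I: "is_bip_I \<mu> \<nu> I"
begin

abbreviation "t \<equiv> bip_t \<mu> \<nu>"
abbreviation "r \<equiv> bip_r \<mu> \<nu>"
abbreviation "X \<equiv> enh_quiver_variety t r I"
abbreviation "P \<equiv> polyfun (quiver_coords t r)"

definition lam :: "nat \<Rightarrow> nat" where "lam k = \<mu> k + \<nu> k"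

text \<open>\<open>J i\<close> indexes the basis of \<open>U\<^sub>i\<close> that consists of the vectors of a Jordan basis of type \<open>lam\<close>
  lying in the image of the \<open>(t - i)\<close>-th power.\<close>

definition J :: "nat \<Rightarrow> (nat \<times> nat) set" where
  "J i = {(k, j). 1 \<le> k \<and> 1 \<le> j \<and> j + (t - i) \<le> lam k}"

lemma lam_partition: "is_partition lam"
proof -
  have "{i. lam i \<noteq> 0} = {i. \<mu> i \<noteq> 0} \<union> {i. \<nu> i \<noteq> 0}" by (auto simp: lam_def)
  then show ?thesis using part by (auto simp: is_partition_def lam_def intro!: add_mono)
qed

lemma lam_le: "1 \<le> k \<Longrightarrow> lam k \<le> t"
  using partition_antimono[OF lam_partition, of 1 k] by (simp add: lam_def bip_t_def)

lemma mu_le: "1 \<le> k \<Longrightarrow> \<mu> k \<le> \<mu> 1"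
  using partition_antimono[OF part(1), of 1 k] by simp

lemma r_alt: "r i = ptrans lam (t - i)"
  by (simp add: bip_r_def lam_def[abs_def])

lemma J_t: "J t = bip_index \<mu> \<nu>"
  by (simp add: J_def bip_index_def lam_def)

lemma J_0: "J 0 = {}"
  using lam_le by (force simp: J_def)

lemma J_mono: "i \<le> i' \<Longrightarrow> J i \<subseteq> J i'"
  by (auto simp: J_def)

lemma finite_J: "finite (J i)"
proof (rule finite_subset)
  show "J i \<subseteq> {k. lam k \<noteq> 0} \<times> {..t}" using lam_le by (force simp: J_def)
  show "finite ({k. lam k \<noteq> 0} \<times> {..t})" using lam_partition by (simp add: is_partition_def)
qed

text \<open>Passing from \<open>J i\<close> to \<open>J (Suc i)\<close> adds one index to each row
  of length at least t - i, namely the last admissible one \<open>f k\<close>. The number of these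
  rows is the column length \<open>r i\<close>.\<close>

lemma card_J: "i \<le> t \<Longrightarrow> card (J i) = qdim r i"
proof (induction i)
  case 0
  then show ?case by (simp add: J_0 qdim_def)
next
  case (Suc i)
  define S where "S = {k. 1 \<le> k \<and> t - i \<le> lam k}"
  define f where "f k = (k, lam k - (t - Suc i))" for k
  have new: "J (Suc i) = J i \<union> f ` S"
  proof (rule subset_antisym; rule subsetI)
    fix q assume q: "q \<in> J (Suc i)"
    obtain k j where kj: "q = (k, j)" by (cases q)
    show "q \<in> J i \<union> f ` S"
    proof (cases "j + (t - i) \<le> lam k")
      case True
      then show ?thesis using q kj by (simp add: J_def)
    next
      case False
      then have "q = f k" "k \<in> S" using q kj Suc.prems by (auto simp: J_def f_def S_def)
      then show ?thesis by blast
    qed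
  next
    fix q assume "q \<in> J i \<union> f ` S"
    then show "q \<in> J (Suc i)" using Suc.prems by (auto simp: J_def f_def S_def)
  qed
  have disj: "J i \<inter> f ` S = {}" using Suc.prems by (auto simp: J_def f_def S_def)
  have finS: "finite S"
    using lam_partition Suc.prems unfolding is_partition_def S_def by (elim conjE) (erule rev_finite_subset, auto)
  have "card (f ` S) = r i"
    using Suc.prems by (subst card_image) (auto simp: inj_on_def f_def r_alt ptrans_def S_def)
  then have "card (J (Suc i)) = qdim r i + r i"
    unfolding new using disj finS finite_J Suc by (subst card_Un_disjoint) auto
  then show ?case by (simp add: qdim_def)
qed

lemma qdim_t: "qdim r t = n"
proof -
  define K where "K = {k. lam k \<noteq> 0}"
  have K: "finite K" "0 \<notin> K" using lam_partition by (auto simp: is_partition_def K_def)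
  have "1 \<le> k \<and> 1 \<le> j \<and> j \<le> lam k \<longleftrightarrow> k \<in> K \<and> 1 \<le> j \<and> j \<le> lam k" for k j
    using K(2) by (cases "k = 0") (auto simp: K_def)
  then have "J t = (SIGMA k:K. {1..lam k})" by (auto simp: J_def)
  then have "card (J t) = (\<Sum>k\<in>K. lam k)" using K by simp
  also have "\<dots> = (\<Sum>k\<in>K. \<mu> k) + (\<Sum>k\<in>K. \<nu> k)" by (simp add: lam_def sum.distrib)
  also have "(\<Sum>k\<in>K. \<mu> k) = psize \<mu>"
    unfolding psize_def by (rule sum.mono_neutral_right) (use K in \<open>auto simp: K_def lam_def\<close>)
  also have "(\<Sum>k\<in>K. \<nu> k) = psize \<nu>"
    unfolding psize_def by (rule sum.mono_neutral_right) (use K in \<open>auto simp: K_def lam_def\<close>)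
  finally show ?thesis using card_J[of t] size by simp
qed

lemma t_pos: "1 \<le> t"
proof (rule ccontr)
  assume "\<not> 1 \<le> t"
  then have "t = 0" by simp
  then have "qdim r t = 0" by (simp add: qdim_def)
  then show False using qdim_t pos by simp
qed

lemma I_sub: "I \<subseteq> {0..<t}"
  using I by (simp add: is_bip_I_def)

lemma finite_I: "finite I"
  using I_sub finite_subset by blast

text \<open>In the equality of lists of column lengths in \<open>is_bip_I\<close>, the entries that
  are at least \<open>k\<close> are counted on both sides. For \<mu> there are
  \<open>\<mu> k\<close> of them; a column of \<open>lam\<close> is that long exactly when its index
  is among the last \<open>lam k\<close>. This link between \<open>I\<close> and the Jordan type
  serves both to lift the orbit and to bound the vector v near a lifted point.\<close>

lemma card_I_tail:
  assumes k: "1 \<le> k"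
  shows "card (I \<inter> {t - lam k..<t}) = \<mu> k"
proof -
  have ri: "k \<le> r l \<longleftrightarrow> t - lam k \<le> l" if "l < t" for l
    using ptrans_galois[OF lam_partition _ k, of "t - l"] that lam_le[OF k] by (auto simp: r_alt)
  have eq: "map r (sorted_list_of_set I) = map (\<lambda>k. ptrans \<mu> (\<mu> 1 - k)) [0..<\<mu> 1]"
    using I by (simp add: is_bip_I_def)
  have "length (filter (\<lambda>x. k \<le> x) (map r (sorted_list_of_set I))) = card {l \<in> I. k \<le> r l}"
    using finite_I by (simp add: filter_map o_def distinct_length_filter Int_def conj_commute)
  moreover have "{l \<in> I. k \<le> r l} = I \<inter> {t - lam k..<t}" using I_sub ri by auto
  moreover have "length (filter (\<lambda>x. k \<le> x) (map (\<lambda>k. ptrans \<mu> (\<mu> 1 - k)) [0..<\<mu> 1]))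
      = card {j. j < \<mu> 1 \<and> k \<le> ptrans \<mu> (\<mu> 1 - j)}"
    by (simp add: filter_map o_def distinct_length_filter Int_def conj_commute)
  moreover have "{j. j < \<mu> 1 \<and> k \<le> ptrans \<mu> (\<mu> 1 - j)} = {\<mu> 1 - \<mu> k..<\<mu> 1}"
    using ptrans_galois[OF part(1) _ k] mu_le[OF k] by fastforce
  ultimately show ?thesis using eq mu_le[OF k] by simp
qed

text \<open>On the way from vertex t down to vertex i, the vector u moves one place down each Jordan
  chain at every step in \<open>I\<close> and keeps its place at the other steps.
  \<open>tailI i\<close> is the total displacement.\<close>

definition tailI :: "nat \<Rightarrow> nat" where
  "tailI i = card (I \<inter> {i..<t})"

lemma tailI_t: "tailI t = 0"
  by (simp add: tailI_def)

lemma tailI_in: "i \<in> I \<Longrightarrow> tailI i = Suc (tailI (Suc i))"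
proof -
  assume i: "i \<in> I"
  then have "I \<inter> {i..<t} = insert i (I \<inter> {Suc i..<t})" using I_sub by auto
  then show ?thesis by (simp add: tailI_def)
qed

lemma tailI_notin: "i \<notin> I \<Longrightarrow> tailI i = tailI (Suc i)"
proof -
  assume i: "i \<notin> I"
  then have "I \<inter> {i..<t} = I \<inter> {Suc i..<t}" by (auto simp: Suc_le_eq order_less_le)
  then show ?thesis by (simp add: tailI_def)
qed

text \<open>By \<open>card_I_tail\<close>, the number \<open>\<mu> k - tailI i\<close> counts the
  elements of \<open>I\<close> from t - lam k up to i - 1. So it is at most i - (t - lam k), which
  is the length of row \<open>k\<close> in \<open>J i\<close>.\<close>

lemma tailI_J:
  assumes k: "1 \<le> k" and i: "i \<le> t" and gt: "tailI i < \<mu> k"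
  shows "(k, \<mu> k - tailI i) \<in> J i"
proof -
  let ?s = "t - lam k"
  have s: "?s < i"
  proof (rule ccontr)
    assume "\<not> ?s < i"
    then have "card (I \<inter> {?s..<t}) \<le> card (I \<inter> {i..<t})" by (intro card_mono) auto
    then show False using card_I_tail[OF k] gt by (simp add: tailI_def)
  qed
  have "I \<inter> {?s..<t} = (I \<inter> {?s..<i}) \<union> (I \<inter> {i..<t})" using s i by auto
  then have "card (I \<inter> {?s..<t}) = card (I \<inter> {?s..<i}) + tailI i"
    unfolding tailI_def by (simp only:) (intro card_Un_disjoint; auto)
  moreover have "card (I \<inter> {?s..<i}) \<le> i - ?s" using card_mono[of "{?s..<i}" "I \<inter> {?s..<i}"] by simp
  ultimately have "\<mu> k - tailI i \<le> i - ?s" using card_I_tail[OF k] by simp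
  then have "\<mu> k - tailI i + (t - i) \<le> lam k" using s i lam_le[OF k] by simp
  then show ?thesis using k gt by (simp add: J_def)
qed

section \<open>Lifting the orbit to the quiver variety\<close>

definition Aop :: "quiver_pt \<Rightarrow> nat \<Rightarrow> (nat \<Rightarrow> complex) \<Rightarrow> nat \<Rightarrow> complex" where
  "Aop p i = mv (qdim r i) (fst (snd p) i)"

definition Bop :: "quiver_pt \<Rightarrow> nat \<Rightarrow> (nat \<Rightarrow> complex) \<Rightarrow> nat \<Rightarrow> complex" where
  "Bop p i = mv (qdim r (Suc i)) (snd (snd p) i)"

text \<open>The endomorphism A_(i-1) B_(i-1) of U_i, which is x for i = t. For \<open>i = 0\<close>
  it is the zero map, because the sum over U_0 in \<open>Aop\<close> is empty.\<close>

definition Top :: "quiver_pt \<Rightarrow> nat \<Rightarrow> (nat \<Rightarrow> complex) \<Rightarrow> nat \<Rightarrow> complex" where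
  "Top p i w = Aop p (i - 1) (Bop p (i - 1) w)"

lemma matA: "p \<in> X \<Longrightarrow> mat_in (qdim r (Suc i)) (qdim r i) (fst (snd p) i)"
  and matB: "p \<in> X \<Longrightarrow> mat_in (qdim r i) (qdim r (Suc i)) (snd (snd p) i)"
  and vecu: "p \<in> X \<Longrightarrow> vec_in (qdim r i) (fst p i)"
  unfolding mat_in_def vec_in_def
  by (intro allI impI enh_quiverD[of p t r I]; auto)+

lemma vec_Aop: "p \<in> X \<Longrightarrow> vec_in (qdim r (Suc i)) (Aop p i w)"
  unfolding Aop_def by (rule mv_vec_in[OF matA])

lemma vec_Bop: "p \<in> X \<Longrightarrow> vec_in (qdim r i) (Bop p i w)"
  unfolding Bop_def by (rule mv_vec_in[OF matB])

lemma mv_compose: "mv k M (mv l M' w) = (\<lambda>a. \<Sum>b<l. (\<Sum>c<k. M a c * M' c b) * w b)"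
proof
  fix a
  have "mv k M (mv l M' w) a = (\<Sum>c<k. \<Sum>b<l. M a c * M' c b * w b)"
    by (simp add: mv_def sum_distrib_left mult_ac)
  then show "mv k M (mv l M' w) a = (\<Sum>b<l. (\<Sum>c<k. M a c * M' c b) * w b)"
    by (subst (asm) sum.swap) (simp add: sum_distrib_right)
qed

lemma BA_eq:
  assumes p: "p \<in> X" and i: "1 \<le> i" "i < t"
  shows "Bop p i (Aop p i w) = Top p i w"
proof
  fix a
  obtain i' where i': "i = Suc i'" using i(1) by (cases i) auto
  show "Bop p i (Aop p i w) a = Top p i w a"
  proof (cases "a < qdim r i")
    case True
    then show ?thesis using enh_quiverD(4)[OF p i(1), of a] i
      by (simp add: Top_def Aop_def Bop_def mv_compose i')
  next
    case False
    then show ?thesis using vec_Bop[OF p, of i] vec_Aop[OF p, of i'] by (simp add: vec_in_def Top_def i')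
  qed
qed

text \<open>A_i intertwines the two endomorphisms because A_i (B_i A_i) = A_i (A_(i-1) B_(i-1)); for
  \<open>i = 0\<close> both sides are 0.\<close>

lemma Top_Aop:
  assumes p: "p \<in> X" and i: "i < t"
  shows "Top p (Suc i) (Aop p i w) = Aop p i (Top p i w)"
proof (cases i)
  case 0
  then show ?thesis by (simp add: Top_def Aop_def mv_def qdim_def)
next
  case (Suc i')
  then show ?thesis using BA_eq[OF p _ i, of w] by (simp add: Top_def)
qed

lemma Top_pow_Aop:
  assumes "p \<in> X" "i < t"
  shows "(Top p (Suc i) ^^ m) (Aop p i w) = Aop p i ((Top p i ^^ m) w)"
  by (induction m) (auto simp: Top_Aop[OF assms])

lemma Bop_u: "p \<in> X \<Longrightarrow> i \<in> I \<Longrightarrow> Bop p i (fst p (Suc i)) = fst p i"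
proof
  fix a assume p: "p \<in> X" and i: "i \<in> I"
  show "Bop p i (fst p (Suc i)) a = fst p i a"
    using enh_quiverD(5)[OF p i, of a] vec_Bop[OF p, of i "fst p (Suc i)"] vecu[OF p, of i]
    by (cases "a < qdim r i") (auto simp: Bop_def mv_def vec_in_def)
qed

lemma Aop_u: "p \<in> X \<Longrightarrow> i < t \<Longrightarrow> i \<notin> I \<Longrightarrow> Aop p i (fst p i) = fst p (Suc i)"
proof
  fix a assume p: "p \<in> X" and i: "i < t" "i \<notin> I"
  show "Aop p i (fst p i) a = fst p (Suc i) a"
    using enh_quiverD(6)[OF p i, of a] vec_Aop[OF p, of i "fst p i"] vecu[OF p, of "Suc i"]
    by (cases "a < qdim r (Suc i)") (auto simp: Aop_def mv_def vec_in_def)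
qed

lemma mv_xmat: "mv n (xmat t r p) = Top p t"
proof
  fix w
  obtain t' where t': "t = Suc t'" using t_pos by (cases t) auto
  have "mv n (xmat t r p) w = (\<lambda>a. \<Sum>b<n. (\<Sum>c<qdim r t'. fst (snd p) t' a c * snd (snd p) t' c b) * w b)"
    by (simp add: mv_def xmat_def t')
  then show "mv n (xmat t r p) w = Top p t w"
    using qdim_t unfolding Top_def Aop_def Bop_def mv_compose by (simp add: t')
qed

lemma mat_xmat: "p \<in> X \<Longrightarrow> mat_in n n (xmat t r p)"
proof -
  assume p: "p \<in> X"
  obtain t' where t': "t = Suc t'" using t_pos by (cases t) auto
  show ?thesis using matA[OF p, of t'] matB[OF p, of t'] qdim_t unfolding mat_in_def xmat_def by (auto simp: t')
qed

text \<open>Jordan bases of all U_i at once. In them A_i is the inclusion of the image of x^(t-i)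
  into that of x^(t-i-1), B_i is the restriction of x and moves down each chain, and u_t has the
  normal form that defines the orbit.\<close>

definition adapted :: "quiver_pt \<Rightarrow> (nat \<Rightarrow> nat \<times> nat \<Rightarrow> nat \<Rightarrow> complex) \<Rightarrow> bool" where
  "adapted p \<epsilon> \<longleftrightarrow> p \<in> X \<and> (\<forall>i\<le>t. is_basis_family (qdim r i) (J i) (\<epsilon> i)) \<and>
     (\<forall>i<t. \<forall>q\<in>J i. Aop p i (\<epsilon> i q) = \<epsilon> (Suc i) q) \<and>
     (\<forall>i<t. \<forall>(k, j)\<in>J (Suc i). Bop p i (\<epsilon> (Suc i) (k, j)) = (if j = 1 then (\<lambda>_. 0) else \<epsilon> i (k, j - 1))) \<and>
     fst p t = (\<lambda>a. \<Sum>k\<in>{k. 1 \<le> k \<and> 0 < \<mu> k}. \<epsilon> t (k, \<mu> k) a)"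

lemma J_pred: "(k, j) \<in> J (Suc i) \<Longrightarrow> j \<noteq> 1 \<Longrightarrow> (k, j - 1) \<in> J i"
  by (auto simp: J_def)

lemma finite_mu: "finite {k. 1 \<le> k \<and> m < \<mu> k}"
proof (rule finite_subset)
  show "finite {k. \<mu> k \<noteq> 0}" using part(1) by (simp add: is_partition_def)
qed auto

lemma mat_eq_on_basis:
  assumes "is_basis_family k K e" "mat_in m k M" "mat_in m k M'" "\<And>q. q \<in> K \<Longrightarrow> mv k M (e q) = mv k M' (e q)"
  shows "M = M'"
proof (rule mat_eqI[OF assms(2,3)])
  fix w assume w: "vec_in k w"
  show "mv k M w = mv k M' w"
    by (rule mv_eq_on_basis[OF assms(1) w assms(4)]) (use bco_expand[OF assms(1) w] in auto)
qed

text \<open>The given Jordan basis is used at vertex t and arbitrary bases of the right size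
  elsewhere; A and B are prescribed on them. The vector u_i arises from v by moving each summand
  down its chain by \<open>tailI i\<close> places and dropping those that leave the chain.\<close>

lemma orbit_lift:
  assumes "(v, x) \<in> enh_orbit n \<mu> \<nu>"
  shows "\<exists>p \<epsilon>. adapted p \<epsilon> \<and> qproj t r p = (v, x)"
proof -
  obtain e where nx: "nilpotent_mat n x" and e: "is_basis_family n (bip_index \<mu> \<nu>) e"
    and xe: "\<And>k j. (k, j) \<in> bip_index \<mu> \<nu> \<Longrightarrow> mv n x (e (k, j)) = (if j = 1 then (\<lambda>_. 0) else e (k, j - 1))"
    and v: "v = (\<lambda>a. \<Sum>i \<in> {i. 1 \<le> i \<and> 0 < \<mu> i}. e (i, \<mu> i) a)"
    using assms unfolding enh_orbit_def by auto
  have "\<exists>\<epsilon>0. \<forall>i<t. is_basis_family (qdim r i) (J i) (\<epsilon>0 i)"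
    using exists_basis[OF finite_J card_J] by (metis less_imp_le)
  then obtain \<epsilon>0 where \<epsilon>0: "\<And>i. i < t \<Longrightarrow> is_basis_family (qdim r i) (J i) (\<epsilon>0 i)" by blast
  define \<epsilon> where "\<epsilon> i = (if i = t then e else \<epsilon>0 i)" for i
  have \<epsilon>: "is_basis_family (qdim r i) (J i) (\<epsilon> i)" if "i \<le> t" for i
    using \<epsilon>0[of i] e that by (cases "i = t") (auto simp: \<epsilon>_def J_t qdim_t)
  note \<epsilon>v = basis_vec_in[OF \<epsilon>]
  have "\<exists>M. mat_in (qdim r (Suc i)) (qdim r i) M \<and> (\<forall>q\<in>J i. mv (qdim r i) M (\<epsilon> i q) = \<epsilon> (Suc i) q)" if "i < t" for i
    using that J_mono[of i "Suc i"] by (intro exists_matrix[OF \<epsilon> finite_J] \<epsilon>v) auto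
  then obtain A0 where A0: "\<And>i. i < t \<Longrightarrow> mat_in (qdim r (Suc i)) (qdim r i) (A0 i)"
    "\<And>i q. i < t \<Longrightarrow> q \<in> J i \<Longrightarrow> mv (qdim r i) (A0 i) (\<epsilon> i q) = \<epsilon> (Suc i) q" by metis
  have "\<exists>M. mat_in (qdim r i) (qdim r (Suc i)) M \<and>
      (\<forall>q\<in>J (Suc i). mv (qdim r (Suc i)) M (\<epsilon> (Suc i) q) = (if snd q = 1 then (\<lambda>_. 0) else \<epsilon> i (fst q, snd q - 1)))" if "i < t" for i
    using that J_pred by (intro exists_matrix[OF \<epsilon> finite_J]) (auto intro!: \<epsilon>v simp: vec_in_def[of _ "\<lambda>_. 0"])
  then obtain B0 where B0: "\<And>i. i < t \<Longrightarrow> mat_in (qdim r i) (qdim r (Suc i)) (B0 i)"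
    "\<And>i q. i < t \<Longrightarrow> q \<in> J (Suc i) \<Longrightarrow> mv (qdim r (Suc i)) (B0 i) (\<epsilon> (Suc i) q) = (if snd q = 1 then (\<lambda>_. 0) else \<epsilon> i (fst q, snd q - 1))"
    by metis
  define A where "A i = (if i < t then A0 i else (\<lambda>_ _. 0))" for i
  define B where "B i = (if i < t then B0 i else (\<lambda>_ _. 0))" for i
  \<comment> \<open>The factor 1 gives the sum the shape expected by \<open>mv_sum\<close>.\<close>
  define u where "u i = (if i \<le> t then (\<lambda>a. \<Sum>k\<in>{k. 1 \<le> k \<and> tailI i < \<mu> k}. 1 * \<epsilon> i (k, \<mu> k - tailI i) a) else (\<lambda>_. 0))" for i
  have A: "mv (qdim r i) (A i) (\<epsilon> i q) = \<epsilon> (Suc i) q" if "i < t" "q \<in> J i" for i q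
    using A0(2)[OF that] that by (simp add: A_def)
  have B: "mv (qdim r (Suc i)) (B i) (\<epsilon> (Suc i) (k, j)) = (if j = 1 then (\<lambda>_. 0) else \<epsilon> i (k, j - 1))"
    if "i < t" "(k, j) \<in> J (Suc i)" for i k j
    using B0(2)[OF that] that by (simp add: B_def)
  have uv: "vec_in (qdim r i) (u i)" for i
    by (cases "i \<le> t") (auto simp: u_def vec_in_def[of _ "\<lambda>_. 0"] intro!: vec_in_sum[where c = "\<lambda>_. 1", simplified] \<epsilon>v tailI_J)
  define p where "p = (u, A, B)"
  have sel: "fst p = u" "fst (snd p) = A" "snd (snd p) = B" by (simp_all add: p_def)
  have BA: "mv (qdim r (Suc i)) (B i) (mv (qdim r i) (A i) w) = mv (qdim r (i - 1)) (A (i - 1)) (mv (qdim r i) (B (i - 1)) w)"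
    if i: "1 \<le> i" "i < t" and w: "vec_in (qdim r i) w" for i w
  proof -
    obtain i' where i': "i = Suc i'" using i(1) by (cases i) auto
    let ?F = "\<lambda>w. mv (qdim r (Suc i)) (B i) (mv (qdim r i) (A i) w)"
      and ?G = "\<lambda>w. mv (qdim r i') (A i') (mv (qdim r i) (B i') w)"
    have bas: "?F (\<epsilon> i q) = ?G (\<epsilon> i q)" if "q \<in> J i" for q
    proof -
      obtain k j where q: "q = (k, j)" by (cases q)
      have qJ: "(k, j) \<in> J (Suc i)" using that J_mono[of i "Suc i"] q by auto
      have "?F (\<epsilon> i q) = (if j = 1 then (\<lambda>_. 0) else \<epsilon> i (k, j - 1))"
        using A[OF i(2) that] B[OF i(2) qJ] by (simp add: q)
      moreover have "?G (\<epsilon> i q) = (if j = 1 then (\<lambda>_. 0) else \<epsilon> i (k, j - 1))"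
      proof (cases "j = 1")
        case True
        then show ?thesis using B[of i' k j] that q i i' by (simp add: mv_zero)
      next
        case False
        then show ?thesis using B[of i' k j] A[of i' "(k, j - 1)"] J_pred[of k j i'] that q i i' by simp
      qed
      ultimately show ?thesis by simp
    qed
    have ex: "w = (\<lambda>a. \<Sum>q\<in>J i. bco (qdim r i) (J i) (\<epsilon> i) w q * \<epsilon> i q a)"
      using bco_expand[OF \<epsilon> w] i by simp
    have "?F w = (\<lambda>a. \<Sum>q\<in>J i. bco (qdim r i) (J i) (\<epsilon> i) w q * ?F (\<epsilon> i q) a)"
      by (subst ex) (simp only: mv_sum)
    also have "\<dots> = (\<lambda>a. \<Sum>q\<in>J i. bco (qdim r i) (J i) (\<epsilon> i) w q * ?G (\<epsilon> i q) a)"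
      using bas by simp
    also have "\<dots> = ?G w" by (subst (2) ex) (simp only: mv_sum)
    finally show ?thesis by (simp add: i')
  qed
  have pX: "p \<in> X"
  proof (rule enh_quiverI; unfold sel)
    fix i a b :: nat
    show "u i a = 0" if "\<not> (i \<le> t \<and> a < qdim r i)"
      using that uv[of i] by (cases "i \<le> t") (auto simp: vec_in_def u_def)
    show "A i a b = 0" if "\<not> (i < t \<and> a < qdim r (Suc i) \<and> b < qdim r i)"
      using that A0(1)[of i] by (cases "i < t") (auto simp: mat_in_def A_def)
    show "B i a b = 0" if "\<not> (i < t \<and> a < qdim r i \<and> b < qdim r (Suc i))"
      using that B0(1)[of i] by (cases "i < t") (auto simp: mat_in_def B_def)
    show "(\<Sum>c<qdim r (Suc i). B i a c * A i c b) = (\<Sum>c<qdim r (i - 1). A (i - 1) a c * B (i - 1) c b)"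
      if i: "1 \<le> i" "i \<le> t - 1" "a < qdim r i" "b < qdim r i"
    proof -
      have "i < t" using i by simp
      from fun_cong[OF BA[OF i(1) this vec_in_unit[OF i(4)]], of a] i(1) show ?thesis
        unfolding mv_unit[OF i(4)] by (simp add: mv_def)
    qed
    show "(\<Sum>c<qdim r (Suc i). B i a c * u (Suc i) c) = u i a" if i: "i \<in> I" "a < qdim r i"
    proof -
      have it: "i < t" using i(1) I_sub by auto
      let ?K = "{k. 1 \<le> k \<and> tailI (Suc i) < \<mu> k}"
      have "mv (qdim r (Suc i)) (B i) (u (Suc i)) = (\<lambda>a. \<Sum>k\<in>?K. 1 * mv (qdim r (Suc i)) (B i) (\<epsilon> (Suc i) (k, \<mu> k - tailI (Suc i))) a)"
        using it unfolding u_def by (simp only: mv_sum Suc_leI if_True)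
      \<comment> \<open>Rows with \<open>\<mu> k = tailI i\<close> sit at the bottom of their chain
        at vertex \<open>Suc i\<close>, and B_i kills them.\<close>
      also have "\<dots> = (\<lambda>a. \<Sum>k\<in>?K. if tailI i < \<mu> k then \<epsilon> i (k, \<mu> k - tailI i) a else 0)"
      proof (intro ext sum.cong refl)
        fix a k assume k: "k \<in> ?K"
        then have kJ: "(k, \<mu> k - tailI (Suc i)) \<in> J (Suc i)" using it by (intro tailI_J) auto
        show "1 * mv (qdim r (Suc i)) (B i) (\<epsilon> (Suc i) (k, \<mu> k - tailI (Suc i))) a = (if tailI i < \<mu> k then \<epsilon> i (k, \<mu> k - tailI i) a else 0)"
          using k unfolding B[OF it kJ] tailI_in[OF i(1)] by auto
      qed
      also have "\<dots> = u i"
      proof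
        fix a
        have "(\<Sum>k\<in>?K. if tailI i < \<mu> k then \<epsilon> i (k, \<mu> k - tailI i) a else 0)
          = (\<Sum>k\<in>{k. 1 \<le> k \<and> tailI i < \<mu> k}. 1 * \<epsilon> i (k, \<mu> k - tailI i) a)"
        proof (rule sum.mono_neutral_cong_right[OF finite_mu])
          show "{k. 1 \<le> k \<and> tailI i < \<mu> k} \<subseteq> ?K" using tailI_in[OF i(1)] by auto
        qed auto
        then show "(\<Sum>k\<in>?K. if tailI i < \<mu> k then \<epsilon> i (k, \<mu> k - tailI i) a else 0) = u i a"
          using it by (simp add: u_def)
      qed
      finally show ?thesis by (auto simp: mv_def fun_eq_iff)
    qed
    show "(\<Sum>c<qdim r i. A i a c * u i c) = u (Suc i) a" if i: "i < t" "i \<notin> I" "a < qdim r (Suc i)"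
    proof -
      let ?K = "{k. 1 \<le> k \<and> tailI i < \<mu> k}"
      have "mv (qdim r i) (A i) (u i) = (\<lambda>a. \<Sum>k\<in>?K. 1 * mv (qdim r i) (A i) (\<epsilon> i (k, \<mu> k - tailI i)) a)"
        using i unfolding u_def by (simp only: mv_sum less_imp_le if_True)
      also have "\<dots> = (\<lambda>a. \<Sum>k\<in>?K. 1 * \<epsilon> (Suc i) (k, \<mu> k - tailI i) a)"
      proof (intro ext sum.cong refl)
        fix a k assume k: "k \<in> ?K"
        then have kJ: "(k, \<mu> k - tailI i) \<in> J i" using i by (intro tailI_J) auto
        show "1 * mv (qdim r i) (A i) (\<epsilon> i (k, \<mu> k - tailI i)) a = 1 * \<epsilon> (Suc i) (k, \<mu> k - tailI i) a"
          unfolding A[OF i(1) kJ] ..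
      qed
      also have "\<dots> = u (Suc i)" using i tailI_notin[OF i(2)] by (simp add: u_def)
      finally show ?thesis by (auto simp: mv_def fun_eq_iff)
    qed
  qed
  have ut: "u t = v" unfolding u_def v by (simp add: tailI_t \<epsilon>_def)
  have xm: "xmat t r p = x"
  proof (rule mat_eq_on_basis[OF e mat_xmat[OF pX]])
    show "mat_in n n x" using nx by (simp add: nilpotent_mat_def)
    fix q assume q: "q \<in> bip_index \<mu> \<nu>"
    obtain k j where kj: "q = (k, j)" by (cases q)
    obtain t' where t': "t = Suc t'" using t_pos by (cases t) auto
    have qJ: "(k, j) \<in> J (Suc t')" using q kj J_t t' by simp
    have e\<epsilon>: "e = \<epsilon> (Suc t')" by (simp add: \<epsilon>_def t')
    have "mv n (xmat t r p) (e q) = mv (qdim r t') (A t') (mv (qdim r (Suc t')) (B t') (\<epsilon> (Suc t') (k, j)))"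
      unfolding mv_xmat Top_def Aop_def Bop_def sel by (simp add: t' e\<epsilon> kj)
    also have "\<dots> = (if j = 1 then (\<lambda>_. 0) else e (k, j - 1))"
      using B[of t' k j] A[of t' "(k, j - 1)"] J_pred[of k j t'] qJ t' by (simp add: mv_zero e\<epsilon>)
    finally show "mv n (xmat t r p) (e q) = mv n x (e q)" using xe[of k j] q kj by simp
  qed
  have "adapted p \<epsilon>"
    unfolding adapted_def
  proof (intro conjI allI impI pX \<epsilon> ballI)
    show "Aop p i (\<epsilon> i q) = \<epsilon> (Suc i) q" if "i < t" "q \<in> J i" for i q
      using A[OF that] by (simp add: Aop_def sel)
    show "case q of (k, j) \<Rightarrow> Bop p i (\<epsilon> (Suc i) (k, j)) = (if j = 1 then \<lambda>_. 0 else \<epsilon> i (k, j - 1))"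
      if "i < t" "q \<in> J (Suc i)" for i q
      using B[OF that(1)] that(2) by (auto simp: Bop_def sel)
    show "fst p t = (\<lambda>a. \<Sum>k\<in>{k. 1 \<le> k \<and> 0 < \<mu> k}. \<epsilon> t (k, \<mu> k) a)"
      by (simp add: sel ut v \<epsilon>_def)
  qed
  moreover have "qproj t r p = (v, x)" by (simp add: qproj_def sel ut xm)
  ultimately show ?thesis by blast
qed

end

section \<open>A Zariski neighbourhood of a lifted point maps into the orbit\<close>

context bipartition
begin

lemma adaptedD:
  assumes "adapted p \<epsilon>"
  shows "p \<in> X"
    and "i \<le> t \<Longrightarrow> is_basis_family (qdim r i) (J i) (\<epsilon> i)"
    and "i < t \<Longrightarrow> q \<in> J i \<Longrightarrow> Aop p i (\<epsilon> i q) = \<epsilon> (Suc i) q"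
    and "i < t \<Longrightarrow> (k, j) \<in> J (Suc i) \<Longrightarrow> Bop p i (\<epsilon> (Suc i) (k, j)) = (if j = 1 then (\<lambda>_. 0) else \<epsilon> i (k, j - 1))"
    and "fst p t = (\<lambda>a. \<Sum>k\<in>{k. 1 \<le> k \<and> 0 < \<mu> k}. \<epsilon> t (k, \<mu> k) a)"
proof -
  have *: "p \<in> X" "\<forall>i\<le>t. is_basis_family (qdim r i) (J i) (\<epsilon> i)"
     "\<forall>i<t. \<forall>q\<in>J i. Aop p i (\<epsilon> i q) = \<epsilon> (Suc i) q"
     "\<forall>i<t. \<forall>(k, j)\<in>J (Suc i). Bop p i (\<epsilon> (Suc i) (k, j)) = (if j = 1 then (\<lambda>_. 0) else \<epsilon> i (k, j - 1))"
     "fst p t = (\<lambda>a. \<Sum>k\<in>{k. 1 \<le> k \<and> 0 < \<mu> k}. \<epsilon> t (k, \<mu> k) a)"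
    using assms unfolding adapted_def by - (elim conjE; assumption)+
  show "Bop p i (\<epsilon> (Suc i) (k, j)) = (if j = 1 then (\<lambda>_. 0) else \<epsilon> i (k, j - 1))" if "i < t" "(k, j) \<in> J (Suc i)"
    using bspec[OF mp[OF spec[OF *(4), of i] that(1)] that(2)] unfolding prod.case .
qed (use assms in \<open>simp_all add: adapted_def\<close>)

lemma Aop_scale: "Aop p i (\<lambda>a. c * w a) = (\<lambda>a. c * Aop p i w a)"
  and Bop_scale: "Bop p i (\<lambda>a. c * w a) = (\<lambda>a. c * Bop p i w a)"
  and Bop_diff: "Bop p i (\<lambda>a. w a - w' a) = (\<lambda>a. Bop p i w a - Bop p i w' a)"
  and Aop_zero: "Aop p i (\<lambda>_. 0) = (\<lambda>_. 0)"
  by (simp_all add: Aop_def Bop_def mv_scale mv_diff mv_zero)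

lemma Top_scale: "Top p i (\<lambda>a. c * w a) = (\<lambda>a. c * Top p i w a)"
  by (simp add: Top_def Aop_scale Bop_scale)

lemma Top_sum: "Top p t (\<lambda>a. \<Sum>i\<in>S. x i * w i a) = (\<lambda>a. \<Sum>i\<in>S. x i * Top p t (w i) a)"
  unfolding mv_xmat[symmetric] by (rule mv_sum)

lemma vec_Top: "p \<in> X \<Longrightarrow> vec_in n (Top p t w)"
  unfolding mv_xmat[symmetric] by (rule mv_vec_in[OF mat_xmat])

lemma vec_Top_pow: "p \<in> X \<Longrightarrow> vec_in n w \<Longrightarrow> vec_in n ((Top p t ^^ b) w)"
  by (induction b) (auto intro: vec_Top)

lemma Aop_polyfun:
  assumes "i < t" "\<And>b. b < qdim r i \<Longrightarrow> (\<lambda>p. w p b) \<in> P" "a < qdim r (Suc i)"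
  shows "(\<lambda>p. Aop p i (w p) a) \<in> P"
  unfolding Aop_def mv_def
proof (intro polyfun_sum pf_mult)
  fix b assume b: "b \<in> {..<qdim r i}"
  then show "(\<lambda>p. fst (snd p) i a b) \<in> P" using assms
    by (intro pf_coord) (auto simp: quiver_coords_eq)
  show "(\<lambda>p. w p b) \<in> P" using b assms by simp
qed

lemma Bop_polyfun:
  assumes "i < t" "\<And>b. b < qdim r (Suc i) \<Longrightarrow> (\<lambda>p. w p b) \<in> P" "a < qdim r i"
  shows "(\<lambda>p. Bop p i (w p) a) \<in> P"
  unfolding Bop_def mv_def
proof (intro polyfun_sum pf_mult)
  fix b assume b: "b \<in> {..<qdim r (Suc i)}"
  then show "(\<lambda>p. snd (snd p) i a b) \<in> P" using assms
    by (intro pf_coord) (auto simp: quiver_coords_eq)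
  show "(\<lambda>p. w p b) \<in> P" using b assms by simp
qed

text \<open>The relation is carried from vertex l to l + 1 by A_l. On the right, w = B_l w' turns
  A_l w into \<open>Top p (Suc l) w'\<close>. On the left, A_l u_l is u_(l+1) for l outside
  \<open>I\<close> and A_l B_l u_(l+1) for l in \<open>I\<close>, which adds one power. For i = t -
  lam k and l = t, \<open>card_I_tail\<close> turns this into: x^(\<mu> k) u_t lies in the image of
  x^(lam k).\<close>

lemma u_image_power:
  assumes p: "p \<in> X" and surj: "\<And>l w. l < t \<Longrightarrow> vec_in (qdim r l) w \<Longrightarrow> \<exists>w'. vec_in (qdim r (Suc l)) w' \<and> Bop p l w' = w"
    and il: "i \<le> l" "l \<le> t"
  shows "\<exists>w. vec_in (qdim r l) w \<and> (Top p l ^^ card (I \<inter> {i..<l})) (fst p l) = (Top p l ^^ (l - i)) w"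
  using il
proof (induction l rule: dec_induct)
  case base
  then show ?case using vecu[OF p, of i] by (intro exI[of _ "fst p i"]) simp
next
  case (step l)
  then obtain w where w: "vec_in (qdim r l) w" "(Top p l ^^ card (I \<inter> {i..<l})) (fst p l) = (Top p l ^^ (l - i)) w" by auto
  have lt: "l < t" using step by simp
  obtain w' where w': "vec_in (qdim r (Suc l)) w'" "Bop p l w' = w" using surj[OF lt w(1)] by blast
  have T: "Top p (Suc l) x = Aop p l (Bop p l x)" for x by (simp add: Top_def)
  have "(Top p (Suc l) ^^ (Suc l - i)) w' = (Top p (Suc l) ^^ (l - i)) (Aop p l w)"
    using step(1) w' T by (simp add: Suc_diff_le funpow_swap1)
  also have "\<dots> = Aop p l ((Top p l ^^ card (I \<inter> {i..<l})) (fst p l))"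
    unfolding Top_pow_Aop[OF p lt] w(2) ..
  also have "\<dots> = (Top p (Suc l) ^^ card (I \<inter> {i..<Suc l})) (fst p (Suc l))"
  proof (cases "l \<in> I")
    case True
    then have "I \<inter> {i..<Suc l} = insert l (I \<inter> {i..<l})" using step(1) by auto
    then have "card (I \<inter> {i..<Suc l}) = Suc (card (I \<inter> {i..<l}))" by simp
    then show ?thesis
      by (simp add: funpow_swap1 T Bop_u[OF p True] Top_pow_Aop[OF p lt])
  next
    case False
    then have "I \<inter> {i..<Suc l} = I \<inter> {i..<l}" by (auto simp: less_Suc_eq)
    then show ?thesis by (simp add: Aop_u[OF p lt False, symmetric] Top_pow_Aop[OF p lt])
  qed
  finally show ?case using w'(1) by metis
qed

text \<open>x lowers the place in a chain by one, so the coordinate at place j after m applications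
  stems from place j + m. If that is beyond the end of the chain, both sides are 0 by the convention
  in \<open>bco\<close>.\<close>

lemma coordinate_shift:
  assumes p: "p \<in> X" and b: "is_basis_family n (J t) E"
    and chain: "\<And>k j. (k, j) \<in> J t \<Longrightarrow> Top p t (E (k, j)) = (if j = 1 then (\<lambda>_. 0) else E (k, j - 1))"
    and w: "vec_in n w" and j: "1 \<le> j"
  shows "bco n (J t) E ((Top p t ^^ m) w) (k, j) = bco n (J t) E w (k, j + m)"
  using w j
proof (induction m arbitrary: j)
  case 0
  then show ?case by simp
next
  case (Suc m)
  define v where "v = (Top p t ^^ m) w"
  have v: "vec_in n v" unfolding v_def by (rule vec_Top_pow[OF p w])
  let ?c = "bco n (J t) E v"
  define c' where "c' q = (if q \<in> J t then ?c (fst q, Suc (snd q)) else 0)" for q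
  have "bco n (J t) E (Top p t v) = c'"
  proof (rule bco_unique[OF b vec_Top[OF p]])
    show "c' q = 0" if "q \<notin> J t" for q using that by (simp add: c'_def)
    show "Top p t v = (\<lambda>a. \<Sum>q\<in>J t. c' q * E q a)"
    proof
      fix a
      have "Top p t v a = (\<Sum>q\<in>J t. ?c q * Top p t (E q) a)"
        using arg_cong[OF bco_expand[OF b v], of "Top p t"] unfolding Top_sum by metis
      also have "\<dots> = (\<Sum>q\<in>{q \<in> J t. snd q \<noteq> 1}. ?c q * E (fst q, snd q - 1) a)"
        by (rule sum.mono_neutral_cong_right[OF finite_J]) (auto simp: chain)
      also have "\<dots> = (\<Sum>q\<in>{q \<in> J t. (fst q, Suc (snd q)) \<in> J t}. ?c (fst q, Suc (snd q)) * E q a)"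
        by (rule sum.reindex_bij_witness[of _ "\<lambda>q. (fst q, Suc (snd q))" "\<lambda>q. (fst q, snd q - 1)"]) (auto simp: J_def)
      also have "\<dots> = (\<Sum>q\<in>J t. c' q * E q a)"
        by (rule sum.mono_neutral_cong_left[OF finite_J]) (auto simp: c'_def bco_outside[OF b v])
      finally show "Top p t v a = (\<Sum>q\<in>J t. c' q * E q a)" .
    qed
  qed
  then have "bco n (J t) E ((Top p t ^^ Suc m) w) (k, j) = c' (k, j)" by (simp add: v_def)
  also have "c' (k, j) = ?c (k, Suc j)"
    using Suc.prems bco_outside[OF b v, of "(k, Suc j)"] by (auto simp: c'_def J_def)
  also have "\<dots> = bco n (J t) E w (k, j + Suc m)"
    using Suc.IH[OF w, of "Suc j"] by (simp add: v_def)
  finally show ?case .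
qed

lemma outside_J: "lam k < j + (t - i) \<Longrightarrow> (k, j) \<notin> J i"
  by (simp add: J_def)

text \<open>Let \<open>R0\<close> be the right inverse of B_i at \<open>p0\<close> that raises the
  place in each chain by one. At a general point B_i \<open>R0\<close> is a matrix that becomes the
  identity at \<open>p0\<close>; composing \<open>R0\<close> with the adjugate of this matrix gives
  a right inverse up to the determinant \<delta>. At \<open>p0\<close> the adjugate is the identity,
  so the lifts there are those by \<open>R0\<close>.\<close>

lemma polynomial_right_inverse:
  assumes ad: "adapted p0 \<epsilon>" and i: "i < t"
  shows "\<exists>\<delta> R. \<delta> \<in> P \<and> \<delta> p0 = 1 \<and>
    (\<forall>p\<in>X. \<forall>w. vec_in (qdim r i) w \<longrightarrow> vec_in (qdim r (Suc i)) (R p w) \<and> Bop p i (R p w) = (\<lambda>a. \<delta> p * w a)) \<and>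
    (\<forall>w. (\<forall>a<qdim r i. (\<lambda>p. w p a) \<in> P) \<longrightarrow> (\<forall>a<qdim r (Suc i). (\<lambda>p. R p (w p) a) \<in> P)) \<and>
    (\<forall>q\<in>J i. R p0 (\<epsilon> i q) = \<epsilon> (Suc i) (fst q, Suc (snd q))) \<and> R p0 (\<lambda>_. 0) = (\<lambda>_. 0)"
proof -
  let ?m = "qdim r i" and ?m' = "qdim r (Suc i)"
  have p0: "p0 \<in> X" and b: "is_basis_family ?m (J i) (\<epsilon> i)" and b': "is_basis_family ?m' (J (Suc i)) (\<epsilon> (Suc i))"
    and B: "\<And>k j. (k, j) \<in> J (Suc i) \<Longrightarrow> Bop p0 i (\<epsilon> (Suc i) (k, j)) = (if j = 1 then (\<lambda>_. 0) else \<epsilon> i (k, j - 1))"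
    using adaptedD[OF ad] i by simp_all
  have up: "(fst q, Suc (snd q)) \<in> J (Suc i)" if "q \<in> J i" for q
    using that i by (cases q) (auto simp: J_def)
  obtain R0 where R0: "mat_in ?m' ?m R0" "\<And>q. q \<in> J i \<Longrightarrow> mv ?m R0 (\<epsilon> i q) = \<epsilon> (Suc i) (fst q, Suc (snd q))"
  proof -
    have "\<exists>R0. mat_in ?m' ?m R0 \<and> (\<forall>q\<in>J i. mv ?m R0 (\<epsilon> i q) = \<epsilon> (Suc i) (fst q, Suc (snd q)))"
      by (rule exists_matrix[OF b finite_J]) (rule basis_vec_in[OF b' up])
    then show ?thesis using that by blast
  qed
  define M where "M a c p = (\<Sum>d<?m'. snd (snd p) i a d * R0 d c)" for a c and p :: quiver_pt
  have BM: "Bop p i (mv ?m R0 w) = mv ?m (\<lambda>a c. M a c p) w" for p w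
    unfolding Bop_def mv_compose by (simp add: mv_def M_def)
  have M0: "M a c p0 = (if a = c then 1 else 0)" if ac: "a < ?m" "c < ?m" for a c
  proof -
    have "mv ?m (\<lambda>a c. M a c p0) (unit_vec' c) = mv ?m (\<lambda>a c. if a = c \<and> a < ?m then 1 else 0) (unit_vec' c)"
    proof (rule mv_eq_on_basis[OF b vec_in_unit[OF ac(2)]])
      fix q assume q: "q \<in> J i"
      have "mv ?m (\<lambda>a c. M a c p0) (\<epsilon> i q) = \<epsilon> i q"
        unfolding BM[symmetric] R0(2)[OF q] using B[of "fst q" "Suc (snd q)"] up[OF q] q by (auto simp: J_def)
      also have "\<epsilon> i q = mv ?m (\<lambda>a c. if a = c \<and> a < ?m then 1 else 0) (\<epsilon> i q)"
      proof
        fix a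
        have "mv ?m (\<lambda>a c. if a = c \<and> a < ?m then 1 else 0) (\<epsilon> i q) a = (\<Sum>c<?m. if c = a then \<epsilon> i q c else 0)"
          unfolding mv_def by (intro sum.cong) auto
        then show "\<epsilon> i q a = mv ?m (\<lambda>a c. if a = c \<and> a < ?m then 1 else 0) (\<epsilon> i q) a"
          using basis_vec_in[OF b q] by (auto simp: vec_in_def)
      qed
      finally show "mv ?m (\<lambda>a c. M a c p0) (\<epsilon> i q) = mv ?m (\<lambda>a c. if a = c \<and> a < ?m then 1 else 0) (\<epsilon> i q)" .
    qed (rule bco_expand[OF b vec_in_unit[OF ac(2)]])
    from fun_cong[OF this, of a] show ?thesis unfolding mv_unit[OF ac(2)] using ac by simp
  qed
  have MP: "M a c \<in> P" if "a < ?m" for a c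
    unfolding M_def[abs_def]
  proof (intro polyfun_sum pf_mult pf_const)
    fix d assume "d \<in> {..<?m'}"
    then show "(\<lambda>p. snd (snd p) i a d) \<in> P" using that i by (intro pf_coord) (auto simp: quiver_coords_eq)
  qed
  have "\<forall>a<?m. \<forall>c<?m. M a c \<in> P \<and> M a c p0 = (if a = c then 1 else 0)" using MP M0 by simp
  from polyfun_adjugate[OF this] obtain \<delta> N where \<delta>: "\<delta> \<in> P" "\<delta> p0 = 1"
    and N: "\<forall>i<?m. \<forall>j<?m. N i j \<in> P \<and> N i j p0 = (if i = j then 1 else 0)"
    and MN: "\<forall>p. \<forall>i<?m. \<forall>j<?m. (\<Sum>k<?m. M i k p * N k j p) = (if i = j then \<delta> p else 0)"
    by (elim exE conjE)
  have MN1: "(\<Sum>k<?m. M i k p * N k j p) = (if i = j then \<delta> p else 0)" if "i < ?m" "j < ?m" for i j p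
    using spec[OF MN, of p] that by blast
  define N' where "N' p a c = (if a < ?m then N a c p else 0)" for p a c
  define R where "R p w = mv ?m R0 (mv ?m (N' p) w)" for p w
  have R1: "vec_in ?m' (R p w)" for p w unfolding R_def by (rule mv_vec_in[OF R0(1)])
  have R2: "Bop p i (R p w) = (\<lambda>a. \<delta> p * w a)" if p: "p \<in> X" and w: "vec_in ?m w" for p w
  proof
    fix a
    show "Bop p i (R p w) a = \<delta> p * w a"
    proof (cases "a < ?m")
      case True
      have "Bop p i (R p w) a = (\<Sum>c<?m. (\<Sum>k<?m. M a k p * N k c p) * w c)"
        unfolding R_def BM[of p "mv ?m (N' p) w"] by (simp add: mv_compose N'_def)
      also have "\<dots> = (\<Sum>c<?m. if c = a then \<delta> p * w c else 0)"
        using True by (intro sum.cong refl) (simp add: MN1)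
      finally show ?thesis using True by simp
    next
      case False
      then show ?thesis using vec_Bop[OF p, of i "R p w"] w by (simp add: vec_in_def)
    qed
  qed
  have R3: "(\<lambda>p. R p (w p) a) \<in> P" if "\<forall>a<?m. (\<lambda>p. w p a) \<in> P" for w a
    unfolding R_def mv_def
  proof (intro polyfun_sum pf_mult pf_const)
    fix c d assume cd: "c \<in> {..<?m}" "d \<in> {..<?m}"
    have "(\<lambda>p. N' p c d) = N c d" using cd by (simp add: N'_def)
    then show "(\<lambda>p. N' p c d) \<in> P" using N cd by simp
    show "(\<lambda>p. w p d) \<in> P" using that cd by simp
  qed
  have R4: "R p0 (\<epsilon> i q) = \<epsilon> (Suc i) (fst q, Suc (snd q))" if q: "q \<in> J i" for q
  proof -
    have "mv ?m (N' p0) (\<epsilon> i q) = \<epsilon> i q"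
    proof
      fix a
      have "mv ?m (N' p0) (\<epsilon> i q) a = (\<Sum>c<?m. if c = a then \<epsilon> i q c else 0)"
        unfolding mv_def using N by (intro sum.cong refl) (auto simp: N'_def)
      then show "mv ?m (N' p0) (\<epsilon> i q) a = \<epsilon> i q a" using basis_vec_in[OF b q] by (auto simp: vec_in_def)
    qed
    then show ?thesis by (simp add: R_def R0(2)[OF q])
  qed
  show ?thesis
    by (intro exI[of _ \<delta>] exI[of _ R] conjI ballI allI impI \<delta> R1 R2 R4 R3)
      (assumption | simp add: R_def mv_zero)+
qed

text \<open>Induction on the vertex. Since divisions are replaced by factors \<delta>, the chain
  relations hold on all of \<open>X\<close>; only linear independence may be lost away from
  \<open>p0\<close>.\<close>

lemma polynomial_chains:
  assumes ad: "adapted p0 \<epsilon>"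
  shows "i \<le> t \<Longrightarrow> \<exists>E. (\<forall>q\<in>J i. (\<forall>a<qdim r i. (\<lambda>p. E q p a) \<in> P) \<and> E q p0 = \<epsilon> i q \<and> (\<forall>p\<in>X. vec_in (qdim r i) (E q p))) \<and>
    (\<forall>p\<in>X. \<forall>k j. (k, j) \<in> J i \<longrightarrow> Top p i (E (k, j) p) = (if j = 1 then (\<lambda>_. 0) else E (k, j - 1) p))"
proof (induction i)
  case 0
  show ?case by (simp add: J_0)
next
  case (Suc i)
  then have i: "i < t" by simp
  let ?m = "qdim r i" and ?m' = "qdim r (Suc i)"
  from Suc.IH[OF less_imp_le[OF i]] obtain E where
    E1: "\<forall>q\<in>J i. (\<forall>a<?m. (\<lambda>p. E q p a) \<in> P) \<and> E q p0 = \<epsilon> i q \<and> (\<forall>p\<in>X. vec_in ?m (E q p))"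
    and chain1: "\<forall>p\<in>X. \<forall>k j. (k, j) \<in> J i \<longrightarrow> Top p i (E (k, j) p) = (if j = 1 then (\<lambda>_. 0) else E (k, j - 1) p)"
    by (elim exE conjE)
  have EP: "(\<lambda>p. E q p a) \<in> P" if "q \<in> J i" "a < ?m" for q a using E1 that by blast
  have E0: "E q p0 = \<epsilon> i q" if "q \<in> J i" for q using E1 that by blast
  have Ev: "vec_in ?m (E q p)" if "q \<in> J i" "p \<in> X" for q p using E1 that by blast
  have chain: "Top p i (E (k, j) p) = (if j = 1 then (\<lambda>_. 0) else E (k, j - 1) p)"
    if "p \<in> X" "(k, j) \<in> J i" for p k j using chain1 that by blast
  from polynomial_right_inverse[OF ad i] obtain \<delta> R where \<delta>: "\<delta> \<in> P" "\<delta> p0 = 1"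
    and R1: "\<forall>p\<in>X. \<forall>w. vec_in ?m w \<longrightarrow> vec_in ?m' (R p w) \<and> Bop p i (R p w) = (\<lambda>a. \<delta> p * w a)"
    and R2: "\<forall>w. (\<forall>a<?m. (\<lambda>p. w p a) \<in> P) \<longrightarrow> (\<forall>a<?m'. (\<lambda>p. R p (w p) a) \<in> P)"
    and R3: "\<forall>q\<in>J i. R p0 (\<epsilon> i q) = \<epsilon> (Suc i) (fst q, Suc (snd q))" and R00: "R p0 (\<lambda>_. 0) = (\<lambda>_. 0)"
    by (elim exE conjE)
  have Rv: "vec_in ?m' (R p w)" and BR: "Bop p i (R p w) = (\<lambda>a. \<delta> p * w a)"
    if "p \<in> X" "vec_in ?m w" for p w using R1 that by blast+
  have RP: "(\<lambda>p. R p (w p) a) \<in> P" if "\<forall>a<?m. (\<lambda>p. w p a) \<in> P" "a < ?m'" for w a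
    using mp[OF spec[OF R2, of w] that(1)] that(2) by simp
  have R0: "R p0 (\<epsilon> i q) = \<epsilon> (Suc i) (fst q, Suc (snd q))" if "q \<in> J i" for q using R3 that by blast
  have p0: "p0 \<in> X" and b': "is_basis_family ?m' (J (Suc i)) (\<epsilon> (Suc i))"
    and A: "\<And>q. q \<in> J i \<Longrightarrow> Aop p0 i (\<epsilon> i q) = \<epsilon> (Suc i) q"
    and B: "\<And>k j. (k, j) \<in> J (Suc i) \<Longrightarrow> Bop p0 i (\<epsilon> (Suc i) (k, j)) = (if j = 1 then (\<lambda>_. 0) else \<epsilon> i (k, j - 1))"
    using adaptedD[OF ad] i by simp_all
  \<comment> \<open>Vectors of old chains are pushed forward by A_i, the new top of an old chain is
    a lift of its former top by \<open>R\<close>, and a chain born at this vertex is a single vector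
    corrected to lie in the kernel of B_i. The factor \<delta> in the first case matches the factor
    that B_i \<open>R\<close> produces in the second.\<close>
  define E' where "E' q p = (if q \<in> J i then (\<lambda>a. \<delta> p * Aop p i (E q p) a)
      else if snd q \<noteq> 1 then R p (E (fst q, snd q - 1) p)
      else (\<lambda>a. \<delta> p * \<epsilon> (Suc i) q a - R p (Bop p i (\<epsilon> (Suc i) q)) a))" for q p
  have pred: "(fst q, snd q - 1) \<in> J i" if "q \<in> J (Suc i)" "snd q \<noteq> 1" for q
    using J_pred[of "fst q" "snd q" i] that by simp
  have T: "Top p (Suc i) w = Aop p i (Bop p i w)" for p w by (simp add: Top_def)
  show ?case
  proof (intro exI[of _ E'] conjI ballI allI impI)
    fix q assume q: "q \<in> J (Suc i)"
    show "(\<lambda>p. E' q p a) \<in> P" if a: "a < ?m'" for a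
    proof -
      consider "q \<in> J i" | "q \<notin> J i" "snd q \<noteq> 1" | "q \<notin> J i" "snd q = 1" by blast
      then show ?thesis
      proof cases
        case 1
        then show ?thesis unfolding E'_def using pf_mult[OF \<delta>(1) Aop_polyfun[OF i EP[OF 1] a]] by simp
      next
        case 2
        have "(\<lambda>p. R p (E (fst q, snd q - 1) p) a) \<in> P"
          by (rule RP[OF _ a]) (use EP[OF pred[OF q 2(2)]] in simp)
        then show ?thesis unfolding E'_def using 2 by simp
      next
        case 3
        have "(\<lambda>p. R p (Bop p i (\<epsilon> (Suc i) q)) a) \<in> P"
          by (rule RP[OF _ a]) (intro allI impI Bop_polyfun[OF i] pf_const)
        then show ?thesis unfolding E'_def using 3 polyfun_minus[OF pf_mult[OF \<delta>(1) pf_const]] by simp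
      qed
    qed
    show "E' q p0 = \<epsilon> (Suc i) q"
    proof -
      consider "q \<in> J i" | "q \<notin> J i" "snd q \<noteq> 1" | "q \<notin> J i" "snd q = 1" by blast
      then show ?thesis
      proof cases
        case 1
        then show ?thesis by (simp add: E'_def \<delta> E0 A)
      next
        case 2
        then have "snd q - 1 + 1 = snd q" using q by (cases q) (auto simp: J_def)
        then show ?thesis using 2 E0[OF pred[OF q 2(2)]] R0[OF pred[OF q 2(2)]] by (simp add: E'_def)
      next
        case 3
        then have "Bop p0 i (\<epsilon> (Suc i) q) = (\<lambda>_. 0)" using B[of "fst q" "snd q"] q by (cases q) simp
        then show ?thesis using 3 by (simp add: E'_def \<delta> R00)
      qed
    qed
    show "vec_in ?m' (E' q p)" if p: "p \<in> X" for p
    proof -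
      consider "q \<in> J i" | "q \<notin> J i" "snd q \<noteq> 1" | "q \<notin> J i" "snd q = 1" by blast
      then show ?thesis
      proof cases
        case 1
        then show ?thesis using vec_Aop[OF p, of i "E q p"] by (simp add: E'_def vec_in_def)
      next
        case 2
        then show ?thesis using Rv[OF p Ev[OF pred[OF q 2(2)] p]] by (simp add: E'_def)
      next
        case 3
        then show ?thesis using Rv[OF p vec_Bop[OF p], of "\<epsilon> (Suc i) q"] basis_vec_in[OF b' q]
          by (simp add: E'_def vec_in_def)
      qed
    qed
  next
    fix p k j assume p: "p \<in> X" and q: "(k, j) \<in> J (Suc i)"
    consider "(k, j) \<in> J i" | "(k, j) \<notin> J i" "j \<noteq> 1" | "(k, j) \<notin> J i" "j = 1" by blast
    then show "Top p (Suc i) (E' (k, j) p) = (if j = 1 then (\<lambda>_. 0) else E' (k, j - 1) p)"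
    proof cases
      case 1
      have "Top p (Suc i) (E' (k, j) p) = (\<lambda>a. \<delta> p * Aop p i (if j = 1 then (\<lambda>_. 0) else E (k, j - 1) p) a)"
        using 1 chain[OF p 1] by (simp add: E'_def Top_scale Top_Aop[OF p i])
      moreover have "(k, j - 1) \<in> J i" if "j \<noteq> 1" using 1 that by (auto simp: J_def)
      ultimately show ?thesis by (auto simp: E'_def Aop_zero)
    next
      case 2
      then have "(k, j - 1) \<in> J i" using J_pred[OF q] by simp
      then show ?thesis using 2 unfolding E'_def T by (simp add: BR[OF p Ev[OF _ p]] Aop_scale)
    next
      case 3
      then show ?thesis unfolding E'_def T
        by (simp add: Bop_diff Bop_scale BR[OF p vec_Bop[OF p]] Aop_zero)
    qed
  qed
qed

text \<open>Three kinds of factors make up \<open>D\<close>: \<open>\<delta>\<close> turns the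
  transported chains into a basis, the \<open>ds i\<close> make the B_i surjective, which bounds the
  place of v in each chain, and \<open>\<delta>2\<close> keeps the chains a basis after they have
  been adapted to v.\<close>

lemma lifted_neighbourhood:
  assumes ad: "adapted p0 \<epsilon>"
  shows "\<exists>D\<in>P. D p0 \<noteq> 0 \<and> (\<forall>p\<in>X. D p \<noteq> 0 \<longrightarrow> qproj t r p \<in> enh_orbit n \<mu> \<nu>)"
proof -
  let ?J = "J t"
  let ?K = "{k. 1 \<le> k \<and> 0 < \<mu> k}"
  have p0: "p0 \<in> X" and b0: "is_basis_family n ?J (\<epsilon> t)" and v0: "fst p0 t = (\<lambda>a. \<Sum>k\<in>?K. \<epsilon> t (k, \<mu> k) a)"
    using adaptedD(1)[OF ad] adaptedD(2)[OF ad, of t] adaptedD(5)[OF ad] qdim_t by simp_all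
  have cJ: "card ?J = n" using card_J[of t] qdim_t by simp
  have "\<forall>i. \<exists>\<delta>. i < t \<longrightarrow> \<delta> \<in> P \<and> \<delta> p0 = 1 \<and> (\<forall>p\<in>X. \<forall>w. vec_in (qdim r i) w \<longrightarrow>
      (\<exists>w'. vec_in (qdim r (Suc i)) w' \<and> Bop p i w' = (\<lambda>a. \<delta> p * w a)))"
  proof
    fix i
    show "\<exists>\<delta>. i < t \<longrightarrow> \<delta> \<in> P \<and> \<delta> p0 = 1 \<and> (\<forall>p\<in>X. \<forall>w. vec_in (qdim r i) w \<longrightarrow>
      (\<exists>w'. vec_in (qdim r (Suc i)) w' \<and> Bop p i w' = (\<lambda>a. \<delta> p * w a)))"
    proof (cases "i < t")
      case True
      from polynomial_right_inverse[OF ad True] obtain \<delta> R where \<delta>: "\<delta> \<in> P" "\<delta> p0 = 1"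
        and R: "\<forall>p\<in>X. \<forall>w. vec_in (qdim r i) w \<longrightarrow> vec_in (qdim r (Suc i)) (R p w) \<and> Bop p i (R p w) = (\<lambda>a. \<delta> p * w a)"
        by (elim exE conjE)
      show ?thesis
        by (intro exI[of _ \<delta>] impI conjI \<delta> ballI allI) (use R in blast)
    qed simp
  qed
  from choice[OF this] obtain ds where ds0: "\<forall>i. i < t \<longrightarrow> ds i \<in> P \<and> ds i p0 = 1 \<and> (\<forall>p\<in>X. \<forall>w. vec_in (qdim r i) w \<longrightarrow>
      (\<exists>w'. vec_in (qdim r (Suc i)) w' \<and> Bop p i w' = (\<lambda>a. ds i p * w a)))" by (rule exE)
  have ds: "ds i \<in> P" "ds i p0 = 1" if "i < t" for i using ds0 that by blast+
  have Rs: "\<exists>w'. vec_in (qdim r (Suc i)) w' \<and> Bop p i w' = (\<lambda>a. ds i p * w a)"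
    if "i < t" "p \<in> X" "vec_in (qdim r i) w" for i p w using ds0 that by blast
  from polynomial_chains[OF ad order_refl, unfolded qdim_t] obtain E where
    E1: "\<forall>q\<in>?J. (\<forall>a<n. (\<lambda>p. E q p a) \<in> P) \<and> E q p0 = \<epsilon> t q \<and> (\<forall>p\<in>X. vec_in n (E q p))"
    and chain1: "\<forall>p\<in>X. \<forall>k j. (k, j) \<in> ?J \<longrightarrow> Top p t (E (k, j) p) = (if j = 1 then (\<lambda>_. 0) else E (k, j - 1) p)"
    by (elim exE conjE)
  have EP: "(\<lambda>p. E q p a) \<in> P" if "q \<in> ?J" "a < n" for q a using E1 that by blast
  have E0: "E q p0 = \<epsilon> t q" if "q \<in> ?J" for q using E1 that by blast
  have Ev: "vec_in n (E q p)" if "q \<in> ?J" "p \<in> X" for q p using E1 that by blast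
  have chain: "Top p t (E (k, j) p) = (if j = 1 then (\<lambda>_. 0) else E (k, j - 1) p)"
    if "p \<in> X" "(k, j) \<in> ?J" for p k j using chain1 that by blast
  have bcong: "is_basis_family n ?J e'" if "\<And>q. q \<in> ?J \<Longrightarrow> e' q = \<epsilon> t q" for e'
    using b0 that unfolding is_basis_family_def by simp
  have bE0: "is_basis_family n ?J (\<lambda>q. E q p0)" by (rule bcong) (rule E0)
  have EP_all: "\<forall>q\<in>?J. \<forall>a<n. (\<lambda>p. E q p a) \<in> P" using E1 by blast
  from polyfun_dual_basis[OF bE0 finite_J cJ EP_all] obtain \<delta> N where \<delta>: "\<delta> \<in> P" "\<delta> p0 = 1"
    and NP: "\<forall>q\<in>?J. \<forall>a<n. N q a \<in> P"
    and N1: "\<forall>p. \<forall>a<n. \<forall>c<n. (\<Sum>q\<in>?J. N q a p * E q p c) = (if a = c then \<delta> p else 0)"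
    and N2: "\<forall>p. \<forall>q\<in>?J. \<forall>q'\<in>?J. (\<Sum>a<n. N q a p * E q' p a) = (if q = q' then \<delta> p else 0)"
    by (elim exE conjE)
  \<comment> \<open>Where \<open>\<delta> p\<close> is nonzero these are the coordinates of u_t in
    the chains \<open>E\<close>, multiplied by \<open>\<delta> p\<close>; the definition itself
    involves no division.\<close>
  define c where "c q p = (\<Sum>a<n. N q a p * fst p t a)" for q and p :: quiver_pt
  have cP: "c q \<in> P" if "q \<in> ?J" for q
    unfolding c_def[abs_def]
  proof (intro polyfun_sum pf_mult)
    fix a assume "a \<in> {..<n}"
    then show "N q a \<in> P" using NP that by simp
    show "(\<lambda>p. fst p t a) \<in> P" using \<open>a \<in> {..<n}\<close> qdim_t
      by (intro pf_coord) (auto simp: quiver_coords_eq)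
  qed
  have dual: "is_basis_family n ?J (\<lambda>q. E q p)" "\<And>q. q \<in> ?J \<Longrightarrow> \<delta> p * bco n ?J (\<lambda>q. E q p) (fst p t) q = c q p"
    if "p \<in> X" "\<delta> p \<noteq> 0" for p
    using basis_of_dual[OF finite_J, of t n "\<lambda>q. E q p" "\<delta> p" "\<lambda>q a. N q a p"] Ev that N1 N2 vecu[OF that(1), of t] qdim_t
    by (simp_all add: c_def)
  have KJ: "(k, \<mu> k) \<in> ?J" if "k \<in> ?K" for k using that by (auto simp: J_def lam_def)
  have c0: "c (k, j) p0 = (if j = \<mu> k then 1 else 0)" if kj: "(k, j) \<in> ?J" for k j
  proof -
    have b: "is_basis_family n ?J (\<lambda>q. E q p0)" using dual(1)[OF p0] \<delta> by simp
    have "c (k, j) p0 = bco n ?J (\<lambda>q. E q p0) (fst p0 t) (k, j)"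
      using dual(2)[OF p0 _ kj] \<delta> by simp
    also have "fst p0 t = (\<lambda>a. \<Sum>k\<in>?K. 1 * E (k, \<mu> k) p0 a)"
      unfolding v0 using E0 KJ by (intro ext sum.cong) auto
    also have "bco n ?J (\<lambda>q. E q p0) \<dots> (k, j) = (\<Sum>k'\<in>?K. 1 * bco n ?J (\<lambda>q. E q p0) (E (k', \<mu> k') p0) (k, j))"
      by (subst bco_sum[OF b, of ?K "\<lambda>k. E (k, \<mu> k) p0" "\<lambda>_. 1"]) (rule Ev[OF KJ p0], simp_all)
    also have "\<dots> = (\<Sum>k'\<in>?K. if k' = k then (if j = \<mu> k then 1 else 0) else 0)"
      using bco_basis[OF b finite_J KJ] by (intro sum.cong refl) auto
    also have "\<dots> = (if j = \<mu> k then 1 else 0)"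
      using finite_mu[of 0] kj by (auto simp: sum.delta J_def)
    finally show ?thesis .
  qed
  \<comment> \<open>To each chain a polynomial in the downward shift is applied, with coefficients
    read off from v, so that its vector at place \<open>\<mu> k\<close> becomes \<delta> times the
    part of v in places 1 to \<open>\<mu> k\<close> of chain k. The shift is the action of x, so the
    results are again chains; those with \<open>\<mu> k = 0\<close> are left alone.\<close>
  define E2 where "E2 q p = (if \<mu> (fst q) = 0 then E q p
      else (\<lambda>a. \<Sum>m<min (snd q) (\<mu> (fst q)). c (fst q, \<mu> (fst q) - m) p * E (fst q, snd q - m) p a))" for q p
  have J1: "(k, l - m) \<in> ?J" "(k, \<mu> k - m) \<in> ?J" if "(k, l) \<in> ?J" "m < min l (\<mu> k)" for k l m
    using that by (auto simp: J_def lam_def)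
  have E2P: "(\<lambda>p. E2 q p a) \<in> P" if q: "q \<in> ?J" and a: "a < n" for q a
  proof -
    obtain k l where kl: "q = (k, l)" by (cases q)
    have "(\<lambda>p. \<Sum>m<min l (\<mu> k). c (k, \<mu> k - m) p * E (k, l - m) p a) \<in> P"
    proof (intro polyfun_sum pf_mult)
      fix m assume "m \<in> {..<min l (\<mu> k)}"
      then show "c (k, \<mu> k - m) \<in> P" "(\<lambda>p. E (k, l - m) p a) \<in> P"
        using J1[of k l m] q kl cP EP a by auto
    qed
    then show ?thesis using EP[OF q a] unfolding E2_def kl by (cases "\<mu> k = 0") simp_all
  qed
  have E20: "E2 q p0 = \<epsilon> t q" if q: "q \<in> ?J" for q
  proof -
    obtain k l where kl: "q = (k, l)" by (cases q)
    have l: "1 \<le> l" using q kl by (simp add: J_def)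
    show ?thesis
    proof (cases "\<mu> k = 0")
      case True
      then show ?thesis using E0[OF q] by (simp add: E2_def kl)
    next
      case False
      have "(\<Sum>m<min l (\<mu> k). c (k, \<mu> k - m) p0 * E (k, l - m) p0 a) = (\<Sum>m<min l (\<mu> k). if m = 0 then E (k, l) p0 a else 0)" for a
        using c0 J1(2)[of k l] q kl by (intro sum.cong refl) auto
      then show ?thesis using False l E0[OF q] by (simp add: E2_def kl fun_eq_iff)
    qed
  qed
  have E2v: "vec_in n (E2 q p)" if q: "q \<in> ?J" and p: "p \<in> X" for q p
  proof -
    obtain k l where kl: "q = (k, l)" by (cases q)
    have "vec_in n (\<lambda>a. \<Sum>m<min l (\<mu> k). c (k, \<mu> k - m) p * E (k, l - m) p a)"
      by (rule vec_in_sum) (use J1[of k l] q kl Ev p in auto)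
    then show ?thesis using Ev[OF q p] by (simp add: E2_def kl)
  qed
  have chain2: "Top p t (E2 (k, l) p) = (if l = 1 then (\<lambda>_. 0) else E2 (k, l - 1) p)"
    if p: "p \<in> X" and q: "(k, l) \<in> ?J" for p k l
  proof (cases "\<mu> k = 0")
    case True
    then show ?thesis using chain[OF p q] by (simp add: E2_def)
  next
    case False
    have "Top p t (E2 (k, l) p) = (\<lambda>a. \<Sum>m<min l (\<mu> k). c (k, \<mu> k - m) p * Top p t (E (k, l - m) p) a)"
      using False by (simp add: E2_def Top_sum)
    also have "\<dots> = (\<lambda>a. \<Sum>m<min (l - 1) (\<mu> k). c (k, \<mu> k - m) p * E (k, l - 1 - m) p a)"
    proof
      fix a
      show "(\<Sum>m<min l (\<mu> k). c (k, \<mu> k - m) p * Top p t (E (k, l - m) p) a)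
        = (\<Sum>m<min (l - 1) (\<mu> k). c (k, \<mu> k - m) p * E (k, l - 1 - m) p a)"
      proof (rule sum.mono_neutral_cong_right)
        show "\<forall>m\<in>{..<min l (\<mu> k)} - {..<min (l - 1) (\<mu> k)}. c (k, \<mu> k - m) p * Top p t (E (k, l - m) p) a = 0"
        proof
          fix m assume m: "m \<in> {..<min l (\<mu> k)} - {..<min (l - 1) (\<mu> k)}"
          then have "l - m = 1" by auto
          then show "c (k, \<mu> k - m) p * Top p t (E (k, l - m) p) a = 0"
            using chain[OF p J1(1)[OF q, of m]] m by simp
        qed
        show "c (k, \<mu> k - m) p * Top p t (E (k, l - m) p) a = c (k, \<mu> k - m) p * E (k, l - 1 - m) p a"
          if "m \<in> {..<min (l - 1) (\<mu> k)}" for m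
        proof -
          have h: "(l - m = 1) = False" "l - m - 1 = l - 1 - m" using that by auto
          have "Top p t (E (k, l - m) p) = (if l - m = 1 then (\<lambda>_. 0) else E (k, l - m - 1) p)"
            by (rule chain[OF p J1(1)[OF q]]) (use that in auto)
          then show ?thesis unfolding h if_False by simp
        qed
      qed auto
    qed
    finally show ?thesis using False by (auto simp: E2_def)
  qed
  have bE20: "is_basis_family n ?J (\<lambda>q. E2 q p0)" by (rule bcong) (rule E20)
  have E2P_all: "\<forall>q\<in>?J. \<forall>a<n. (\<lambda>p. E2 q p a) \<in> P" using E2P by blast
  from polyfun_dual_basis[OF bE20 finite_J cJ E2P_all] obtain \<delta>2 N' where \<delta>2: "\<delta>2 \<in> P" "\<delta>2 p0 = 1"
    and N1': "\<forall>p. \<forall>a<n. \<forall>c<n. (\<Sum>q\<in>?J. N' q a p * E2 q p c) = (if a = c then \<delta>2 p else 0)"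
    and N2': "\<forall>p. \<forall>q\<in>?J. \<forall>q'\<in>?J. (\<Sum>a<n. N' q a p * E2 q' p a) = (if q = q' then \<delta>2 p else 0)"
    by (elim exE conjE)
  define D where "D p = \<delta> p * \<delta>2 p * (\<Prod>i<t. ds i p)" for p
  have DP: "D \<in> P" unfolding D_def[abs_def]
    by (intro pf_mult polyfun_prod \<delta>(1) \<delta>2(1) ds(1)) simp
  have D0: "D p0 = 1" by (simp add: D_def \<delta> \<delta>2 ds)
  have "qproj t r p \<in> enh_orbit n \<mu> \<nu>" if p: "p \<in> X" and Dp: "D p \<noteq> 0" for p
  proof -
    have d: "\<delta> p \<noteq> 0" "\<delta>2 p \<noteq> 0" "\<And>i. i < t \<Longrightarrow> ds i p \<noteq> 0" using Dp by (auto simp: D_def)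
    let ?E = "\<lambda>q. E q p"
    note bE = dual(1)[OF p d(1)]
    have v: "vec_in n (fst p t)" using vecu[OF p, of t] qdim_t by simp
    have bE2: "is_basis_family n ?J (\<lambda>q. E2 q p)"
      using basis_of_dual(1)[OF finite_J, of t n "\<lambda>q. E2 q p" "\<delta>2 p" "\<lambda>q a. N' q a p"] E2v p d N1' N2' by simp
    \<comment> \<open>Division by \<open>\<delta> p\<close> undoes the scaling contained in
      \<open>c\<close>.\<close>
    define e where "e q = (\<lambda>a. 1 / \<delta> p * E2 q p a)" for q
    have be: "is_basis_family n ?J e" unfolding e_def by (rule basis_scale[OF bE2]) (use d in simp)
    have shift: "bco n ?J ?E ((Top p t ^^ m) w) (k, j) = bco n ?J ?E w (k, j + m)"
      if "vec_in n w" "1 \<le> j" for w k j m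
      by (rule coordinate_shift[OF p bE _ that]) (rule chain[OF p])
    have surj: "\<exists>w'. vec_in (qdim r (Suc l)) w' \<and> Bop p l w' = w" if "l < t" "vec_in (qdim r l) w" for l w
    proof -
      have "vec_in (qdim r l) (\<lambda>a. 1 / ds l p * w a)" using that by (simp add: vec_in_def)
      from Rs[OF that(1) p this] show ?thesis using d(3)[OF that(1)] by simp
    qed
    \<comment> \<open>Surjectivity of all B_l gives x^(\<mu> k) v = x^(lam k) w for some w.
      Comparing coordinates at (k, j - \<mu> k) identifies the coordinate of v at (k, j) with one of
      w beyond the end of chain k.\<close>
    have vanish: "bco n ?J ?E (fst p t) (k, j) = 0" if kj: "(k, j) \<in> ?J" "\<mu> k < j" for k j
    proof -
      have k: "1 \<le> k" using kj by (simp add: J_def)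
      obtain w where w: "vec_in n w"
        "(Top p t ^^ card (I \<inter> {t - lam k..<t})) (fst p t) = (Top p t ^^ (t - (t - lam k))) w"
        using u_image_power[OF p surj, of "t - lam k" t] qdim_t by auto
      have "bco n ?J ?E (fst p t) (k, j) = bco n ?J ?E ((Top p t ^^ \<mu> k) (fst p t)) (k, j - \<mu> k)"
        using shift[OF v, of "j - \<mu> k" "\<mu> k" k] kj by simp
      also have "\<dots> = bco n ?J ?E ((Top p t ^^ lam k) w) (k, j - \<mu> k)"
        using w(2) card_I_tail[OF k] lam_le[OF k] by simp
      also have "\<dots> = bco n ?J ?E w (k, j - \<mu> k + lam k)"
        using kj by (intro shift[OF w(1)]) simp
      also have "\<dots> = 0" by (rule bco_outside[OF bE w(1) outside_J]) (use kj in simp)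
      finally show ?thesis .
    qed
    have vform: "fst p t = (\<lambda>a. \<Sum>i\<in>?K. e (i, \<mu> i) a)"
    proof
      fix a
      let ?c = "bco n ?J ?E (fst p t)"
      have "(\<Sum>i\<in>?K. e (i, \<mu> i) a) = (\<Sum>k\<in>?K. \<Sum>m<\<mu> k. ?c (k, \<mu> k - m) * E (k, \<mu> k - m) p a)"
      proof (rule sum.cong[OF refl])
        fix k assume k: "k \<in> ?K"
        have "c (k, \<mu> k - m) p = \<delta> p * ?c (k, \<mu> k - m)" if "m < \<mu> k" for m
          using dual(2)[OF p d(1) J1(2)[OF KJ[OF k], of m]] that by simp
        then show "e (k, \<mu> k) a = (\<Sum>m<\<mu> k. ?c (k, \<mu> k - m) * E (k, \<mu> k - m) p a)"
          using k d(1) by (simp add: e_def E2_def sum_divide_distrib)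
      qed
      also have "\<dots> = (\<Sum>k\<in>?K. \<Sum>j\<in>{1..\<mu> k}. ?c (k, j) * E (k, j) p a)"
      proof (rule sum.cong[OF refl])
        fix k
        show "(\<Sum>m<\<mu> k. ?c (k, \<mu> k - m) * E (k, \<mu> k - m) p a) = (\<Sum>j\<in>{1..\<mu> k}. ?c (k, j) * E (k, j) p a)"
          by (rule sum.reindex_bij_witness[of _ "\<lambda>j. \<mu> k - j" "\<lambda>m. \<mu> k - m"]) auto
      qed
      also have "\<dots> = (\<Sum>q\<in>(SIGMA k:?K. {1..\<mu> k}). ?c q * E q p a)"
        by (subst sum.Sigma[OF finite_mu]) (simp_all add: case_prod_unfold)
      also have "\<dots> = (\<Sum>q\<in>?J. ?c q * E q p a)"
      proof (rule sum.mono_neutral_left[OF finite_J])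
        show "(SIGMA k:?K. {1..\<mu> k}) \<subseteq> ?J" by (auto simp: J_def lam_def)
        show "\<forall>q\<in>?J - (SIGMA k:?K. {1..\<mu> k}). ?c q * E q p a = 0"
        proof
          fix q assume q: "q \<in> ?J - (SIGMA k:?K. {1..\<mu> k})"
          then have "\<mu> (fst q) < snd q" by (cases q) (auto simp: J_def not_le)
          then show "?c q * E q p a = 0" using vanish[of "fst q" "snd q"] q by simp
        qed
      qed
      also have "\<dots> = fst p t a" using fun_cong[OF bco_expand[OF bE v], of a] by simp
      finally show "fst p t a = (\<Sum>i\<in>?K. e (i, \<mu> i) a)" by simp
    qed
    have nil: "nilpotent_mat n (xmat t r p)"
      unfolding nilpotent_mat_def mv_xmat
    proof (intro conjI exI[of _ t] allI impI mat_xmat[OF p])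
      fix w assume w: "vec_in n w"
      have "bco n ?J ?E ((Top p t ^^ t) w) q = 0" if q: "q \<in> ?J" for q
      proof -
        obtain k j where kj: "q = (k, j)" by (cases q)
        have k: "1 \<le> k" "1 \<le> j" using q kj by (auto simp: J_def)
        have "bco n ?J ?E ((Top p t ^^ t) w) (k, j) = bco n ?J ?E w (k, j + t)" by (rule shift[OF w k(2)])
        also have "\<dots> = 0" by (rule bco_outside[OF bE w outside_J]) (use lam_le[OF k(1)] k in simp)
        finally show ?thesis by (simp add: kj)
      qed
      then show "(Top p t ^^ t) w = (\<lambda>_. 0)"
        using bco_expand[OF bE vec_Top_pow[OF p w, of t]] by simp
    qed
    have che: "mv n (xmat t r p) (e (i, j)) = (if j = 1 then (\<lambda>_. 0) else e (i, j - 1))" if "(i, j) \<in> ?J" for i j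
      unfolding mv_xmat e_def Top_scale chain2[OF p that] by auto
    show ?thesis
      unfolding enh_orbit_def qproj_def mem_Collect_eq prod.case
      using v nil be che vform by (intro conjI exI[of _ e]) (auto simp: J_t)
  qed
  then show ?thesis using DP D0 by (intro bexI[of _ D]) auto
qed

end

section \<open>Normality of the orbit closure\<close>

lemma quiver_coordsI:
  "i \<le> t \<Longrightarrow> a < qdim r i \<Longrightarrow> (\<lambda>p. fst p i a) \<in> quiver_coords t r"
  "i < t \<Longrightarrow> a < qdim r (Suc i) \<Longrightarrow> b < qdim r i \<Longrightarrow> (\<lambda>p. fst (snd p) i a b) \<in> quiver_coords t r"
  "i < t \<Longrightarrow> a < qdim r i \<Longrightarrow> b < qdim r (Suc i) \<Longrightarrow> (\<lambda>p. snd (snd p) i a b) \<in> quiver_coords t r"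
  unfolding quiver_coords_eq Un_iff mem_Collect_eq by metis+

lemma normal_variety_empty: "normal_variety C {}"
  unfolding normal_variety_def
proof (intro ballI impI)
  fix f :: "'a \<Rightarrow> complex"
  show "\<exists>h\<in>polyfun C. \<forall>x\<in>{}. f x = h x * g x" for g
    by (rule bexI[OF _ pf_const[of 0]]) simp
qed

context bipartition
begin

lemma polyfun_qproj:
  assumes f: "f \<in> polyfun (VN_coords n)"
  shows "(\<lambda>p. f (qproj t r p)) \<in> P"
proof (rule polyfun_subst[OF f])
  fix c assume "c \<in> VN_coords n"
  then consider a where "c = (\<lambda>q. fst q a)" "a < n" | a b where "c = (\<lambda>q. snd q a b)" "a < n" "b < n"
    unfolding VN_coords_eq Un_iff mem_Collect_eq by (elim disjE exE conjE) metis+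
  then show "(\<lambda>p. c (qproj t r p)) \<in> P"
  proof cases
    case 1
    then show ?thesis using qdim_t by (intro pf_coord) (auto simp: qproj_def quiver_coords_eq)
  next
    case 2
    obtain t' where t': "t = Suc t'" using t_pos by (cases t) auto
    have "(\<lambda>p. \<Sum>c<qdim r t'. fst (snd p) t' a c * snd (snd p) t' c b) \<in> P"
    proof (intro polyfun_sum pf_mult)
      fix d assume d: "d \<in> {..<qdim r t'}"
      have n: "qdim r (Suc t') = n" using qdim_t t' by simp
      show "(\<lambda>p. fst (snd p) t' a d) \<in> P"
        by (intro pf_coord quiver_coordsI) (use 2 d n t' in auto)
      show "(\<lambda>p. snd (snd p) t' d b) \<in> P"
        by (intro pf_coord quiver_coordsI) (use 2 d n t' in auto)
    qed
    then show ?thesis unfolding 2(1) qproj_def xmat_def t' by simp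
  qed
qed

theorem orbit_closure_normal:
  assumes nv: "normal_variety (quiver_coords t r) X"
  shows "normal_variety (VN_coords n) (zariski_closure (VN_ambient n) (VN_coords n) (enh_orbit n \<mu> \<nu>))"
proof (cases "enh_orbit n \<mu> \<nu> = {}")
  case True
  \<comment> \<open>On an empty orbit the constant 1 vanishes vacuously, so the closure is empty and
    trivially normal.\<close>
  have "zariski_closure (VN_ambient n) (VN_coords n) {} = {}"
    unfolding zariski_closure_def using pf_const[of 1 "VN_coords n"] by force
  then show ?thesis by (simp add: True normal_variety_empty)
next
  case False
  let ?C = "VN_coords n" and ?O = "enh_orbit n \<mu> \<nu>"
  let ?Y = "zariski_closure (VN_ambient n) ?C ?O"
  let ?\<pi> = "qproj t r"
  have lift: "\<exists>p\<in>X. ?\<pi> p = y" if "y \<in> ?O" for y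
    using orbit_lift[of "fst y" "snd y"] that adaptedD(1) by auto
  obtain p0 \<epsilon> where ad: "adapted p0 \<epsilon>" using False orbit_lift by fast
  have p0: "p0 \<in> X" by (rule adaptedD(1)[OF ad])
  from lifted_neighbourhood[OF ad] obtain D where D: "D \<in> P" "D p0 \<noteq> 0"
    and DO: "\<forall>p\<in>X. D p \<noteq> 0 \<longrightarrow> ?\<pi> p \<in> ?O" by (elim bexE conjE)
  note dom = quiver_domain[OF nv refl]
  \<comment> \<open>A polynomial vanishing on the orbit, composed with the projection and multiplied
    by \<open>D\<close>, vanishes on \<open>X\<close>; and \<open>D\<close> is a non-zero-divisor
    there.\<close>
  have \<pi>Y: "?\<pi> p \<in> ?Y" if p: "p \<in> X" for p
    unfolding zariski_closure_def mem_Collect_eq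
  proof (intro conjI ballI impI)
    show "?\<pi> p \<in> VN_ambient n"
      using vecu[OF p, of t] mat_xmat[OF p] qdim_t by (simp add: qproj_def VN_ambient_def)
    fix q assume q: "q \<in> polyfun ?C" and q0: "\<forall>y\<in>?O. q y = 0"
    show "q (?\<pi> p) = 0"
    proof (rule dom[OF D(1) p0 D(2) polyfun_qproj[OF q] _ p])
      show "D p' * q (?\<pi> p') = 0" if "p' \<in> X" for p' using DO q0 that by auto
    qed
  qed
  \<comment> \<open>The image of \<open>X\<close> contains the orbit, so a polynomial identity
    checked on \<open>X\<close> extends to the closure.\<close>
  have ext: "\<forall>y\<in>?Y. q y = 0" if q: "q \<in> polyfun ?C" and q0: "\<And>p. p \<in> X \<Longrightarrow> q (?\<pi> p) = 0" for q
  proof -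
    have "\<forall>y\<in>?O. q y = 0" using q0 lift by metis
    then show ?thesis unfolding zariski_closure_def using q by blast
  qed
  show ?thesis
    unfolding normal_variety_def
  proof (intro ballI impI)
    fix f g assume f: "f \<in> polyfun ?C" and g: "g \<in> polyfun ?C"
      and reg: "\<forall>h\<in>polyfun ?C. (\<forall>x\<in>?Y. g x * h x = 0) \<longrightarrow> (\<forall>x\<in>?Y. h x = 0)"
      and "\<exists>m>0. \<exists>a. (\<forall>i. a i \<in> polyfun ?C) \<and> (\<forall>x\<in>?Y. f x ^ m + (\<Sum>i = 1..m. a i x * f x ^ (m - i) * g x ^ i) = 0)"
    then obtain m a where m: "m > 0" and a: "\<forall>i. a i \<in> polyfun ?C"
      and eq: "\<forall>x\<in>?Y. f x ^ m + (\<Sum>i = 1..m. a i x * f x ^ (m - i) * g x ^ i) = 0"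
      by (elim exE conjE)
    \<comment> \<open>If g vanished on Y, it would kill the constant 1, contrary to its being a
      non-zero-divisor on the nonempty set Y. One point with nonzero value is enough to make the
      pullback a non-zero-divisor on \<open>X\<close>.\<close>
    have "\<exists>p1\<in>X. g (?\<pi> p1) \<noteq> 0"
    proof (rule ccontr)
      assume "\<not> ?thesis"
      then have "\<forall>y\<in>?Y. g y = 0" by (intro ext[OF g]) simp
      then have "\<forall>y\<in>?Y. (1::complex) = 0" by (intro mp[OF bspec[OF reg pf_const]]) simp
      from bspec[OF this \<pi>Y[OF p0]] show False by simp
    qed
    then obtain p1 where p1: "p1 \<in> X" "g (?\<pi> p1) \<noteq> 0" by blast
    have "\<exists>h\<in>P. \<forall>p\<in>X. f (?\<pi> p) = h p * g (?\<pi> p)"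
    proof (rule normal_varietyD[OF nv polyfun_qproj[OF f] polyfun_qproj[OF g] _ m, of "\<lambda>i p. a i (?\<pi> p)"])
      show "\<forall>p\<in>X. h p = 0" if "h \<in> P" "\<forall>p\<in>X. g (?\<pi> p) * h p = 0" for h
        by (intro ballI dom[OF polyfun_qproj[OF g] p1 that(1)]) (use that(2) in blast)+
      show "(\<lambda>p. a i (?\<pi> p)) \<in> P" for i by (rule polyfun_qproj[OF spec[OF a]])
      show "f (?\<pi> p) ^ m + (\<Sum>i = 1..m. a i (?\<pi> p) * f (?\<pi> p) ^ (m - i) * g (?\<pi> p) ^ i) = 0" if "p \<in> X" for p
        using bspec[OF eq \<pi>Y[OF that]] .
    qed
    then obtain h where h: "h \<in> P" "\<And>p. p \<in> X \<Longrightarrow> f (?\<pi> p) = h p * g (?\<pi> p)" by (elim bexE) simp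
    have "\<exists>h'\<in>polyfun ?C. \<forall>p\<in>X. f (?\<pi> p) = h' (?\<pi> p) * g (?\<pi> p)"
      by (rule quotient_descends[OF t_pos refl h(1), unfolded qdim_t]) (rule h(2))
    then obtain h' where h': "h' \<in> polyfun ?C"
      "\<forall>p\<in>X. f (?\<pi> p) = h' (?\<pi> p) * g (?\<pi> p)" by (elim bexE)
    have "(\<lambda>y. f y - h' y * g y) \<in> polyfun ?C" by (intro polyfun_minus pf_mult f g h'(1))
    then have "\<forall>y\<in>?Y. f y - h' y * g y = 0" by (rule ext) (use h'(2) in simp)
    then show "\<exists>h\<in>polyfun ?C. \<forall>y\<in>?Y. f y = h y * g y" by (intro bexI[OF _ h'(1)]) simp
  qed
qed

end

theorem theorem4p11:
  fixes \<mu> \<nu> :: "nat \<Rightarrow> nat" and n :: nat and I :: "nat set"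
  assumes "is_partition \<mu>" and "is_partition \<nu>"
    and "psize \<mu> + psize \<nu> = n" and "n \<ge> 1"
    and "is_bip_I \<mu> \<nu> I"
    and "normal_variety (quiver_coords (bip_t \<mu> \<nu>) (bip_r \<mu> \<nu>))
           (enh_quiver_variety (bip_t \<mu> \<nu>) (bip_r \<mu> \<nu>) I)"
  shows "normal_variety (VN_coords n)
           (zariski_closure (VN_ambient n) (VN_coords n) (enh_orbit n \<mu> \<nu>))"
proof -
  interpret bipartition \<mu> \<nu> n I
    by unfold_locales (use assms in simp_all)
  show ?thesis by (rule orbit_closure_normal[OF assms(6)])
qed

end
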